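(* Let $K$ be a field and let $\mathcal{A}$ be a small delta category. Then the $K$-linearization $K[\mathcal{A}]$ is separable if and only if $\mathcal{A}$ is a discrete category (i.e. its only morphisms are the identities).
   Context: Write $\mathcal{C}_0$ for the set of objects of a small category $\mathcal{C}$ and $\mathcal{C}(x,y)$ for $\mathrm{Hom}_{\mathcal{C}}(x,y)$. A category is skeletal if its only isomorphisms are automorphisms. A delta category is a skeletal category whose only endomorphisms are the identities. The $K$-linearization $K[\mathcal{A}]$ of a category $\mathcal{A}$ is the $K$-linear category with the same objects as $\mathcal{A}$, in which $K[\mathcal{A}](x,y)$ is the $K$-vector space with basis $\mathcal{A}(x,y)$, and whose composition is the bilinear extension of that of $\mathcal{A}$. A category is $K$-linear if each $\mathcal{C}(x,y)$ is a $K$-vector space and composition is $K$-bilinear; a functor between $K$-linear categories is $K$-linear if it is $K$-linear on each Hom space. Tensor products are over $K$. For a small $K$-linear category $\mathcal{C}$, $\mathcal{C}\boxtimes_K\mathcal{C}^{op}$ is the $K$-linear category whose objects are pairs $(x,y)\in\mathcal{C}_0\times\mathcal{C}_0$, with morphisms from $(x,y)$ to $(x',y')$ given by $\mathcal{C}(x,x')\otimes\mathcal{C}(y',y)$ and the evident composition. A $\mathcal{C}$-bimodule is a $K$-linear functor $M:\mathcal{C}\boxtimes_K\mathcal{C}^{op}\to K\text{-}\mathrm{Mod}$, with value ${}_xM_y$ at $(x,y)$; morphisms are natural transformations. The category of $\mathcal{C}$-bimodules is abelian with enough projectives and injectives. $\mathcal{C}$ itself is a bimodule by ${}_x\mathcal{C}_y=\mathcal{C}(y,x)$,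 with actions given by composition. Hochschild-Mitchell cohomology: $H^{n}(\mathcal{C},M):=\mathrm{Ext}^{n}_{\mathcal{C}-\mathcal{C}}(\mathcal{C},M)$, with $\mathrm{Ext}$ computed in the category of $\mathcal{C}$-bimodules. $\mathcal{C}$ is called separable if $H^{1}(\mathcal{C},M)=0$ for every $\mathcal{C}$-bimodule $M$. *)

theory Defs
  imports "HOL-Algebra.Module" "HOL-Algebra.AbelCoset" "HOL-Library.Equipollence"
begin

section \<open>Small categories\<close>

text \<open>
  Hom sets belonging to different pairs of objects need not be disjoint, so composition is indexed
  by objects: for \<open>f\<close> from \<open>x\<close> to \<open>y\<close> and \<open>g\<close> from \<open>y\<close> to \<open>z\<close>, the composite
  \<open>g \<circ> f\<close> is \<open>Comp C x y z g f\<close>.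
\<close>

record ('o, 'm) category =
  Ob :: "'o set"
  Hom :: "'o \<Rightarrow> 'o \<Rightarrow> 'm set"
  Ide :: "'o \<Rightarrow> 'm"
  Comp :: "'o \<Rightarrow> 'o \<Rightarrow> 'o \<Rightarrow> 'm \<Rightarrow> 'm \<Rightarrow> 'm"

locale category =
  fixes C :: "('o, 'm) category"
  assumes ide_closed: "x \<in> Ob C \<Longrightarrow> Ide C x \<in> Hom C x x"
    and comp_closed: "\<lbrakk>x \<in> Ob C; y \<in> Ob C; z \<in> Ob C; f \<in> Hom C x y; g \<in> Hom C y z\<rbrakk>
      \<Longrightarrow> Comp C x y z g f \<in> Hom C x z"
    and comp_ide_left: "\<lbrakk>x \<in> Ob C; y \<in> Ob C; f \<in> Hom C x y\<rbrakk> \<Longrightarrow> Comp C x y y (Ide C y) f = f"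
    and comp_ide_right: "\<lbrakk>x \<in> Ob C; y \<in> Ob C; f \<in> Hom C x y\<rbrakk> \<Longrightarrow> Comp C x x y f (Ide C x) = f"
    and comp_assoc: "\<lbrakk>w \<in> Ob C; x \<in> Ob C; y \<in> Ob C; z \<in> Ob C;
        f \<in> Hom C w x; g \<in> Hom C x y; h \<in> Hom C y z\<rbrakk>
      \<Longrightarrow> Comp C w y z h (Comp C w x y g f) = Comp C w x z (Comp C x y z h g) f"

definition isomorphism :: "('o, 'm) category \<Rightarrow> 'o \<Rightarrow> 'o \<Rightarrow> 'm \<Rightarrow> bool" where
  "isomorphism C x y f \<longleftrightarrow> f \<in> Hom C x y \<and>
     (\<exists>g \<in> Hom C y x. Comp C x y x g f = Ide C x \<and> Comp C y x y f g = Ide C y)"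

definition skeletal :: "('o, 'm) category \<Rightarrow> bool" where
  "skeletal C \<longleftrightarrow> (\<forall>x \<in> Ob C. \<forall>y \<in> Ob C. \<forall>f. isomorphism C x y f \<longrightarrow> x = y)"

definition delta_category :: "('o, 'm) category \<Rightarrow> bool" where
  "delta_category C \<longleftrightarrow> category C \<and> skeletal C \<and> (\<forall>x \<in> Ob C. \<forall>f \<in> Hom C x x. f = Ide C x)"

definition discrete_category :: "('o, 'm) category \<Rightarrow> bool" where
  "discrete_category C \<longleftrightarrow> category C \<and>
     (\<forall>x \<in> Ob C. \<forall>y \<in> Ob C. \<forall>f \<in> Hom C x y. x = y \<and> f = Ide C x)"

text \<open>
  HOL has no quantification over types, so a type \<open>'u\<close> plays the role of the universe of sets:
  a set is small if it injects into \<open>'u\<close>, and the category \<open>K\<close>-Mod consists of the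
  \<open>K\<close>-modules whose carriers are sets of elements of \<open>'u\<close>.
\<close>

definition small :: "'u itself \<Rightarrow> 'a set \<Rightarrow> bool" where
  "small U S \<longleftrightarrow> S \<lesssim> (UNIV :: 'u set)"

definition small_category :: "'u itself \<Rightarrow> ('o, 'm) category \<Rightarrow> bool" where
  "small_category U C \<longleftrightarrow> small U (Ob C) \<and> (\<forall>x \<in> Ob C. \<forall>y \<in> Ob C. small U (Hom C x y))"


section \<open>Modules over a commutative ring\<close>

text \<open>
  The record \<^typ>\<open>('k, 'v) module\<close> extends that of rings; its multiplicative fields play no role
  for modules and are left undefined.
\<close>

definition linear_map ::
    "('k, 'z) ring_scheme \<Rightarrow> ('k, 'v) module \<Rightarrow> ('k, 'w) module \<Rightarrow> ('v \<Rightarrow> 'w) \<Rightarrow> bool" where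
  "linear_map K V W h \<longleftrightarrow> h \<in> carrier V \<rightarrow> carrier W \<and>
     (\<forall>v \<in> carrier V. \<forall>v' \<in> carrier V. h (v \<oplus>\<^bsub>V\<^esub> v') = h v \<oplus>\<^bsub>W\<^esub> h v') \<and>
     (\<forall>r \<in> carrier K. \<forall>v \<in> carrier V. h (r \<odot>\<^bsub>V\<^esub> v) = r \<odot>\<^bsub>W\<^esub> h v)"

definition submodule_span ::
    "('k, 'z) ring_scheme \<Rightarrow> ('k, 'v) module \<Rightarrow> 'v set \<Rightarrow> 'v set" where
  "submodule_span K V S = \<Inter> {N. submodule N K V \<and> S \<subseteq> N}"

definition quotient_module :: "('k, 'v) module \<Rightarrow> 'v set \<Rightarrow> ('k, 'v set) module" where
  "quotient_module V N =
     \<lparr>carrier = a_rcosets\<^bsub>V\<^esub> N, mult = undefined, one = undefined,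
      zero = N, add = (<+>\<^bsub>V\<^esub>), smult = (\<lambda>r X. \<Union>v \<in> X. N +>\<^bsub>V\<^esub> (r \<odot>\<^bsub>V\<^esub> v))\<rparr>"

text \<open>The free module with basis \<open>S\<close>: finitely supported functions, zero outside \<open>S\<close>.\<close>

definition support :: "('k, 'z) ring_scheme \<Rightarrow> ('s \<Rightarrow> 'k) \<Rightarrow> 's set" where
  "support K a = {s. a s \<noteq> \<zero>\<^bsub>K\<^esub>}"

definition free_module :: "('k, 'z) ring_scheme \<Rightarrow> 's set \<Rightarrow> ('k, 's \<Rightarrow> 'k) module" where
  "free_module K S =
     \<lparr>carrier = {a. range a \<subseteq> carrier K \<and> support K a \<subseteq> S \<and> finite (support K a)},
      mult = undefined, one = undefined,
      zero = (\<lambda>s. \<zero>\<^bsub>K\<^esub>), add = (\<lambda>a b s. a s \<oplus>\<^bsub>K\<^esub> b s), smult = (\<lambda>r a s. r \<otimes>\<^bsub>K\<^esub> a s)\<rparr>"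

definition basis_vector :: "('k, 'z) ring_scheme \<Rightarrow> 's \<Rightarrow> 's \<Rightarrow> 'k" where
  "basis_vector K s = (\<lambda>t. if t = s then \<one>\<^bsub>K\<^esub> else \<zero>\<^bsub>K\<^esub>)"

text \<open>The linear map from a free module to \<open>V\<close> that sends each basis element \<open>s\<close> to \<open>\<phi> s\<close>.\<close>

definition linear_extension ::
    "('k, 'z) ring_scheme \<Rightarrow> ('k, 'v) module \<Rightarrow> ('s \<Rightarrow> 'v) \<Rightarrow> ('s \<Rightarrow> 'k) \<Rightarrow> 'v" where
  "linear_extension K V \<phi> a = (\<Oplus>\<^bsub>V\<^esub> s \<in> support K a. a s \<odot>\<^bsub>V\<^esub> \<phi> s)"

text \<open>
  The tensor product is the free module on \<open>carrier V \<times> carrier W\<close> modulo the submodule generated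
  by the bilinearity relations.
\<close>

definition tensor_relations ::
    "('k, 'z) ring_scheme \<Rightarrow> ('k, 'v) module \<Rightarrow> ('k, 'w) module \<Rightarrow> ('v \<times> 'w \<Rightarrow> 'k) set" where
  "tensor_relations K V W =
    (let F = free_module K (carrier V \<times> carrier W); \<beta> = (\<lambda>v w. basis_vector K (v, w)) in
     submodule_span K F
      ({\<beta> (v \<oplus>\<^bsub>V\<^esub> v') w \<ominus>\<^bsub>F\<^esub> (\<beta> v w \<oplus>\<^bsub>F\<^esub> \<beta> v' w) | v v' w.
          v \<in> carrier V \<and> v' \<in> carrier V \<and> w \<in> carrier W} \<union>
       {\<beta> v (w \<oplus>\<^bsub>W\<^esub> w') \<ominus>\<^bsub>F\<^esub> (\<beta> v w \<oplus>\<^bsub>F\<^esub> \<beta> v w') | v w w'.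
          v \<in> carrier V \<and> w \<in> carrier W \<and> w' \<in> carrier W} \<union>
       {\<beta> (r \<odot>\<^bsub>V\<^esub> v) w \<ominus>\<^bsub>F\<^esub> r \<odot>\<^bsub>F\<^esub> \<beta> v w | r v w.
          r \<in> carrier K \<and> v \<in> carrier V \<and> w \<in> carrier W} \<union>
       {\<beta> v (r \<odot>\<^bsub>W\<^esub> w) \<ominus>\<^bsub>F\<^esub> r \<odot>\<^bsub>F\<^esub> \<beta> v w | r v w.
          r \<in> carrier K \<and> v \<in> carrier V \<and> w \<in> carrier W}))"

definition tensor_product ::
    "('k, 'z) ring_scheme \<Rightarrow> ('k, 'v) module \<Rightarrow> ('k, 'w) module \<Rightarrow> ('k, ('v \<times> 'w \<Rightarrow> 'k) set) module"
  where "tensor_product K V W =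
    quotient_module (free_module K (carrier V \<times> carrier W)) (tensor_relations K V W)"

definition pure_tensor ::
    "('k, 'z) ring_scheme \<Rightarrow> ('k, 'v) module \<Rightarrow> ('k, 'w) module \<Rightarrow> 'v \<Rightarrow> 'w \<Rightarrow> ('v \<times> 'w \<Rightarrow> 'k) set"
  where "pure_tensor K V W v w =
    tensor_relations K V W +>\<^bsub>free_module K (carrier V \<times> carrier W)\<^esub> basis_vector K (v, w)"

text \<open>
  The linear map from a tensor product to \<open>U\<close> that is induced by a bilinear map \<open>\<beta>\<close>. An element
  \<open>t\<close> of a tensor product is a coset, and for bilinear \<open>\<beta>\<close> the value does not depend on the
  representative chosen.
\<close>

definition tensor_lift ::
    "('k, 'z) ring_scheme \<Rightarrow> ('k, 'u) module \<Rightarrow> ('v \<Rightarrow> 'w \<Rightarrow> 'u) \<Rightarrow> ('v \<times> 'w \<Rightarrow> 'k) set \<Rightarrow> 'u" where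
  "tensor_lift K U \<beta> t = linear_extension K U (\<lambda>(v, w). \<beta> v w) (SOME a. a \<in> t)"


section \<open>Linear categories\<close>

record ('o, 'm, 'k) linear_category =
  LOb :: "'o set"
  LHom :: "'o \<Rightarrow> 'o \<Rightarrow> ('k, 'm) module"
  LIde :: "'o \<Rightarrow> 'm"
  LComp :: "'o \<Rightarrow> 'o \<Rightarrow> 'o \<Rightarrow> 'm \<Rightarrow> 'm \<Rightarrow> 'm"

definition underlying_category :: "('o, 'm, 'k) linear_category \<Rightarrow> ('o, 'm) category" where
  "underlying_category C =
     \<lparr>Ob = LOb C, Hom = (\<lambda>x y. carrier (LHom C x y)), Ide = LIde C, Comp = LComp C\<rparr>"

definition linear_category :: "('k, 'z) ring_scheme \<Rightarrow> ('o, 'm, 'k) linear_category \<Rightarrow> bool" where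
  "linear_category K C \<longleftrightarrow> category (underlying_category C) \<and>
     (\<forall>x \<in> LOb C. \<forall>y \<in> LOb C. Module.module K (LHom C x y)) \<and>
     (\<forall>x \<in> LOb C. \<forall>y \<in> LOb C. \<forall>z \<in> LOb C.
        (\<forall>g \<in> carrier (LHom C y z). linear_map K (LHom C x y) (LHom C x z) (\<lambda>f. LComp C x y z g f)) \<and>
        (\<forall>f \<in> carrier (LHom C x y). linear_map K (LHom C y z) (LHom C x z) (\<lambda>g. LComp C x y z g f)))"

definition linearization ::
    "('k, 'z) ring_scheme \<Rightarrow> ('o, 'm) category \<Rightarrow> ('o, 'm \<Rightarrow> 'k, 'k) linear_category" where
  "linearization K A =
     \<lparr>LOb = Ob A,
      LHom = (\<lambda>x y. free_module K (Hom A x y)),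
      LIde = (\<lambda>x. basis_vector K (Ide A x)),
      LComp = (\<lambda>x y z b a.
        let V = free_module K (Hom A x z) in
        linear_extension K V
          (\<lambda>g. linear_extension K V (\<lambda>f. basis_vector K (Comp A x y z g f)) a) b)\<rparr>"

definition opposite :: "('o, 'm, 'k) linear_category \<Rightarrow> ('o, 'm, 'k) linear_category" where
  "opposite C =
     \<lparr>LOb = LOb C, LHom = (\<lambda>x y. LHom C y x), LIde = LIde C,
      LComp = (\<lambda>x y z g f. LComp C z y x f g)\<rparr>"

text \<open>Composition is determined by \<open>(g \<otimes> g') \<circ> (f \<otimes> f') = (g \<circ> f) \<otimes> (g' \<circ> f')\<close>.\<close>

definition box ::
    "('k, 'z) ring_scheme \<Rightarrow> ('o, 'm, 'k) linear_category \<Rightarrow> ('p, 'n, 'k) linear_category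
      \<Rightarrow> ('o \<times> 'p, ('m \<times> 'n \<Rightarrow> 'k) set, 'k) linear_category" where
  "box K C D =
     \<lparr>LOb = LOb C \<times> LOb D,
      LHom = (\<lambda>(x, x') (y, y'). tensor_product K (LHom C x y) (LHom D x' y')),
      LIde = (\<lambda>(x, x'). pure_tensor K (LHom C x x) (LHom D x' x') (LIde C x) (LIde D x')),
      LComp = (\<lambda>(x, x') (y, y') (z, z') t s.
        let V = LHom C x z; W = LHom D x' z'; U = tensor_product K V W in
        tensor_lift K U
          (\<lambda>g g'. tensor_lift K U
            (\<lambda>f f'. pure_tensor K V W (LComp C x y z g f) (LComp D x' y' z' g' f')) s) t)\<rparr>"


section \<open>Linear functors to modules\<close>

record ('d, 'm, 'k, 'u) module_functor =
  Val :: "'d \<Rightarrow> ('k, 'u) module"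
  Act :: "'d \<Rightarrow> 'd \<Rightarrow> 'm \<Rightarrow> 'u \<Rightarrow> 'u"

definition linear_functor ::
    "('k, 'z) ring_scheme \<Rightarrow> ('d, 'm, 'k) linear_category \<Rightarrow> ('d, 'm, 'k, 'u) module_functor \<Rightarrow> bool"
  where "linear_functor K D M \<longleftrightarrow>
     (\<forall>d \<in> LOb D. Module.module K (Val M d)) \<and>
     (\<forall>d \<in> LOb D. \<forall>e \<in> LOb D. \<forall>f \<in> carrier (LHom D d e).
        linear_map K (Val M d) (Val M e) (Act M d e f)) \<and>
     (\<forall>d \<in> LOb D. \<forall>v \<in> carrier (Val M d). Act M d d (LIde D d) v = v) \<and>
     (\<forall>c \<in> LOb D. \<forall>d \<in> LOb D. \<forall>e \<in> LOb D.
        \<forall>f \<in> carrier (LHom D c d). \<forall>g \<in> carrier (LHom D d e). \<forall>v \<in> carrier (Val M c).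
          Act M c e (LComp D c d e g f) v = Act M d e g (Act M c d f v)) \<and>
     (\<forall>d \<in> LOb D. \<forall>e \<in> LOb D. \<forall>v \<in> carrier (Val M d).
        linear_map K (LHom D d e) (Val M e) (\<lambda>f. Act M d e f v))"

text \<open>
  The components of a natural transformation are determined on the carriers only, hence the
  extensionality conditions.
\<close>

definition natural_transformations ::
    "('k, 'z) ring_scheme \<Rightarrow> ('d, 'm, 'k) linear_category \<Rightarrow> ('d, 'm, 'k, 'u) module_functor
      \<Rightarrow> ('d, 'm, 'k, 'v) module_functor \<Rightarrow> ('d \<Rightarrow> 'u \<Rightarrow> 'v) set" where
  "natural_transformations K D M N =
     {\<eta> \<in> extensional (LOb D).
        (\<forall>d \<in> LOb D. \<eta> d \<in> extensional (carrier (Val M d)) \<and>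
           linear_map K (Val M d) (Val N d) (\<eta> d)) \<and>
        (\<forall>d \<in> LOb D. \<forall>e \<in> LOb D. \<forall>f \<in> carrier (LHom D d e). \<forall>v \<in> carrier (Val M d).
           \<eta> e (Act M d e f v) = Act N d e f (\<eta> d v))}"

definition natural_module ::
    "('k, 'z) ring_scheme \<Rightarrow> ('d, 'm, 'k) linear_category \<Rightarrow> ('d, 'm, 'k, 'u) module_functor
      \<Rightarrow> ('d, 'm, 'k, 'v) module_functor \<Rightarrow> ('k, 'd \<Rightarrow> 'u \<Rightarrow> 'v) module" where
  "natural_module K D M N =
     \<lparr>carrier = natural_transformations K D M N, mult = undefined, one = undefined,
      zero = (\<lambda>d \<in> LOb D. \<lambda>v \<in> carrier (Val M d). \<zero>\<^bsub>Val N d\<^esub>),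
      add = (\<lambda>\<eta> \<theta>. \<lambda>d \<in> LOb D. \<lambda>v \<in> carrier (Val M d). \<eta> d v \<oplus>\<^bsub>Val N d\<^esub> \<theta> d v),
      smult = (\<lambda>r \<eta>. \<lambda>d \<in> LOb D. \<lambda>v \<in> carrier (Val M d). r \<odot>\<^bsub>Val N d\<^esub> \<eta> d v)\<rparr>"

text \<open>The composite of \<open>\<eta>\<close> from \<open>M\<close> to \<open>N\<close> with \<open>\<theta>\<close> starting at \<open>N\<close>.\<close>

definition natural_comp ::
    "('d, 'm, 'k) linear_category \<Rightarrow> ('d, 'm, 'k, 'u) module_functor
      \<Rightarrow> ('d \<Rightarrow> 'v \<Rightarrow> 'w) \<Rightarrow> ('d \<Rightarrow> 'u \<Rightarrow> 'v) \<Rightarrow> ('d \<Rightarrow> 'u \<Rightarrow> 'w)" where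
  "natural_comp D M \<theta> \<eta> = (\<lambda>d \<in> LOb D. \<lambda>v \<in> carrier (Val M d). \<theta> d (\<eta> d v))"

text \<open>Epimorphisms and exactness of linear functors to modules are computed objectwise.\<close>

definition epimorphism ::
    "('d, 'm, 'k) linear_category \<Rightarrow> ('d, 'm, 'k, 'u) module_functor
      \<Rightarrow> ('d, 'm, 'k, 'v) module_functor \<Rightarrow> ('d \<Rightarrow> 'u \<Rightarrow> 'v) \<Rightarrow> bool" where
  "epimorphism D M N \<eta> \<longleftrightarrow> (\<forall>d \<in> LOb D. \<eta> d ` carrier (Val M d) = carrier (Val N d))"

definition exact_at ::
    "('d, 'm, 'k) linear_category \<Rightarrow> ('d, 'm, 'k, 'u) module_functor
      \<Rightarrow> ('d, 'm, 'k, 'v) module_functor \<Rightarrow> ('d, 'm, 'k, 'w) module_functor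
      \<Rightarrow> ('d \<Rightarrow> 'u \<Rightarrow> 'v) \<Rightarrow> ('d \<Rightarrow> 'v \<Rightarrow> 'w) \<Rightarrow> bool" where
  "exact_at D L M N \<eta> \<theta> \<longleftrightarrow>
     (\<forall>d \<in> LOb D. \<eta> d ` carrier (Val L d) = {v \<in> carrier (Val M d). \<theta> d v = \<zero>\<^bsub>Val N d\<^esub>})"

definition projective ::
    "('k, 'z) ring_scheme \<Rightarrow> ('d, 'm, 'k) linear_category \<Rightarrow> ('d, 'm, 'k, 'u) module_functor \<Rightarrow> bool"
  where "projective K D P \<longleftrightarrow> linear_functor K D P \<and>
     (\<forall>(M :: ('d, 'm, 'k, 'u) module_functor) (N :: ('d, 'm, 'k, 'u) module_functor).
        linear_functor K D M \<longrightarrow> linear_functor K D N \<longrightarrow>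
        (\<forall>\<epsilon> \<in> natural_transformations K D M N. epimorphism D M N \<epsilon> \<longrightarrow>
           (\<forall>\<phi> \<in> natural_transformations K D P N.
              \<exists>\<psi> \<in> natural_transformations K D P M. natural_comp D P \<epsilon> \<psi> = \<phi>)))"


section \<open>Ext and Hochschild--Mitchell cohomology\<close>

text \<open>
  A projective resolution of \<open>X\<close> consists of projectives \<open>P n\<close>, differentials \<open>\<delta> n\<close> from
  \<open>P (Suc n)\<close> to \<open>P n\<close> and an augmentation \<open>\<epsilon>\<close> from \<open>P 0\<close> to \<open>X\<close>.
\<close>

definition projective_resolution ::
    "('k, 'z) ring_scheme \<Rightarrow> ('d, 'm, 'k) linear_category \<Rightarrow> ('d, 'm, 'k, 'v) module_functor
      \<Rightarrow> (nat \<Rightarrow> ('d, 'm, 'k, 'u) module_functor) \<Rightarrow> (nat \<Rightarrow> 'd \<Rightarrow> 'u \<Rightarrow> 'u)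
      \<Rightarrow> ('d \<Rightarrow> 'u \<Rightarrow> 'v) \<Rightarrow> bool" where
  "projective_resolution K D X P \<delta> \<epsilon> \<longleftrightarrow>
     (\<forall>n. projective K D (P n)) \<and>
     (\<forall>n. \<delta> n \<in> natural_transformations K D (P (Suc n)) (P n)) \<and>
     \<epsilon> \<in> natural_transformations K D (P 0) X \<and>
     epimorphism D (P 0) X \<epsilon> \<and>
     exact_at D (P (Suc 0)) (P 0) X (\<delta> 0) \<epsilon> \<and>
     (\<forall>n. exact_at D (P (Suc (Suc n))) (P (Suc n)) (P n) (\<delta> (Suc n)) (\<delta> n))"

text \<open>The cohomology at \<open>n\<close> of the complex of all \<open>Hom (P n, M)\<close>.\<close>

definition hom_cocycles ::
    "('k, 'z) ring_scheme \<Rightarrow> ('d, 'm, 'k) linear_category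
      \<Rightarrow> (nat \<Rightarrow> ('d, 'm, 'k, 'u) module_functor) \<Rightarrow> (nat \<Rightarrow> 'd \<Rightarrow> 'u \<Rightarrow> 'u)
      \<Rightarrow> nat \<Rightarrow> ('d, 'm, 'k, 'w) module_functor \<Rightarrow> ('d \<Rightarrow> 'u \<Rightarrow> 'w) set" where
  "hom_cocycles K D P \<delta> n M =
     {\<phi> \<in> natural_transformations K D (P n) M.
        natural_comp D (P (Suc n)) \<phi> (\<delta> n) = \<zero>\<^bsub>natural_module K D (P (Suc n)) M\<^esub>}"

fun hom_coboundaries ::
    "('k, 'z) ring_scheme \<Rightarrow> ('d, 'm, 'k) linear_category
      \<Rightarrow> (nat \<Rightarrow> ('d, 'm, 'k, 'u) module_functor) \<Rightarrow> (nat \<Rightarrow> 'd \<Rightarrow> 'u \<Rightarrow> 'u)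
      \<Rightarrow> nat \<Rightarrow> ('d, 'm, 'k, 'w) module_functor \<Rightarrow> ('d \<Rightarrow> 'u \<Rightarrow> 'w) set" where
  "hom_coboundaries K D P \<delta> 0 M = {\<zero>\<^bsub>natural_module K D (P 0) M\<^esub>}"
| "hom_coboundaries K D P \<delta> (Suc n) M =
     (\<lambda>\<phi>. natural_comp D (P (Suc n)) \<phi> (\<delta> n)) ` natural_transformations K D (P n) M"

definition hom_cohomology ::
    "('k, 'z) ring_scheme \<Rightarrow> ('d, 'm, 'k) linear_category
      \<Rightarrow> (nat \<Rightarrow> ('d, 'm, 'k, 'u) module_functor) \<Rightarrow> (nat \<Rightarrow> 'd \<Rightarrow> 'u \<Rightarrow> 'u)
      \<Rightarrow> nat \<Rightarrow> ('d, 'm, 'k, 'w) module_functor \<Rightarrow> ('k, ('d \<Rightarrow> 'u \<Rightarrow> 'w) set) module" where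
  "hom_cohomology K D P \<delta> n M =
     quotient_module (natural_module K D (P n) M\<lparr>carrier := hom_cocycles K D P \<delta> n M\<rparr>)
       (hom_coboundaries K D P \<delta> n M)"

text \<open>
  \<open>Ext\<close> is computed from a chosen projective resolution of \<open>X\<close> in the category to which \<open>M\<close>
  belongs; up to isomorphism the choice is immaterial. If \<open>'u\<close> is infinite and \<open>K\<close>, \<open>D\<close> and
  the values of \<open>X\<close> are small, a projective resolution exists: the free linear functor on
  the elements of a small one is again small. The values of \<open>X\<close> may lie in another type than \<open>'u\<close>.
\<close>

definition Ext ::
    "('k, 'z) ring_scheme \<Rightarrow> ('d, 'm, 'k) linear_category \<Rightarrow> nat \<Rightarrow> ('d, 'm, 'k, 'v) module_functor
      \<Rightarrow> ('d, 'm, 'k, 'u) module_functor \<Rightarrow> ('k, ('d \<Rightarrow> 'u \<Rightarrow> 'u) set) module" where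
  "Ext K D n X M =
     (let (P, \<delta>) = (SOME (P, \<delta>). \<exists>\<epsilon>. projective_resolution K D X P \<delta> \<epsilon>)
      in hom_cohomology K D P \<delta> n M)"

definition enveloping_category ::
    "('k, 'z) ring_scheme \<Rightarrow> ('o, 'm, 'k) linear_category
      \<Rightarrow> ('o \<times> 'o, ('m \<times> 'm \<Rightarrow> 'k) set, 'k) linear_category" where
  "enveloping_category K C = box K C (opposite C)"

definition bimodule ::
    "('k, 'z) ring_scheme \<Rightarrow> ('o, 'm, 'k) linear_category
      \<Rightarrow> ('o \<times> 'o, ('m \<times> 'm \<Rightarrow> 'k) set, 'k, 'u) module_functor \<Rightarrow> bool" where
  "bimodule K C M \<longleftrightarrow> linear_functor K (enveloping_category K C) M"

text \<open>
  The value at \<open>(x, y)\<close> is \<open>C(y, x)\<close>, and \<open>f \<otimes> g\<close> with \<open>f\<close> from \<open>x\<close> to \<open>x'\<close> and \<open>g\<close>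
  from \<open>y'\<close> to \<open>y\<close> sends \<open>h\<close> to \<open>f \<circ> h \<circ> g\<close>.
\<close>

definition regular_bimodule ::
    "('k, 'z) ring_scheme \<Rightarrow> ('o, 'm, 'k) linear_category
      \<Rightarrow> ('o \<times> 'o, ('m \<times> 'm \<Rightarrow> 'k) set, 'k, 'm) module_functor" where
  "regular_bimodule K C =
     \<lparr>Val = (\<lambda>(x, y). LHom C y x),
      Act = (\<lambda>(x, y) (x', y') t h.
        tensor_lift K (LHom C y' x') (\<lambda>f g. LComp C y' x x' f (LComp C y' y x h g)) t)\<rparr>"

definition hochschild_mitchell ::
    "('k, 'z) ring_scheme \<Rightarrow> ('o, 'm, 'k) linear_category \<Rightarrow> nat
      \<Rightarrow> ('o \<times> 'o, ('m \<times> 'm \<Rightarrow> 'k) set, 'k, 'u) module_functor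
      \<Rightarrow> ('k, ('o \<times> 'o \<Rightarrow> 'u \<Rightarrow> 'u) set) module" where
  "hochschild_mitchell K C n M = Ext K (enveloping_category K C) n (regular_bimodule K C) M"

definition separable ::
    "'u itself \<Rightarrow> ('k, 'z) ring_scheme \<Rightarrow> ('o, 'm, 'k) linear_category \<Rightarrow> bool" where
  "separable U K C \<longleftrightarrow>
     (\<forall>M :: ('o \<times> 'o, ('m \<times> 'm \<Rightarrow> 'k) set, 'k, 'u) module_functor. bimodule K C M \<longrightarrow>
        carrier (hochschild_mitchell K C 1 M) = {\<zero>\<^bsub>hochschild_mitchell K C 1 M\<^esub>})"


section \<open>The linearization is a linear category\<close>

lemma free_module_simps:
  "carrier (free_module K S) = {a. range a \<subseteq> carrier K \<and> support K a \<subseteq> S \<and> finite (support K a)}"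
  "\<zero>\<^bsub>free_module K S\<^esub> = (\<lambda>s. \<zero>\<^bsub>K\<^esub>)"
  "a \<oplus>\<^bsub>free_module K S\<^esub> b = (\<lambda>s. a s \<oplus>\<^bsub>K\<^esub> b s)"
  "r \<odot>\<^bsub>free_module K S\<^esub> a = (\<lambda>s. r \<otimes>\<^bsub>K\<^esub> a s)"
  by (simp_all add: free_module_def)

lemma free_carrier_add:
  assumes "cring K" "a \<in> carrier (free_module K S)" "b \<in> carrier (free_module K S)"
  shows "(\<lambda>s. a s \<oplus>\<^bsub>K\<^esub> b s) \<in> carrier (free_module K S)"
proof -
  interpret cring K by fact
  have "support K (\<lambda>s. a s \<oplus>\<^bsub>K\<^esub> b s) \<subseteq> support K a \<union> support K b"
    by (auto simp: support_def)
  moreover have "finite (support K a \<union> support K b)" "support K a \<union> support K b \<subseteq> S"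
    using assms by (auto simp: free_module_simps)
  ultimately show ?thesis using assms
    by (auto simp: free_module_simps image_subset_iff intro: finite_subset)
qed

lemma free_carrier_smult:
  assumes "cring K" "r \<in> carrier K" "b \<in> carrier (free_module K S)"
  shows "(\<lambda>s. r \<otimes>\<^bsub>K\<^esub> b s) \<in> carrier (free_module K S)"
proof -
  interpret cring K by fact
  have "support K (\<lambda>s. r \<otimes>\<^bsub>K\<^esub> b s) \<subseteq> support K b"
    using assms by (auto simp: support_def)
  then show ?thesis using assms
    by (auto simp: free_module_simps image_subset_iff intro: finite_subset)
qed

lemma module_free_module:
  assumes "cring K" shows "Module.module K (free_module K S)"
proof -
  interpret cring K by fact
  have [simp]: "a \<in> carrier (free_module K S) \<Longrightarrow> a s \<in> carrier K" for a s
    by (auto simp: free_module_simps)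
  have inv: "\<exists>y\<in>carrier (free_module K S). (\<lambda>s. y s \<oplus>\<^bsub>K\<^esub> x s) = (\<lambda>s. \<zero>\<^bsub>K\<^esub>)"
    if x: "x \<in> carrier (free_module K S)" for x
  proof (rule bexI)
    show "(\<lambda>s. (\<ominus>\<^bsub>K\<^esub> \<one>\<^bsub>K\<^esub>) \<otimes>\<^bsub>K\<^esub> x s) \<in> carrier (free_module K S)"
      using free_carrier_smult[OF assms _ x] by simp
    show "(\<lambda>s. (\<ominus>\<^bsub>K\<^esub> \<one>\<^bsub>K\<^esub>) \<otimes>\<^bsub>K\<^esub> x s \<oplus>\<^bsub>K\<^esub> x s) = (\<lambda>s. \<zero>\<^bsub>K\<^esub>)"
      using x by (simp add: l_minus l_neg)
  qed
  show ?thesis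
  proof (rule moduleI)
    show "abelian_group (free_module K S)"
    proof (rule abelian_groupI)
      show "\<And>x. x \<in> carrier (free_module K S) \<Longrightarrow>
         \<exists>y\<in>carrier (free_module K S). y \<oplus>\<^bsub>free_module K S\<^esub> x = \<zero>\<^bsub>free_module K S\<^esub>"
        using inv by (simp add: free_module_simps(2,3))
      show "\<zero>\<^bsub>free_module K S\<^esub> \<in> carrier (free_module K S)"
        by (auto simp: free_module_simps support_def)
    qed (auto simp: free_module_simps(2-4) a_assoc a_comm a_lcomm intro: free_carrier_add[OF assms] )
  qed (auto simp: free_module_simps(2-4) m_assoc l_distr r_distr assms intro: free_carrier_smult[OF assms])
qed

lemma basis_vector_closed:
  assumes "cring K" "s \<in> S" shows "basis_vector K s \<in> carrier (free_module K S)"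
proof -
  interpret cring K by fact
  have "support K (basis_vector K s) \<subseteq> {s}" by (auto simp: support_def basis_vector_def)
  then show ?thesis using assms
    by (auto simp: free_module_simps basis_vector_def image_subset_iff intro: finite_subset)
qed

lemma linear_extension_superset:
  assumes "Module.module K V" "a \<in> carrier (free_module K S)" "\<phi> \<in> S \<rightarrow> carrier V"
    "support K a \<subseteq> T" "finite T" "T \<subseteq> S"
  shows "linear_extension K V \<phi> a = (\<Oplus>\<^bsub>V\<^esub> s \<in> T. a s \<odot>\<^bsub>V\<^esub> \<phi> s)"
proof -
  interpret Module.module K V by fact
  have "\<And>s. a s \<in> carrier K" using assms(2) by (auto simp: free_module_simps)
  then show ?thesis unfolding linear_extension_def
    using assms by (intro add.finprod_mono_neutral_cong_left) (auto simp: support_def Pi_iff)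
qed

lemma linear_extension_linear:
  assumes "Module.module K V" "\<phi> \<in> S \<rightarrow> carrier V"
  shows "linear_map K (free_module K S) V (linear_extension K V \<phi>)"
proof -
  interpret Module.module K V by fact
  note c = free_carrier_add[OF R.is_cring] free_carrier_smult[OF R.is_cring]
  have coeff: "a s \<in> carrier K" and fin: "finite (support K a)" and sub: "support K a \<subseteq> S"
    if "a \<in> carrier (free_module K S)" for a s
    using that by (auto simp: free_module_simps)
  have \<phi>: "\<phi> s \<in> carrier V" if "s \<in> S" for s using assms that by auto
  show ?thesis unfolding linear_map_def
  proof (intro conjI ballI funcsetI)
    fix a assume a: "a \<in> carrier (free_module K S)"
    show "linear_extension K V \<phi> a \<in> carrier V"
      unfolding linear_extension_def using sub[OF a]
      by (intro M.finsum_closed funcsetI smult_closed coeff[OF a] \<phi>) auto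
    fix b assume b: "b \<in> carrier (free_module K S)"
    let ?T = "support K a \<union> support K b"
    have T: "finite ?T" "?T \<subseteq> S" using fin sub a b by auto
    have ts: "\<phi> s \<in> carrier V" if "s \<in> ?T" for s using T that by (intro \<phi>) auto
    have "linear_extension K V \<phi> (\<lambda>s. a s \<oplus>\<^bsub>K\<^esub> b s) = (\<Oplus>\<^bsub>V\<^esub> s \<in> ?T. (a s \<oplus>\<^bsub>K\<^esub> b s) \<odot>\<^bsub>V\<^esub> \<phi> s)"
      using T by (intro linear_extension_superset[OF assms(1) c(1)[OF a b] assms(2)]) (auto simp: support_def)
    also have "\<dots> = (\<Oplus>\<^bsub>V\<^esub> s \<in> ?T. a s \<odot>\<^bsub>V\<^esub> \<phi> s \<oplus>\<^bsub>V\<^esub> b s \<odot>\<^bsub>V\<^esub> \<phi> s)"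
      by (intro M.finsum_cong' funcsetI refl) (simp_all add: ts coeff[OF a] coeff[OF b] smult_l_distr del: Un_iff)
    also have "\<dots> = (\<Oplus>\<^bsub>V\<^esub> s \<in> ?T. a s \<odot>\<^bsub>V\<^esub> \<phi> s) \<oplus>\<^bsub>V\<^esub> (\<Oplus>\<^bsub>V\<^esub> s \<in> ?T. b s \<odot>\<^bsub>V\<^esub> \<phi> s)"
      by (intro M.finsum_addf funcsetI smult_closed coeff[OF a] coeff[OF b] ts)
    also have "\<dots> = linear_extension K V \<phi> a \<oplus>\<^bsub>V\<^esub> linear_extension K V \<phi> b"
      by (simp only: linear_extension_superset[OF assms(1) a assms(2) Un_upper1 T]
        linear_extension_superset[OF assms(1) b assms(2) Un_upper2 T])
    finally show "linear_extension K V \<phi> (a \<oplus>\<^bsub>free_module K S\<^esub> b) =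
        linear_extension K V \<phi> a \<oplus>\<^bsub>V\<^esub> linear_extension K V \<phi> b"
      by (simp add: free_module_simps)
  next
    fix r a assume r: "r \<in> carrier K" and a: "a \<in> carrier (free_module K S)"
    have s: "\<phi> s \<in> carrier V" if "s \<in> support K a" for s using sub[OF a] that by (intro \<phi>) auto
    have "linear_extension K V \<phi> (\<lambda>s. r \<otimes>\<^bsub>K\<^esub> a s) = (\<Oplus>\<^bsub>V\<^esub> s \<in> support K a. (r \<otimes>\<^bsub>K\<^esub> a s) \<odot>\<^bsub>V\<^esub> \<phi> s)"
      using r fin[OF a] sub[OF a]
      by (intro linear_extension_superset[OF assms(1) c(2)[OF r a] assms(2)]) (auto simp: support_def)
    also have "\<dots> = (\<Oplus>\<^bsub>V\<^esub> s \<in> support K a. r \<odot>\<^bsub>V\<^esub> (a s \<odot>\<^bsub>V\<^esub> \<phi> s))"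
      by (intro M.finsum_cong' funcsetI refl) (simp_all add: s r coeff[OF a] smult_assoc1)
    also have "\<dots> = r \<odot>\<^bsub>V\<^esub> linear_extension K V \<phi> a"
      unfolding linear_extension_def by (intro finsum_smult_ldistr[symmetric] fin[OF a] r funcsetI smult_closed coeff[OF a] s)
    finally show "linear_extension K V \<phi> (r \<odot>\<^bsub>free_module K S\<^esub> a) = r \<odot>\<^bsub>V\<^esub> linear_extension K V \<phi> a"
      by (simp add: free_module_simps)
  qed
qed

lemma linear_extension_basis:
  assumes "Module.module K V" "\<phi> \<in> S \<rightarrow> carrier V" "s \<in> S"
  shows "linear_extension K V \<phi> (basis_vector K s) = \<phi> s"
proof -
  interpret Module.module K V by fact
  have "linear_extension K V \<phi> (basis_vector K s) = (\<Oplus>\<^bsub>V\<^esub> t \<in> {s}. basis_vector K s t \<odot>\<^bsub>V\<^esub> \<phi> t)"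
    by (rule linear_extension_superset[OF assms(1) basis_vector_closed[OF R.is_cring assms(3)] assms(2)])
       (use assms in \<open>auto simp: support_def basis_vector_def\<close>)
  also have "\<dots> = \<phi> s"
  proof -
    have "\<phi> s \<in> carrier V" using assms(2,3) by blast
    then show ?thesis by (simp add: M.finsum_insert basis_vector_def)
  qed
  finally show ?thesis .
qed

lemma linear_map_finsum:
  assumes "Module.module K V" "Module.module K W" "linear_map K V W h" "finite A" "f \<in> A \<rightarrow> carrier V"
  shows "h (\<Oplus>\<^bsub>V\<^esub> s \<in> A. f s) = (\<Oplus>\<^bsub>W\<^esub> s \<in> A. h (f s))"
proof -
  interpret V: Module.module K V by fact
  interpret W: Module.module K W by fact
  have h0: "h \<zero>\<^bsub>V\<^esub> = \<zero>\<^bsub>W\<^esub>"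
  proof -
    have "h (\<zero>\<^bsub>K\<^esub> \<odot>\<^bsub>V\<^esub> \<zero>\<^bsub>V\<^esub>) = \<zero>\<^bsub>K\<^esub> \<odot>\<^bsub>W\<^esub> h \<zero>\<^bsub>V\<^esub>" using assms(3) unfolding linear_map_def by blast
    moreover have "h \<zero>\<^bsub>V\<^esub> \<in> carrier W" using assms(3) unfolding linear_map_def by blast
    ultimately show ?thesis by simp
  qed
  show ?thesis using assms(4,5)
  proof (induction A)
    case empty then show ?case by (simp add: h0)
  next
    case (insert x F)
    have "h ` carrier V \<subseteq> carrier W" using assms(3) unfolding linear_map_def by blast
    then have "h (f x) \<in> carrier W" "(\<lambda>s. h (f s)) \<in> F \<rightarrow> carrier W" using insert.prems by auto
    moreover have "h (f x \<oplus>\<^bsub>V\<^esub> (\<Oplus>\<^bsub>V\<^esub> s \<in> F. f s)) = h (f x) \<oplus>\<^bsub>W\<^esub> h (\<Oplus>\<^bsub>V\<^esub> s \<in> F. f s)"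
      using assms(3) insert.prems unfolding linear_map_def by (metis Pi_split_insert_domain V.M.finsum_closed)
    ultimately show ?case using insert by simp
  qed
qed

lemma linear_map_linear_extension:
  assumes V: "Module.module K V" and W: "Module.module K W" and h: "linear_map K V W h"
    and \<phi>: "\<phi> \<in> S \<rightarrow> carrier V" and a: "a \<in> carrier (free_module K S)"
  shows "h (linear_extension K V \<phi> a) = linear_extension K W (\<lambda>s. h (\<phi> s)) a"
proof -
  interpret V: Module.module K V by fact
  interpret W: Module.module K W by fact
  have s: "s \<in> S" if "s \<in> support K a" for s using a that by (auto simp: free_module_simps)
  have ak: "a s \<in> carrier K" for s using a by (auto simp: free_module_simps)
  have "finite (support K a)" using a by (auto simp: free_module_simps)
  then have "h (linear_extension K V \<phi> a) = (\<Oplus>\<^bsub>W\<^esub> s \<in> support K a. h (a s \<odot>\<^bsub>V\<^esub> \<phi> s))"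
    unfolding linear_extension_def using s \<phi> ak
    by (intro linear_map_finsum[OF V W h]) auto
  also have "\<dots> = (\<Oplus>\<^bsub>W\<^esub> s \<in> support K a. a s \<odot>\<^bsub>W\<^esub> h (\<phi> s))"
    using h s \<phi> ak unfolding linear_map_def by (intro W.M.finsum_cong') (auto simp: Pi_iff)
  finally show ?thesis unfolding linear_extension_def .
qed

lemma linear_extension_cong:
  assumes "Module.module K V" "a \<in> carrier (free_module K S)" "\<And>s. s \<in> S \<Longrightarrow> \<phi> s = \<psi> s" "\<psi> \<in> S \<rightarrow> carrier V"
  shows "linear_extension K V \<phi> a = linear_extension K V \<psi> a"
proof -
  interpret Module.module K V by fact
  have s: "s \<in> S" if "s \<in> support K a" for s using assms(2) that by (auto simp: free_module_simps)
  have ak: "a s \<in> carrier K" for s using assms(2) by (auto simp: free_module_simps)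
  show ?thesis unfolding linear_extension_def
    using s ak assms(3) funcset_mem[OF assms(4)] by (intro M.finsum_cong') auto
qed

lemma linear_extension_id:
  fixes a :: "'s \<Rightarrow> 'k" and K :: "('k, 'z) ring_scheme"
  assumes "cring K" "a \<in> carrier (free_module K S)"
  shows "linear_extension K (free_module K S) (basis_vector K) a = a"
proof
  fix t :: 's
  interpret cring K by fact
  have F: "Module.module K (free_module K S)" by (rule module_free_module[OF assms(1)])
  interpret F: Module.module K "free_module K S" by fact
  have ak: "a s \<in> carrier K" for s using assms(2) by (auto simp: free_module_simps)
  have s: "s \<in> S" if "s \<in> support K a" for s using assms(2) that by (auto simp: free_module_simps)
  have fin: "finite (support K a)" using assms by (auto simp: free_module_simps)
  have gen: "(finsum (free_module K S) (\<lambda>s. a s \<odot>\<^bsub>free_module K S\<^esub> basis_vector K s) B) t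
     = (if t \<in> B then a t else \<zero>\<^bsub>K\<^esub>)" if "finite B" "B \<subseteq> S" for B
    using that
  proof (induction B)
    case empty then show ?case by (simp add: free_module_simps)
  next
    case (insert x B)
    have [simp]: "basis_vector K s \<in> carrier (free_module K S)" if "s \<in> S" for s
      using basis_vector_closed[OF assms(1) that] .
    have "(\<Oplus>\<^bsub>free_module K S\<^esub> s \<in> insert x B. a s \<odot>\<^bsub>free_module K S\<^esub> basis_vector K s) =
      a x \<odot>\<^bsub>free_module K S\<^esub> basis_vector K x \<oplus>\<^bsub>free_module K S\<^esub>
        (\<Oplus>\<^bsub>free_module K S\<^esub> s \<in> B. a s \<odot>\<^bsub>free_module K S\<^esub> basis_vector K s)"
      using insert ak by (intro F.M.finsum_insert) auto
    then show ?case using insert ak by (auto simp: free_module_simps(3,4) basis_vector_def)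
  qed
  show "linear_extension K (free_module K S) (basis_vector K) a t = a t"
    unfolding linear_extension_def using gen[OF fin subsetI[OF s]] by (auto simp: support_def split: if_splits)
qed

lemma linear_map_eqI:
  assumes "Module.module K V" "cring K" "linear_map K (free_module K S) V g" "linear_map K (free_module K S) V h"
    "\<And>s. s \<in> S \<Longrightarrow> g (basis_vector K s) = h (basis_vector K s)" "a \<in> carrier (free_module K S)"
  shows "g a = h a"
proof -
  note F = module_free_module[OF assms(2), of S]
  have b: "basis_vector K \<in> S \<rightarrow> carrier (free_module K S)" using basis_vector_closed[OF assms(2)] by auto
  have hv: "(\<lambda>s. h (basis_vector K s)) \<in> S \<rightarrow> carrier V"
    using assms(4) b unfolding linear_map_def by auto
  show ?thesis
    using linear_map_linear_extension[OF F assms(1,3) b assms(6)]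
      linear_map_linear_extension[OF F assms(1,4) b assms(6)]
      linear_extension_cong[OF assms(1) assms(6) assms(5) hv]
      linear_extension_id[OF assms(2,6)] by simp
qed

lemma linear_map_closed: "\<lbrakk>linear_map K V W h; v \<in> carrier V\<rbrakk> \<Longrightarrow> h v \<in> carrier W"
  unfolding linear_map_def by auto

lemma linear_map_comp:
  "\<lbrakk>linear_map K U V g; linear_map K V W h\<rbrakk> \<Longrightarrow> linear_map K U W (\<lambda>x. h (g x))"
  unfolding linear_map_def by (auto simp: Pi_iff)

lemma linear_extension_linear_arg:
  assumes W: "Module.module K W" and b: "b \<in> carrier (free_module K T)"
    and U: "Module.module K U"
    and \<phi>: "\<And>s. s \<in> T \<Longrightarrow> linear_map K U W (\<lambda>a. \<phi> a s)"
  shows "linear_map K U W (\<lambda>a. linear_extension K W (\<phi> a) b)"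
proof -
  interpret Module.module K W by fact
  have s: "s \<in> T" if "s \<in> support K b" for s using b that by (auto simp: free_module_simps)
  have bk[simp]: "b s \<in> carrier K" for s using b by (auto simp: free_module_simps)
  have fin[simp]: "finite (support K b)" using b by (auto simp: free_module_simps)
  have cl: "\<phi> a s \<in> carrier W" if "a \<in> carrier U" "s \<in> support K b" for a s
    using \<phi>[OF s[OF that(2)]] that unfolding linear_map_def by auto
  show ?thesis unfolding linear_map_def
  proof (intro conjI ballI funcsetI)
    fix a assume a: "a \<in> carrier U"
    show "linear_extension K W (\<phi> a) b \<in> carrier W"
      unfolding linear_extension_def using cl[OF a] by (intro M.finsum_closed) auto
    fix a' assume a': "a' \<in> carrier U"
    show "linear_extension K W (\<phi> (a \<oplus>\<^bsub>U\<^esub> a')) b =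
      linear_extension K W (\<phi> a) b \<oplus>\<^bsub>W\<^esub> linear_extension K W (\<phi> a') b"
    proof -
      have "(\<Oplus>\<^bsub>W\<^esub>s\<in>support K b. b s \<odot>\<^bsub>W\<^esub> \<phi> (a \<oplus>\<^bsub>U\<^esub> a') s) =
         (\<Oplus>\<^bsub>W\<^esub>s\<in>support K b. b s \<odot>\<^bsub>W\<^esub> \<phi> a s \<oplus>\<^bsub>W\<^esub> b s \<odot>\<^bsub>W\<^esub> \<phi> a' s)"
        using cl[OF a] cl[OF a'] \<phi>[OF s] a a' by (intro M.finsum_cong') (auto simp: linear_map_def smult_r_distr)
      also have "\<dots> = (\<Oplus>\<^bsub>W\<^esub>s\<in>support K b. b s \<odot>\<^bsub>W\<^esub> \<phi> a s) \<oplus>\<^bsub>W\<^esub> (\<Oplus>\<^bsub>W\<^esub>s\<in>support K b. b s \<odot>\<^bsub>W\<^esub> \<phi> a' s)"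
        using cl[OF a] cl[OF a'] by (intro M.finsum_addf) auto
      finally show ?thesis unfolding linear_extension_def .
    qed
  next
    fix r a assume r: "r \<in> carrier K" and a: "a \<in> carrier U"
    have cm: "b s \<odot>\<^bsub>W\<^esub> (r \<odot>\<^bsub>W\<^esub> w) = r \<odot>\<^bsub>W\<^esub> (b s \<odot>\<^bsub>W\<^esub> w)" if "w \<in> carrier W" for s w
      using that r by (metis bk R.m_comm smult_assoc1)
    have "(\<Oplus>\<^bsub>W\<^esub>s\<in>support K b. b s \<odot>\<^bsub>W\<^esub> \<phi> (r \<odot>\<^bsub>U\<^esub> a) s) = (\<Oplus>\<^bsub>W\<^esub>s\<in>support K b. r \<odot>\<^bsub>W\<^esub> (b s \<odot>\<^bsub>W\<^esub> \<phi> a s))"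
      using cl[OF a] \<phi>[OF s] a r cm by (intro M.finsum_cong') (auto simp: linear_map_def)
    also have "\<dots> = r \<odot>\<^bsub>W\<^esub> (\<Oplus>\<^bsub>W\<^esub>s\<in>support K b. b s \<odot>\<^bsub>W\<^esub> \<phi> a s)"
      using cl[OF a] r by (intro finsum_smult_ldistr[symmetric]) auto
    finally show "linear_extension K W (\<phi> (r \<odot>\<^bsub>U\<^esub> a)) b = r \<odot>\<^bsub>W\<^esub> linear_extension K W (\<phi> a) b"
      unfolding linear_extension_def .
  qed
qed

lemma linear_category_linearization:
  assumes "cring K" "category A" shows "linear_category K (linearization K A)"
proof -
  interpret cring K by fact
  interpret A: category A by fact
  let ?F = "\<lambda>x y. free_module K (Hom A x y)"
  let ?c = "LComp (linearization K A)"
  note m = module_free_module[OF assms(1)]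
  note bc = basis_vector_closed[OF assms(1)]
  have c: "?c x y z b a = linear_extension K (?F x z)
          (\<lambda>g. linear_extension K (?F x z) (\<lambda>f. basis_vector K (Comp A x y z g f)) a) b" for x y z a b
    by (simp add: linearization_def Let_def)
  have in1: "(\<lambda>f. basis_vector K (Comp A x y z g f)) \<in> Hom A x y \<rightarrow> carrier (?F x z)"
    if "x \<in> Ob A" "y \<in> Ob A" "z \<in> Ob A" "g \<in> Hom A y z" for x y z g
    by (intro funcsetI bc A.comp_closed[of x y z]) (use that in auto)
  have lin1: "linear_map K (?F x y) (?F x z) (\<lambda>a. linear_extension K (?F x z) (\<lambda>f. basis_vector K (Comp A x y z g f)) a)"
    if "x \<in> Ob A" "y \<in> Ob A" "z \<in> Ob A" "g \<in> Hom A y z" for x y z g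
    using linear_extension_linear[OF m in1[OF that]] .
  have linr: "linear_map K (?F x y) (?F x z) (?c x y z b)"
    if "x \<in> Ob A" "y \<in> Ob A" "z \<in> Ob A" "b \<in> carrier (?F y z)" for x y z b
    unfolding c by (rule linear_extension_linear_arg[OF m that(4) m lin1[OF that(1-3)]])
  have linl: "linear_map K (?F y z) (?F x z) (\<lambda>b. ?c x y z b a)"
    if "x \<in> Ob A" "y \<in> Ob A" "z \<in> Ob A" "a \<in> carrier (?F x y)" for x y z a
    unfolding c by (rule linear_extension_linear[OF m]) (blast intro: linear_map_closed[OF lin1[OF that(1-3)] that(4)])
  have bas: "?c x y z (basis_vector K g) (basis_vector K f) = basis_vector K (Comp A x y z g f)"
    if "x \<in> Ob A" "y \<in> Ob A" "z \<in> Ob A" "f \<in> Hom A x y" "g \<in> Hom A y z" for x y z f g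
  proof -
    have "(\<lambda>g. linear_extension K (?F x z) (\<lambda>f. basis_vector K (Comp A x y z g f)) (basis_vector K f)) \<in> Hom A y z \<rightarrow> carrier (?F x z)"
      by (blast intro: linear_map_closed[OF lin1[OF that(1-3)] bc[OF that(4)]])
    from linear_extension_basis[OF m this that(5)] show ?thesis unfolding c
      using linear_extension_basis[OF m in1[OF that(1-3,5)] that(4)] by simp
  qed
  have cl: "?c x y z b a \<in> carrier (?F x z)"
    if "x \<in> Ob A" "y \<in> Ob A" "z \<in> Ob A" "a \<in> carrier (?F x y)" "b \<in> carrier (?F y z)" for x y z a b
    using linear_map_closed[OF linr[OF that(1-3,5)] that(4)] .
  have lm_id: "linear_map K V V (\<lambda>x. x)" for V by (simp add: linear_map_def)
  have "category (underlying_category (linearization K A))"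
  proof (unfold_locales, unfold underlying_category_def, simp_all, goal_cases)
    case (1 x) then show ?case by (simp add: linearization_def bc A.ide_closed)
  next
    case (2 x y z f g) then show ?case using cl[of x y z f g] by (simp add: linearization_def)
  next
    case (3 x y f)
    then have o: "x \<in> Ob A" "y \<in> Ob A" and f: "f \<in> carrier (?F x y)" by (simp_all add: linearization_def)
    have "?c x y y (basis_vector K (Ide A y)) f = f"
      by (rule linear_map_eqI[OF m assms(1) linr[OF o o(2) bc[OF A.ide_closed[OF o(2)]]] lm_id _ f])
         (simp add: bas[OF o o(2) _ A.ide_closed[OF o(2)]] A.comp_ide_left[OF o])
    then show ?case by (simp add: linearization_def)
  next
    case (4 x y f)
    then have o: "x \<in> Ob A" "y \<in> Ob A" and f: "f \<in> carrier (?F x y)" by (simp_all add: linearization_def)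
    have "?c x x y f (basis_vector K (Ide A x)) = f"
      by (rule linear_map_eqI[OF m assms(1) linl[OF o(1) o bc[OF A.ide_closed[OF o(1)]]] lm_id _ f])
         (simp add: bas[OF o(1) o A.ide_closed[OF o(1)]] A.comp_ide_right[OF o])
    then show ?case by (simp add: linearization_def)
  next
    case (5 w x y z f g h)
    then have o: "w \<in> Ob A" "x \<in> Ob A" "y \<in> Ob A" "z \<in> Ob A"
      and f: "f \<in> carrier (?F w x)" and g: "g \<in> carrier (?F x y)" and h: "h \<in> carrier (?F y z)"
      by (simp_all add: linearization_def)
    show ?case
    proof (rule linear_map_eqI[OF m assms(1) _ _ _ h])
      show "linear_map K (?F y z) (?F w z) (\<lambda>h. ?c w y z h (?c w x y g f))"
        using linl[OF o(1,3,4) cl[OF o(1-3) f g]] .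
      show "linear_map K (?F y z) (?F w z) (\<lambda>h. ?c w x z (?c x y z h g) f)"
        using linear_map_comp[OF linl[OF o(2-4) g] linl[OF o(1,2,4) f]] .
      fix h assume h: "h \<in> Hom A y z"
      show "?c w y z (basis_vector K h) (?c w x y g f) = ?c w x z (?c x y z (basis_vector K h) g) f"
      proof (rule linear_map_eqI[OF m assms(1) _ _ _ g])
        show "linear_map K (?F x y) (?F w z) (\<lambda>g. ?c w y z (basis_vector K h) (?c w x y g f))"
          using linear_map_comp[OF linl[OF o(1-3) f] linr[OF o(1,3,4) bc[OF h]]] .
        show "linear_map K (?F x y) (?F w z) (\<lambda>g. ?c w x z (?c x y z (basis_vector K h) g) f)"
          using linear_map_comp[OF linr[OF o(2-4) bc[OF h]] linl[OF o(1,2,4) f]] .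
        fix g assume g: "g \<in> Hom A x y"
        show "?c w y z (basis_vector K h) (?c w x y (basis_vector K g) f) =
          ?c w x z (?c x y z (basis_vector K h) (basis_vector K g)) f"
        proof (rule linear_map_eqI[OF m assms(1) _ _ _ f])
          show "linear_map K (?F w x) (?F w z) (\<lambda>f. ?c w y z (basis_vector K h) (?c w x y (basis_vector K g) f))"
            using linear_map_comp[OF linr[OF o(1-3) bc[OF g]] linr[OF o(1,3,4) bc[OF h]]] .
          show "linear_map K (?F w x) (?F w z) (\<lambda>f. ?c w x z (?c x y z (basis_vector K h) (basis_vector K g)) f)"
            using linr[OF o(1,2,4) cl[OF o(2-4) bc[OF g] bc[OF h]]] .
          fix f assume f: "f \<in> Hom A w x"
          show "?c w y z (basis_vector K h) (?c w x y (basis_vector K g) (basis_vector K f)) =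
            ?c w x z (?c x y z (basis_vector K h) (basis_vector K g)) (basis_vector K f)"
            by (simp add: bas f g h o A.comp_closed[of _ x] A.comp_closed[of _ y] A.comp_assoc)
        qed
      qed
    qed
  qed
  moreover have "LOb (linearization K A) = Ob A" "LHom (linearization K A) = ?F"
    by (simp_all add: linearization_def)
  ultimately show ?thesis
    unfolding linear_category_def by (auto intro: m linl linr)
qed

end

theory Submission
  imports Defs "HOL-Algebra.Free_Abelian_Groups"
begin

text \<open>
  Let \<open>C\<close> be the linearization and \<open>\<epsilon>\<close> from \<open>P 0\<close> to \<open>C\<close> the augmentation of a projective resolution
  of the regular bimodule. The differential \<open>\<delta> 0\<close>, viewed as a cocycle with values in the kernel of
  \<open>\<epsilon>\<close>, is a coboundary if and only if \<open>\<epsilon>\<close> splits, and a splitting kills all of the first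
  cohomology; hence \<open>C\<close> is separable if and only if every epimorphism from a small bimodule onto
  \<open>C\<close> splits. If \<open>C\<close> is separable, the epimorphism from the sum over all objects \<open>z\<close> of the
  bimodules \<open>C(z, -) \<otimes> C(-, z)\<close>, given by composition, has a section. In a delta category no two
  distinct objects have morphisms in both directions, so the section sends the identity of \<open>x\<close> into the
  summand at \<open>x\<close>; a morphism from \<open>x\<close> to \<open>y\<close> is then sent into the summands at \<open>x\<close> and at
  \<open>y\<close>, hence to zero unless \<open>x = y\<close>. Conversely, over a discrete category the enveloping category
  has only multiples of identities as morphisms, and lifting each identity of \<open>C\<close> through \<open>\<epsilon>\<close>
  gives a section.
\<close>

section \<open>Modules and tensor products\<close>

text \<open>Two obstacles shape the proof. First, \<open>projective\<close>, \<open>Ext\<close> and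
  \<open>separable\<close> speak only of functors with values in the single type \<open>'u\<close>,
  while sums of representable functors and the regular bimodule have their values in other types.
  Small functors are therefore copied into \<open>'u\<close> along injections, and the cardinal
  arithmetic of an infinite \<open>'u\<close> shows that free functors stay small. Second,
  \<open>Ext\<close> picks a resolution by \<open>SOME\<close>: one has to exist before anything is
  known about the pick, and the argument has to run for an unknown one. What helps is that the pick
  is made before the coefficients are given, so the kernel of its own augmentation may serve as
  coefficients. Projectivity of \<open>P 0\<close> then replaces the unknown augmentation by any
  chosen epimorphism \<open>\<pi>\<close> onto the regular bimodule: lift the augmentation through
  \<open>\<pi>\<close> and compose with the section. The summand at \<open>z\<close> of the bimodule
  used for this is the functor represented by the diagonal object \<open>(z, z)\<close> of the
  enveloping category; maps out of the sum are thus given by one element per object, and identities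
  as these elements give composition.\<close>

lemma module_image:
  assumes V: "Module.module K V" and surj: "p ` carrier V = carrier Q" and zero: "p \<zero>\<^bsub>V\<^esub> = \<zero>\<^bsub>Q\<^esub>"
    and add: "\<And>v w. \<lbrakk>v \<in> carrier V; w \<in> carrier V\<rbrakk> \<Longrightarrow> p (v \<oplus>\<^bsub>V\<^esub> w) = p v \<oplus>\<^bsub>Q\<^esub> p w"
    and smult: "\<And>r v. \<lbrakk>r \<in> carrier K; v \<in> carrier V\<rbrakk> \<Longrightarrow> p (r \<odot>\<^bsub>V\<^esub> v) = r \<odot>\<^bsub>Q\<^esub> p v"
  shows "Module.module K Q"
proof -
  interpret V: Module.module K V by fact
  have cl: "p v \<in> carrier Q" if "v \<in> carrier V" for v using surj that by blast
  have ex: "\<exists>v. v \<in> carrier V \<and> q = p v" if "q \<in> carrier Q" for q using surj that by blast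
  \<comment> \<open>All laws of \<open>Q\<close> are read backwards through \<open>p\<close>:
    operations on images are images of operations in \<open>V\<close>. As \<open>Q\<close> is still
    a bare record, its zero has to be given as an image and cannot be deduced by
    cancellation.\<close>
  note simps = add[symmetric] smult[symmetric] zero[symmetric]
  have ab: "abelian_group Q"
  proof (rule abelian_groupI)
    fix x assume "x \<in> carrier Q"
    then obtain v where v: "v \<in> carrier V" "x = p v" using ex by blast
    show "\<exists>y\<in>carrier Q. y \<oplus>\<^bsub>Q\<^esub> x = \<zero>\<^bsub>Q\<^esub>"
      by (rule bexI[of _ "p (\<ominus>\<^bsub>V\<^esub> v)"]) (use v in \<open>simp_all add: simps V.M.l_neg cl\<close>)
    show "\<zero>\<^bsub>Q\<^esub> \<oplus>\<^bsub>Q\<^esub> x = x" using v by (simp add: simps)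
    fix y assume "y \<in> carrier Q"
    then obtain w where w: "w \<in> carrier V" "y = p w" using ex by blast
    show "x \<oplus>\<^bsub>Q\<^esub> y \<in> carrier Q" "x \<oplus>\<^bsub>Q\<^esub> y = y \<oplus>\<^bsub>Q\<^esub> x"
      using v w by (simp_all add: simps cl V.M.a_comm)
    fix z assume "z \<in> carrier Q"
    then obtain u where u: "u \<in> carrier V" "z = p u" using ex by blast
    show "x \<oplus>\<^bsub>Q\<^esub> y \<oplus>\<^bsub>Q\<^esub> z = x \<oplus>\<^bsub>Q\<^esub> (y \<oplus>\<^bsub>Q\<^esub> z)"
      using v w u by (simp add: simps V.M.a_assoc)
  qed (simp add: simps cl)
  show ?thesis
  proof (rule moduleI[OF V.R.is_cring ab])
    fix a b x assume ab: "a \<in> carrier K" "b \<in> carrier K" and "x \<in> carrier Q"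
    then obtain v where v: "v \<in> carrier V" "x = p v" using ex by blast
    show "(a \<oplus>\<^bsub>K\<^esub> b) \<odot>\<^bsub>Q\<^esub> x = a \<odot>\<^bsub>Q\<^esub> x \<oplus>\<^bsub>Q\<^esub> b \<odot>\<^bsub>Q\<^esub> x" "(a \<otimes>\<^bsub>K\<^esub> b) \<odot>\<^bsub>Q\<^esub> x = a \<odot>\<^bsub>Q\<^esub> (b \<odot>\<^bsub>Q\<^esub> x)"
      using v ab by (simp_all add: simps V.smult_l_distr V.smult_assoc1)
  next
    fix a x y assume a: "a \<in> carrier K" and "x \<in> carrier Q" "y \<in> carrier Q"
    then obtain v w where vw: "v \<in> carrier V" "x = p v" "w \<in> carrier V" "y = p w" using ex by metis
    show "a \<odot>\<^bsub>Q\<^esub> (x \<oplus>\<^bsub>Q\<^esub> y) = a \<odot>\<^bsub>Q\<^esub> x \<oplus>\<^bsub>Q\<^esub> a \<odot>\<^bsub>Q\<^esub> y"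
      using vw a by (simp add: simps V.smult_r_distr)
  next
    fix a x assume a: "a \<in> carrier K" and "x \<in> carrier Q"
    then obtain v where v: "v \<in> carrier V" "x = p v" using ex by blast
    show "a \<odot>\<^bsub>Q\<^esub> x \<in> carrier Q" using v a by (simp add: simps cl)
  next
    fix x assume "x \<in> carrier Q"
    then obtain v where "v \<in> carrier V" "x = p v" using ex by blast
    then show "\<one>\<^bsub>K\<^esub> \<odot>\<^bsub>Q\<^esub> x = x" by (simp add: simps)
  qed
qed

lemma linear_mapI:
  assumes "\<And>v. v \<in> carrier V \<Longrightarrow> h v \<in> carrier W"
    and "\<And>v w. \<lbrakk>v \<in> carrier V; w \<in> carrier V\<rbrakk> \<Longrightarrow> h (v \<oplus>\<^bsub>V\<^esub> w) = h v \<oplus>\<^bsub>W\<^esub> h w"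
    and "\<And>r v. \<lbrakk>r \<in> carrier K; v \<in> carrier V\<rbrakk> \<Longrightarrow> h (r \<odot>\<^bsub>V\<^esub> v) = r \<odot>\<^bsub>W\<^esub> h v"
  shows "linear_map K V W h"
  using assms unfolding linear_map_def by blast

lemma linear_map_add:
  "\<lbrakk>linear_map K V W h; v \<in> carrier V; w \<in> carrier V\<rbrakk> \<Longrightarrow> h (v \<oplus>\<^bsub>V\<^esub> w) = h v \<oplus>\<^bsub>W\<^esub> h w"
  and linear_map_smult:
  "\<lbrakk>linear_map K V W h; r \<in> carrier K; v \<in> carrier V\<rbrakk> \<Longrightarrow> h (r \<odot>\<^bsub>V\<^esub> v) = r \<odot>\<^bsub>W\<^esub> h v"
  unfolding linear_map_def by blast+

lemma linear_map_cong:
  assumes "Module.module K V" "\<And>v. v \<in> carrier V \<Longrightarrow> g v = h v"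
  shows "linear_map K V W g \<longleftrightarrow> linear_map K V W h"
proof -
  interpret Module.module K V by fact
  show ?thesis unfolding linear_map_def using assms(2) by (auto simp: Pi_iff)
qed

lemma linear_map_zero:
  assumes "Module.module K V" "Module.module K W" "linear_map K V W h"
  shows "h \<zero>\<^bsub>V\<^esub> = \<zero>\<^bsub>W\<^esub>"
  using linear_map_finsum[OF assms, of "{}" "\<lambda>_. \<zero>\<^bsub>V\<^esub>"] assms(1,2)
  by (simp add: abelian_monoid.finsum_empty Module.module_def abelian_group_def)

lemma linear_map_minus:
  assumes "Module.module K V" "Module.module K W" "linear_map K V W h" "v \<in> carrier V" "w \<in> carrier V"
  shows "h (v \<ominus>\<^bsub>V\<^esub> w) = h v \<ominus>\<^bsub>W\<^esub> h w"
proof -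
  interpret V: Module.module K V by fact
  interpret W: Module.module K W by fact
  have hw: "h w \<in> carrier W" using linear_map_closed[OF assms(3,5)] .
  have "h (\<ominus>\<^bsub>V\<^esub> w) = h ((\<ominus>\<^bsub>K\<^esub> \<one>\<^bsub>K\<^esub>) \<odot>\<^bsub>V\<^esub> w)" using assms(5) by (simp add: V.smult_l_minus)
  also have "\<dots> = \<ominus>\<^bsub>W\<^esub> h w"
    using hw assms(5) by (simp add: linear_map_smult[OF assms(3)] W.smult_l_minus)
  finally show ?thesis using assms(4,5) by (simp add: a_minus_def linear_map_add[OF assms(3)])
qed

lemma linear_map_difference:
  assumes "Module.module K V" "Module.module K W" "linear_map K V W g" "linear_map K V W h"
  shows "linear_map K V W (\<lambda>v. g v \<ominus>\<^bsub>W\<^esub> h v)"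
proof -
  interpret V: Module.module K V by fact
  interpret W: Module.module K W by fact
  note c = linear_map_closed[OF assms(3)] linear_map_closed[OF assms(4)]
  show ?thesis
  proof (rule linear_mapI, goal_cases)
    case 1 then show ?case by (simp add: c)
  next
    case 2 then show ?case
      by (simp add: c linear_map_add[OF assms(3)] linear_map_add[OF assms(4)] a_minus_def
          W.M.minus_add W.M.a_ac)
  next
    case 3 then show ?case
      by (simp add: c linear_map_smult[OF assms(3)] linear_map_smult[OF assms(4)] a_minus_def
          W.smult_r_distr W.smult_r_minus)
  qed
qed

lemma linear_map_smult_const:
  assumes "Module.module K V" "r \<in> carrier K" shows "linear_map K V V (\<lambda>v. r \<odot>\<^bsub>V\<^esub> v)"
proof -
  interpret Module.module K V by fact
  show ?thesis
    by (rule linear_mapI) (use assms(2) in \<open>auto simp: smult_r_distr smult_assoc1[symmetric] R.m_comm\<close>)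
qed

lemma (in Module.module) minus_eq_zero_iff:
  assumes "x \<in> carrier M" "y \<in> carrier M" shows "x \<ominus>\<^bsub>M\<^esub> y = \<zero>\<^bsub>M\<^esub> \<longleftrightarrow> x = y"
  using assms by (metis M.minus_eq M.r_neg M.minus_minus M.minus_equality M.a_inv_closed)

lemma submodule_kernel:
  assumes "Module.module K V" "Module.module K W" "linear_map K V W h"
  shows "submodule {v \<in> carrier V. h v = \<zero>\<^bsub>W\<^esub>} K V"
proof -
  interpret V: Module.module K V by fact
  interpret W: Module.module K W by fact
  have "h (\<ominus>\<^bsub>V\<^esub> v) = \<zero>\<^bsub>W\<^esub>" if "v \<in> carrier V" "h v = \<zero>\<^bsub>W\<^esub>" for v
    using linear_map_minus[OF assms V.M.zero_closed that(1)] that linear_map_zero[OF assms]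
    by (simp add: a_minus_def)
  then show ?thesis
    using linear_map_zero[OF assms] linear_map_add[OF assms(3)] linear_map_smult[OF assms(3)]
    by (intro V.submoduleI) auto
qed

section \<open>Quotients by submodules\<close>

context
  fixes K :: "('k, 'z) ring_scheme" and V :: "('k, 'v) module" and N :: "'v set"
  assumes V: "Module.module K V" and N: "submodule N K V"
begin

interpretation V: Module.module K V by (rule V)

lemma abelian_subgroup_submodule: "abelian_subgroup N V"
  by (intro abelian_subgroupI3 additive_subgroupI submodule.axioms(1)[OF N] V.abelian_group_axioms)

interpretation N: abelian_subgroup N V by (rule abelian_subgroup_submodule)

lemma quotient_module_simps:
  "carrier (quotient_module V N) = (\<lambda>v. N +>\<^bsub>V\<^esub> v) ` carrier V" "\<zero>\<^bsub>quotient_module V N\<^esub> = N"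
  by (auto simp: quotient_module_def A_RCOSETS_def')

text \<open>\<open>quotient_module\<close> defines \<open>r\<close> times a coset as a union of
  cosets over all representatives. Two representatives differ by an element of \<open>N\<close>,
  which stays in \<open>N\<close> when multiplied by \<open>r\<close>; so all members of the union
  coincide, and the coset over which it runs is not empty.\<close>

lemma coset_smult:
  assumes r: "r \<in> carrier K" and v: "v \<in> carrier V"
  shows "r \<odot>\<^bsub>quotient_module V N\<^esub> (N +>\<^bsub>V\<^esub> v) = N +>\<^bsub>V\<^esub> (r \<odot>\<^bsub>V\<^esub> v)"
proof -
  have "N +>\<^bsub>V\<^esub> (r \<odot>\<^bsub>V\<^esub> w) = N +>\<^bsub>V\<^esub> (r \<odot>\<^bsub>V\<^esub> v)" if w: "w \<in> N +>\<^bsub>V\<^esub> v" for w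
  proof -
    obtain n where n: "n \<in> N" "w = n \<oplus>\<^bsub>V\<^esub> v" using w by (auto simp: a_r_coset_def')
    then have "r \<odot>\<^bsub>V\<^esub> w = r \<odot>\<^bsub>V\<^esub> n \<oplus>\<^bsub>V\<^esub> r \<odot>\<^bsub>V\<^esub> v"
      using r v N.a_subset by (auto intro!: V.smult_r_distr)
    moreover have "r \<odot>\<^bsub>V\<^esub> n \<in> N" using submodule.smult_closed[OF N r] n by blast
    ultimately have "r \<odot>\<^bsub>V\<^esub> w \<in> N +>\<^bsub>V\<^esub> (r \<odot>\<^bsub>V\<^esub> v)" by (auto simp: a_r_coset_def')
    then show ?thesis using N.a_repr_independence' r v by (metis V.smult_closed)
  qed
  moreover have "N +>\<^bsub>V\<^esub> v \<noteq> {}" using N.a_rcos_self[OF v] by blast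
  ultimately show ?thesis by (simp add: quotient_module_def SUP_eq_const)
qed

lemma coset_add:
  assumes "v \<in> carrier V" "w \<in> carrier V"
  shows "(N +>\<^bsub>V\<^esub> v) \<oplus>\<^bsub>quotient_module V N\<^esub> (N +>\<^bsub>V\<^esub> w) = N +>\<^bsub>V\<^esub> (v \<oplus>\<^bsub>V\<^esub> w)"
  using N.a_rcos_sum[OF assms] by (simp add: quotient_module_def)

lemma coset_eq_zero_iff: "v \<in> carrier V \<Longrightarrow> N +>\<^bsub>V\<^esub> v = N \<longleftrightarrow> v \<in> N"
  using N.a_rcos_self[of v] N.a_rcos_const[of v] by auto

lemma module_quotient_module: "Module.module K (quotient_module V N)"
  by (rule module_image[OF V, where p = "\<lambda>v. N +>\<^bsub>V\<^esub> v"])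
    (simp_all add: quotient_module_simps coset_add coset_smult coset_eq_zero_iff)

lemma linear_map_coset: "linear_map K V (quotient_module V N) (\<lambda>v. N +>\<^bsub>V\<^esub> v)"
  by (rule linear_mapI) (simp_all add: quotient_module_simps(1) coset_add coset_smult)

text \<open>The form matches \<open>tensor_lift\<close>, which evaluates at a representative picked
  by \<open>SOME\<close>. The pick differs from \<open>v\<close> by an element of \<open>N\<close>,
  and \<open>h\<close> kills \<open>N\<close>.\<close>

lemma quotient_lift_coset:
  assumes U: "Module.module K U" and h: "linear_map K V U h" and z: "\<And>n. n \<in> N \<Longrightarrow> h n = \<zero>\<^bsub>U\<^esub>"
    and v: "v \<in> carrier V"
  shows "h (SOME a. a \<in> N +>\<^bsub>V\<^esub> v) = h v"
proof -
  interpret U: Module.module K U by fact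
  have "(SOME a. a \<in> N +>\<^bsub>V\<^esub> v) \<in> N +>\<^bsub>V\<^esub> v" by (rule someI) (rule N.a_rcos_self[OF v])
  then obtain n where n: "n \<in> N" "(SOME a. a \<in> N +>\<^bsub>V\<^esub> v) = n \<oplus>\<^bsub>V\<^esub> v"
    by (auto simp: a_r_coset_def')
  then have "h (n \<oplus>\<^bsub>V\<^esub> v) = h n \<oplus>\<^bsub>U\<^esub> h v"
    using N.a_subset v by (intro linear_map_add[OF h]) auto
  then show ?thesis using n z linear_map_closed[OF h v] by simp
qed

lemma quotient_lift_linear:
  assumes U: "Module.module K U" and h: "linear_map K V U h" and z: "\<And>n. n \<in> N \<Longrightarrow> h n = \<zero>\<^bsub>U\<^esub>"
  shows "linear_map K (quotient_module V N) U (\<lambda>t. h (SOME a. a \<in> t))"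
  by (rule linear_mapI)
    (auto simp: quotient_module_simps coset_add coset_smult quotient_lift_coset[OF U h z]
      linear_map_closed[OF h] linear_map_add[OF h] linear_map_smult[OF h])

end

lemma submodule_submodule_span:
  assumes "Module.module K V" "S \<subseteq> carrier V"
  shows "submodule (submodule_span K V S) K V"
proof -
  interpret Module.module K V by fact
  let ?A = "{N. submodule N K V \<and> S \<subseteq> N}"
  \<comment> \<open>The whole module belongs to the family, which keeps the intersection inside the
    carrier.\<close>
  have c: "carrier V \<in> ?A" using carrier_is_submodule assms(2) by simp
  have sub: "submodule N K V" if "N \<in> ?A" for N using that by simp
  show ?thesis unfolding submodule_span_def
  proof (rule submoduleI)
    show "\<Inter> ?A \<subseteq> carrier V" using c by blast
    show "\<zero>\<^bsub>V\<^esub> \<in> \<Inter> ?A"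
      using subgroup.one_closed[OF submodule.axioms(1)[OF sub]] by (intro InterI) simp
  next
    fix a assume a: "a \<in> \<Inter> ?A"
    show "\<ominus>\<^bsub>V\<^esub> a \<in> \<Inter> ?A" using submoduleE(3)[OF sub] a by blast
    fix b assume "b \<in> \<Inter> ?A"
    then show "a \<oplus>\<^bsub>V\<^esub> b \<in> \<Inter> ?A" using submoduleE(5)[OF sub] a by blast
  next
    fix r a assume "r \<in> carrier K" "a \<in> \<Inter> ?A"
    then show "r \<odot>\<^bsub>V\<^esub> a \<in> \<Inter> ?A" using submoduleE(4)[OF sub] by blast
  qed
qed

lemma submodule_span_superset: "S \<subseteq> submodule_span K V S"
  and submodule_span_minimal: "\<lbrakk>submodule N K V; S \<subseteq> N\<rbrakk> \<Longrightarrow> submodule_span K V S \<subseteq> N"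
  unfolding submodule_span_def by blast+

definition bilinear_map ::
    "('k, 'z) ring_scheme \<Rightarrow> ('k, 'v) module \<Rightarrow> ('k, 'w) module \<Rightarrow> ('k, 'u) module
      \<Rightarrow> ('v \<Rightarrow> 'w \<Rightarrow> 'u) \<Rightarrow> bool" where
  "bilinear_map K V W U \<beta> \<longleftrightarrow> (\<forall>v \<in> carrier V. linear_map K W U (\<beta> v)) \<and>
     (\<forall>w \<in> carrier W. linear_map K V U (\<lambda>v. \<beta> v w))"

lemma bilinear_mapD:
  assumes "bilinear_map K V W U \<beta>"
  shows "v \<in> carrier V \<Longrightarrow> linear_map K W U (\<beta> v)" "w \<in> carrier W \<Longrightarrow> linear_map K V U (\<lambda>v. \<beta> v w)"
  using assms unfolding bilinear_map_def by blast+

section \<open>Tensor products and their universal property\<close>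

context
  fixes K :: "('k, 'z) ring_scheme" and V :: "('k, 'v) module" and W :: "('k, 'w) module"
  assumes V: "Module.module K V" and W: "Module.module K W"
begin

interpretation V: Module.module K V by (rule V)
interpretation W: Module.module K W by (rule W)

private abbreviation (input) "pair_module \<equiv> free_module K (carrier V \<times> carrier W)"

lemma module_pair_module: "Module.module K pair_module"
  by (rule module_free_module) (rule V.R.is_cring)

interpretation F: Module.module K pair_module by (rule module_pair_module)

lemma pair_basis_vector_closed:
  "\<lbrakk>v \<in> carrier V; w \<in> carrier W\<rbrakk> \<Longrightarrow> basis_vector K (v, w) \<in> carrier pair_module"
  by (rule basis_vector_closed) (auto intro: V.R.is_cring)

lemma submodule_tensor_relations: "submodule (tensor_relations K V W) K pair_module"
  unfolding tensor_relations_def Let_def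
  by (rule submodule_submodule_span[OF module_pair_module]) (auto intro!: pair_basis_vector_closed F.M.minus_closed)

lemma module_tensor_product: "Module.module K (tensor_product K V W)"
  unfolding tensor_product_def by (rule module_quotient_module[OF module_pair_module submodule_tensor_relations])

interpretation T: Module.module K "tensor_product K V W" by (rule module_tensor_product)

private abbreviation (input) "pair_coset a \<equiv> tensor_relations K V W +>\<^bsub>pair_module\<^esub> a"

lemma linear_map_pair_coset: "linear_map K pair_module (tensor_product K V W) (\<lambda>a. pair_coset a)"
  unfolding tensor_product_def by (rule linear_map_coset[OF module_pair_module submodule_tensor_relations])

lemma carrier_tensor_product: "carrier (tensor_product K V W) = (\<lambda>a. pair_coset a) ` carrier pair_module"
  unfolding tensor_product_def
  by (rule quotient_module_simps(1)[OF module_pair_module submodule_tensor_relations])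

lemma pair_coset_eqI:
  assumes "a \<in> carrier pair_module" "b \<in> carrier pair_module" "a \<ominus>\<^bsub>pair_module\<^esub> b \<in> tensor_relations K V W"
  shows "pair_coset a = pair_coset b"
proof -
  have "pair_coset a \<ominus>\<^bsub>tensor_product K V W\<^esub> pair_coset b = pair_coset (a \<ominus>\<^bsub>pair_module\<^esub> b)"
    using linear_map_minus[OF module_pair_module module_tensor_product linear_map_pair_coset assms(1,2)] by simp
  also have "\<dots> = \<zero>\<^bsub>tensor_product K V W\<^esub>"
    using assms coset_eq_zero_iff[OF module_pair_module submodule_tensor_relations]
    by (simp add: tensor_product_def quotient_module_simps(2)[OF module_pair_module submodule_tensor_relations])
  finally show ?thesis
    using T.minus_eq_zero_iff linear_map_closed[OF linear_map_pair_coset] assms(1,2) by blast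
qed

lemma pure_tensor_closed:
  "\<lbrakk>v \<in> carrier V; w \<in> carrier W\<rbrakk> \<Longrightarrow> pure_tensor K V W v w \<in> carrier (tensor_product K V W)"
  unfolding pure_tensor_def carrier_tensor_product using pair_basis_vector_closed by blast

text \<open>Each of the four families of generating relations yields one law: additivity or
  homogeneity in one of the two arguments. The remaining goals are closure.\<close>

lemma bilinear_pure_tensor: "bilinear_map K V W (tensor_product K V W) (pure_tensor K V W)"
proof -
  note bc = pair_basis_vector_closed
  have gen: "x \<in> tensor_relations K V W"
    if "x \<in> ({basis_vector K (v \<oplus>\<^bsub>V\<^esub> v', w) \<ominus>\<^bsub>pair_module\<^esub> (basis_vector K (v, w) \<oplus>\<^bsub>pair_module\<^esub> basis_vector K (v', w)) | v v' w.
          v \<in> carrier V \<and> v' \<in> carrier V \<and> w \<in> carrier W} \<union>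
       {basis_vector K (v, w \<oplus>\<^bsub>W\<^esub> w') \<ominus>\<^bsub>pair_module\<^esub> (basis_vector K (v, w) \<oplus>\<^bsub>pair_module\<^esub> basis_vector K (v, w')) | v w w'.
          v \<in> carrier V \<and> w \<in> carrier W \<and> w' \<in> carrier W} \<union>
       {basis_vector K (r \<odot>\<^bsub>V\<^esub> v, w) \<ominus>\<^bsub>pair_module\<^esub> r \<odot>\<^bsub>pair_module\<^esub> basis_vector K (v, w) | r v w.
          r \<in> carrier K \<and> v \<in> carrier V \<and> w \<in> carrier W} \<union>
       {basis_vector K (v, r \<odot>\<^bsub>W\<^esub> w) \<ominus>\<^bsub>pair_module\<^esub> r \<odot>\<^bsub>pair_module\<^esub> basis_vector K (v, w) | r v w.
          r \<in> carrier K \<and> v \<in> carrier V \<and> w \<in> carrier W})" for x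
    using subsetD[OF submodule_span_superset that] unfolding tensor_relations_def Let_def .
  note add = linear_map_add[OF linear_map_pair_coset, symmetric]
    and smult = linear_map_smult[OF linear_map_pair_coset, symmetric]
  show ?thesis unfolding bilinear_map_def
  proof (intro conjI ballI linear_mapI, goal_cases)
    case (2 v w w') show ?case unfolding pure_tensor_def
      by (use 2 in \<open>subst add\<close>; (rule pair_coset_eqI)?; auto intro!: bc gen)
  next
    case (3 v r w) show ?case unfolding pure_tensor_def
      by (use 3 in \<open>subst smult\<close>; (rule pair_coset_eqI)?; auto intro!: bc gen)
  next
    case (5 w v v') show ?case unfolding pure_tensor_def
      by (use 5 in \<open>subst add\<close>; (rule pair_coset_eqI)?; auto intro!: bc gen)
  next
    case (6 w r v) show ?case unfolding pure_tensor_def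
      by (use 6 in \<open>subst smult\<close>; (rule pair_coset_eqI)?; auto intro!: bc gen)
  qed (auto intro: pure_tensor_closed)
qed

text \<open>Composed with the coset map, both sides are linear on a free module and agree on its
  basis vectors, whose cosets are the pure tensors. Later identities for arbitrary tensors are
  reduced to pure ones by this rule.\<close>

lemma linear_map_tensor_eqI:
  assumes U: "Module.module K U"
    and g: "linear_map K (tensor_product K V W) U g" and h: "linear_map K (tensor_product K V W) U h"
    and eq: "\<And>v w. \<lbrakk>v \<in> carrier V; w \<in> carrier W\<rbrakk> \<Longrightarrow> g (pure_tensor K V W v w) = h (pure_tensor K V W v w)"
    and t: "t \<in> carrier (tensor_product K V W)"
  shows "g t = h t"
proof -
  obtain a where a: "a \<in> carrier pair_module" "t = pair_coset a" using t by (auto simp: carrier_tensor_product)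
  have "g (pair_coset a) = h (pair_coset a)"
    by (rule linear_map_eqI[OF U V.R.is_cring linear_map_comp[OF linear_map_pair_coset g] linear_map_comp[OF linear_map_pair_coset h] _ a(1)])
      (use eq in \<open>auto simp: pure_tensor_def\<close>)
  then show ?thesis using a by simp
qed

context
  fixes U :: "('k, 'u) module" and \<beta> :: "'v \<Rightarrow> 'w \<Rightarrow> 'u"
  assumes U: "Module.module K U" and \<beta>: "bilinear_map K V W U \<beta>"
begin

interpretation U: Module.module K U by (rule U)

lemma case_prod_bilinear: "(\<lambda>(v, w). \<beta> v w) \<in> carrier V \<times> carrier W \<rightarrow> carrier U"
  using linear_map_closed[OF bilinear_mapD(1)[OF \<beta>]] by auto

text \<open>The kernel of the linear extension is a submodule. Bilinearity puts the generating
  relations into it, and the span is the least submodule that contains them.\<close>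

lemma linear_extension_tensor_relations:
  assumes "n \<in> tensor_relations K V W"
  shows "linear_extension K U (\<lambda>(v, w). \<beta> v w) n = \<zero>\<^bsub>U\<^esub>"
proof -
  let ?h = "linear_extension K U (\<lambda>(v, w). \<beta> v w)"
  have h: "linear_map K pair_module U ?h" by (rule linear_extension_linear[OF U case_prod_bilinear])
  have hb: "?h (basis_vector K (v, w)) = \<beta> v w" if "v \<in> carrier V" "w \<in> carrier W" for v w
    using linear_extension_basis[OF U case_prod_bilinear, of "(v, w)"] that by simp
  have cl: "\<beta> v w \<in> carrier U" if "v \<in> carrier V" "w \<in> carrier W" for v w
    using linear_map_closed[OF bilinear_mapD(1)[OF \<beta>]] that .
  note simps = linear_map_minus[OF module_pair_module U h] linear_map_add[OF h] linear_map_smult[OF h] hb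
    pair_basis_vector_closed linear_map_add[OF bilinear_mapD(1)[OF \<beta>]] linear_map_add[OF bilinear_mapD(2)[OF \<beta>]]
    linear_map_smult[OF bilinear_mapD(1)[OF \<beta>]] linear_map_smult[OF bilinear_mapD(2)[OF \<beta>]] cl U.minus_eq_zero_iff
  have "tensor_relations K V W \<subseteq> {a \<in> carrier pair_module. ?h a = \<zero>\<^bsub>U\<^esub>}"
    unfolding tensor_relations_def Let_def
    by (rule submodule_span_minimal[OF submodule_kernel[OF module_pair_module U h]])
      (auto simp: simps intro!: F.M.minus_closed)
  then show ?thesis using assms by blast
qed

lemma linear_map_tensor_lift: "linear_map K (tensor_product K V W) U (tensor_lift K U \<beta>)"
  unfolding tensor_product_def tensor_lift_def
  by (rule quotient_lift_linear[OF module_pair_module submodule_tensor_relations U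
        linear_extension_linear[OF U case_prod_bilinear] linear_extension_tensor_relations])

lemma tensor_lift_pure_tensor:
  assumes "v \<in> carrier V" "w \<in> carrier W"
  shows "tensor_lift K U \<beta> (pure_tensor K V W v w) = \<beta> v w"
proof -
  have "tensor_lift K U \<beta> (pure_tensor K V W v w)
    = linear_extension K U (\<lambda>(v, w). \<beta> v w) (basis_vector K (v, w))"
    unfolding tensor_lift_def pure_tensor_def
    by (rule quotient_lift_coset[OF module_pair_module submodule_tensor_relations U
          linear_extension_linear[OF U case_prod_bilinear] linear_extension_tensor_relations
          pair_basis_vector_closed[OF assms]])
  also have "\<dots> = \<beta> v w"
    using linear_extension_basis[OF U case_prod_bilinear, of "(v, w)"] assms by simp
  finally show ?thesis .
qed

end

text \<open>For fixed \<open>t\<close> the lift is a finite sum whose coefficients are those of the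
  chosen representative of \<open>t\<close>, so linearity in \<open>p\<close> passes through
  termwise. This handles arguments that enter a lift as parameters: the other factor of a composite,
  or the element acted upon.\<close>

lemma linear_map_tensor_lift_parameter:
  assumes U: "Module.module K U" and P: "Module.module K P"
    and \<beta>: "\<And>v w. \<lbrakk>v \<in> carrier V; w \<in> carrier W\<rbrakk> \<Longrightarrow> linear_map K P U (\<lambda>p. \<beta> p v w)"
    and t: "t \<in> carrier (tensor_product K V W)"
  shows "linear_map K P U (\<lambda>p. tensor_lift K U (\<beta> p) t)"
proof -
  obtain a where a: "a \<in> carrier pair_module" "t = pair_coset a" using t by (auto simp: carrier_tensor_product)
  have "(SOME b. b \<in> t) \<in> t" using abelian_subgroup.a_rcos_self[OF
      abelian_subgroup_submodule[OF module_pair_module submodule_tensor_relations] a(1)] a(2) by (metis someI)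
  then have "(SOME b. b \<in> t) \<in> carrier pair_module"
    using a submodule.axioms(1)[OF submodule_tensor_relations, THEN subgroup.subset]
    by (auto simp: a_r_coset_def' intro!: F.M.a_closed)
  from linear_extension_linear_arg[OF U this P, of "\<lambda>p (v, w). \<beta> p v w"] show ?thesis
    unfolding tensor_lift_def using \<beta> by auto
qed

end

section \<open>Enveloping categories\<close>

lemma linear_categoryD:
  assumes "linear_category K C"
  shows linear_category_module:
      "\<lbrakk>x \<in> LOb C; y \<in> LOb C\<rbrakk> \<Longrightarrow> Module.module K (LHom C x y)"
    and linear_category_ide: "x \<in> LOb C \<Longrightarrow> LIde C x \<in> carrier (LHom C x x)"
    and linear_category_comp:
      "\<lbrakk>x \<in> LOb C; y \<in> LOb C; z \<in> LOb C; f \<in> carrier (LHom C x y); g \<in> carrier (LHom C y z)\<rbrakk>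
        \<Longrightarrow> LComp C x y z g f \<in> carrier (LHom C x z)"
    and linear_category_ide_left:
      "\<lbrakk>x \<in> LOb C; y \<in> LOb C; f \<in> carrier (LHom C x y)\<rbrakk> \<Longrightarrow> LComp C x y y (LIde C y) f = f"
    and linear_category_ide_right:
      "\<lbrakk>x \<in> LOb C; y \<in> LOb C; f \<in> carrier (LHom C x y)\<rbrakk> \<Longrightarrow> LComp C x x y f (LIde C x) = f"
    and linear_category_assoc:
      "\<lbrakk>w \<in> LOb C; x \<in> LOb C; y \<in> LOb C; z \<in> LOb C; f \<in> carrier (LHom C w x);
          g \<in> carrier (LHom C x y); h \<in> carrier (LHom C y z)\<rbrakk>
        \<Longrightarrow> LComp C w y z h (LComp C w x y g f) = LComp C w x z (LComp C x y z h g) f"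
    and linear_category_linear_right:
      "\<lbrakk>x \<in> LOb C; y \<in> LOb C; z \<in> LOb C; g \<in> carrier (LHom C y z)\<rbrakk>
        \<Longrightarrow> linear_map K (LHom C x y) (LHom C x z) (\<lambda>f. LComp C x y z g f)"
    and linear_category_linear_left:
      "\<lbrakk>x \<in> LOb C; y \<in> LOb C; z \<in> LOb C; f \<in> carrier (LHom C x y)\<rbrakk>
        \<Longrightarrow> linear_map K (LHom C y z) (LHom C x z) (\<lambda>g. LComp C x y z g f)"
proof -
  interpret category "underlying_category C" using assms by (simp add: linear_category_def)
  note s = underlying_category_def category.simps
  show "x \<in> LOb C \<Longrightarrow> LIde C x \<in> carrier (LHom C x x)"
    using ide_closed[unfolded s] .
  show "\<lbrakk>x \<in> LOb C; y \<in> LOb C; z \<in> LOb C; f \<in> carrier (LHom C x y); g \<in> carrier (LHom C y z)\<rbrakk>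
        \<Longrightarrow> LComp C x y z g f \<in> carrier (LHom C x z)"
    using comp_closed[unfolded s] .
  show "\<lbrakk>x \<in> LOb C; y \<in> LOb C; f \<in> carrier (LHom C x y)\<rbrakk> \<Longrightarrow> LComp C x y y (LIde C y) f = f"
    using comp_ide_left[unfolded s] .
  show "\<lbrakk>x \<in> LOb C; y \<in> LOb C; f \<in> carrier (LHom C x y)\<rbrakk> \<Longrightarrow> LComp C x x y f (LIde C x) = f"
    using comp_ide_right[unfolded s] .
  show "\<lbrakk>w \<in> LOb C; x \<in> LOb C; y \<in> LOb C; z \<in> LOb C; f \<in> carrier (LHom C w x);
          g \<in> carrier (LHom C x y); h \<in> carrier (LHom C y z)\<rbrakk>
        \<Longrightarrow> LComp C w y z h (LComp C w x y g f) = LComp C w x z (LComp C x y z h g) f"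
    using comp_assoc[unfolded s] .
qed (use assms in \<open>auto simp: linear_category_def\<close>)

lemma linear_category_opposite:
  assumes "linear_category K C" shows "linear_category K (opposite C)"
proof -
  note D = linear_categoryD[OF assms]
  have "category (underlying_category (opposite C))"
    by unfold_locales (simp_all add: underlying_category_def opposite_def D)
  then show ?thesis unfolding linear_category_def by (simp add: opposite_def D)
qed

lemma bilinear_map_comp:
  assumes \<beta>: "bilinear_map K V' W' U \<beta>" and p: "linear_map K V V' p" and q: "linear_map K W W' q"
  shows "bilinear_map K V W U (\<lambda>v w. \<beta> (p v) (q w))"
  unfolding bilinear_map_def
  by (intro conjI ballI linear_map_comp[OF q] linear_map_comp[OF p, of _ "\<lambda>v. \<beta> v _"]
      bilinear_mapD[OF \<beta>] linear_map_closed[OF p] linear_map_closed[OF q])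

lemma linear_map_id: "linear_map K V V (\<lambda>v. v)"
  unfolding linear_map_def by simp

lemma box_simps:
  "LOb (box K C D) = LOb C \<times> LOb D"
  "LHom (box K C D) (x, x') (y, y') = tensor_product K (LHom C x y) (LHom D x' y')"
  "LIde (box K C D) (x, x') = pure_tensor K (LHom C x x) (LHom D x' x') (LIde C x) (LIde D x')"
  by (simp_all add: box_def)

section \<open>The box product as a linear category\<close>

context
  fixes K :: "('k, 'z) ring_scheme"
    and C :: "('o, 'm, 'k) linear_category" and D :: "('p, 'n, 'k) linear_category"
  assumes C: "linear_category K C" and D: "linear_category K D"
begin

lemma box_module:
  "\<lbrakk>x \<in> LOb C; x' \<in> LOb D; y \<in> LOb C; y' \<in> LOb D\<rbrakk>
    \<Longrightarrow> Module.module K (tensor_product K (LHom C x y) (LHom D x' y'))"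
  by (intro module_tensor_product linear_category_module C D)

context
  fixes x y z :: 'o and x' y' z' :: 'p
  assumes o: "x \<in> LOb C" "y \<in> LOb C" "z \<in> LOb C" "x' \<in> LOb D" "y' \<in> LOb D" "z' \<in> LOb D"
begin

lemma box_comp_bilinear_inner:
  assumes "g \<in> carrier (LHom C y z)" "g' \<in> carrier (LHom D y' z')"
  shows "bilinear_map K (LHom C x y) (LHom D x' y') (tensor_product K (LHom C x z) (LHom D x' z'))
    (\<lambda>f f'. pure_tensor K (LHom C x z) (LHom D x' z') (LComp C x y z g f) (LComp D x' y' z' g' f'))"
  by (rule bilinear_map_comp[OF bilinear_pure_tensor]; intro linear_categoryD[OF C] linear_categoryD[OF D] o assms)

text \<open>For fixed \<open>f\<close> and \<open>f'\<close> the pure tensor is bilinear in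
  \<open>g\<close> and \<open>g'\<close>. The inner lift at \<open>s\<close> combines these values
  with coefficients that depend on \<open>s\<close> only, so it stays bilinear with \<open>g\<close>
  or \<open>g'\<close> as parameter.\<close>

lemma box_comp_bilinear_outer:
  assumes s: "s \<in> carrier (tensor_product K (LHom C x y) (LHom D x' y'))"
  shows "bilinear_map K (LHom C y z) (LHom D y' z') (tensor_product K (LHom C x z) (LHom D x' z'))
    (\<lambda>g g'. tensor_lift K (tensor_product K (LHom C x z) (LHom D x' z'))
      (\<lambda>f f'. pure_tensor K (LHom C x z) (LHom D x' z') (LComp C x y z g f) (LComp D x' y' z' g' f')) s)"
proof -
  have b: "bilinear_map K (LHom C y z) (LHom D y' z') (tensor_product K (LHom C x z) (LHom D x' z'))
    (\<lambda>g g'. pure_tensor K (LHom C x z) (LHom D x' z') (LComp C x y z g f) (LComp D x' y' z' g' f'))"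
    if "f \<in> carrier (LHom C x y)" "f' \<in> carrier (LHom D x' y')" for f f'
    by (rule bilinear_map_comp[OF bilinear_pure_tensor]; intro linear_categoryD[OF C] linear_categoryD[OF D] o that)
  show ?thesis unfolding bilinear_map_def
    by (intro conjI ballI linear_map_tensor_lift_parameter[OF _ _ _ _ _ s] box_module
        linear_categoryD[OF C] linear_categoryD[OF D] o bilinear_mapD[OF b])
qed

text \<open>A composite is a lift inside a lift. Linearity in the outer tensor is the universal
  property of the outer lift; linearity in the inner tensor holds for every inner lift and is
  carried through the outer one as in a parameter.\<close>

lemma box_comp_bilinear:
  "bilinear_map K (LHom (box K C D) (y, y') (z, z')) (LHom (box K C D) (x, x') (y, y'))
    (LHom (box K C D) (x, x') (z, z')) (LComp (box K C D) (x, x') (y, y') (z, z'))"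
proof -
  note prems = o box_module linear_category_module[OF C] linear_category_module[OF D]
  show ?thesis
    unfolding bilinear_map_def box_simps box_def linear_category.simps prod.case Let_def
  proof (intro conjI ballI, goal_cases)
    case (1 t)
    show ?case
      by (rule linear_map_tensor_lift_parameter[OF _ _ _ _ linear_map_tensor_lift[OF _ _ _ box_comp_bilinear_inner] 1])
        (simp_all add: prems)
  next
    case (2 s)
    show ?case by (rule linear_map_tensor_lift[OF _ _ _ box_comp_bilinear_outer[OF 2]]) (simp_all add: prems)
  qed
qed

lemma box_comp_pure_tensor:
  assumes "f \<in> carrier (LHom C x y)" "f' \<in> carrier (LHom D x' y')"
    "g \<in> carrier (LHom C y z)" "g' \<in> carrier (LHom D y' z')"
  shows "LComp (box K C D) (x, x') (y, y') (z, z')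
      (pure_tensor K (LHom C y z) (LHom D y' z') g g') (pure_tensor K (LHom C x y) (LHom D x' y') f f')
    = pure_tensor K (LHom C x z) (LHom D x' z') (LComp C x y z g f) (LComp D x' y' z' g' f')"
  unfolding box_def linear_category.simps prod.case Let_def
  by (subst tensor_lift_pure_tensor[OF _ _ _ box_comp_bilinear_outer])
    (simp_all add: tensor_lift_pure_tensor[OF _ _ _ box_comp_bilinear_inner] linear_categoryD[OF C]
      linear_categoryD[OF D] o assms pure_tensor_closed box_module)

end

text \<open>On pure tensors the laws hold factor by factor. Both sides of a law are linear in every
  argument, so arbitrary tensors are replaced by pure ones, one argument at a time; associativity
  does this for three arguments in turn.\<close>

lemma linear_category_box: "linear_category K (box K C D)"
proof -
  note cd = linear_categoryD[OF C] linear_categoryD[OF D]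
  note bl = box_comp_bilinear[unfolded box_simps]
  let ?c = "LComp (box K C D)"
  let ?T = "\<lambda>x x' y y'. tensor_product K (LHom C x y) (LHom D x' y')"
  have cl: "?c (x, x') (y, y') (z, z') t s \<in> carrier (?T x x' z z')"
    if "x \<in> LOb C" "y \<in> LOb C" "z \<in> LOb C" "x' \<in> LOb D" "y' \<in> LOb D" "z' \<in> LOb D"
      "s \<in> carrier (?T x x' y y')" "t \<in> carrier (?T y y' z z')" for x x' y y' z z' s t
    using linear_map_closed[OF bilinear_mapD(1)[OF bl[OF that(1-6)] that(8)] that(7)] .
  have "category (underlying_category (box K C D))"
  proof (unfold_locales, unfold underlying_category_def category.simps box_simps, goal_cases)
    case (1 d)
    then show ?case by (auto simp: box_simps intro!: pure_tensor_closed cd)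
  next
    case (2 d e f s t)
    then show ?case by (cases d; cases e; cases f) (auto simp: box_simps intro!: cl)
  next
    case (3 d e s)
    obtain x x' y y' where [simp]: "d = (x, x')" "e = (y, y')" by (cases d; cases e) blast
    have o: "x \<in> LOb C" "y \<in> LOb C" "x' \<in> LOb D" "y' \<in> LOb D" and s: "s \<in> carrier (?T x x' y y')"
      using 3 by (simp_all add: box_simps)
    have "?c (x, x') (y, y') (y, y') (pure_tensor K (LHom C y y) (LHom D y' y') (LIde C y) (LIde D y')) s = s"
    proof (rule linear_map_tensor_eqI[OF _ _ _ bilinear_mapD(1)[OF bl] linear_map_id _ s])
    qed (simp_all add: o cd box_module pure_tensor_closed box_comp_pure_tensor)
    then show ?case by (simp add: box_simps)
  next
    case (4 d e s)
    obtain x x' y y' where [simp]: "d = (x, x')" "e = (y, y')" by (cases d; cases e) blast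
    have o: "x \<in> LOb C" "y \<in> LOb C" "x' \<in> LOb D" "y' \<in> LOb D" and s: "s \<in> carrier (?T x x' y y')"
      using 4 by (simp_all add: box_simps)
    have "?c (x, x') (x, x') (y, y') s (pure_tensor K (LHom C x x) (LHom D x' x') (LIde C x) (LIde D x')) = s"
    proof (rule linear_map_tensor_eqI[OF _ _ _ bilinear_mapD(2)[OF bl] linear_map_id _ s])
    qed (simp_all add: o cd box_module pure_tensor_closed box_comp_pure_tensor)
    then show ?case by (simp add: box_simps)
  next
    case (5 d1 d2 d3 d4 r s t)
    obtain w w' x x' y y' z z' where [simp]: "d1 = (w, w')" "d2 = (x, x')" "d3 = (y, y')" "d4 = (z, z')"
      by (cases d1; cases d2; cases d3; cases d4) blast
    have o: "w \<in> LOb C" "x \<in> LOb C" "y \<in> LOb C" "z \<in> LOb C" "w' \<in> LOb D" "x' \<in> LOb D" "y' \<in> LOb D" "z' \<in> LOb D"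
      and r: "r \<in> carrier (?T w w' x x')" and s: "s \<in> carrier (?T x x' y y')" and t: "t \<in> carrier (?T y y' z z')"
      using 5 by (simp_all add: box_simps)
    let ?l = "\<lambda>t s r. ?c (w, w') (y, y') (z, z') t (?c (w, w') (x, x') (y, y') s r)"
    let ?r = "\<lambda>t s r. ?c (w, w') (x, x') (z, z') (?c (x, x') (y, y') (z, z') t s) r"
    note prems = o cd box_module pure_tensor_closed cl
    have "?l t s r = ?r t s r"
    proof (rule linear_map_tensor_eqI[OF _ _ _ _ _ _ t])
      show "linear_map K (?T y y' z z') (?T w w' z z') (\<lambda>t. ?l t s r)"
        by (rule bilinear_mapD(2)[OF bl]) (simp_all add: prems r s)
      show "linear_map K (?T y y' z z') (?T w w' z z') (\<lambda>t. ?r t s r)"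
        by (rule linear_map_comp[OF bilinear_mapD(2)[OF bl] bilinear_mapD(2)[OF bl]]) (simp_all add: prems r s)
      fix h h' assume h: "h \<in> carrier (LHom C y z)" "h' \<in> carrier (LHom D y' z')"
      let ?h = "pure_tensor K (LHom C y z) (LHom D y' z') h h'"
      show "?l ?h s r = ?r ?h s r"
      proof (rule linear_map_tensor_eqI[OF _ _ _ _ _ _ s])
        show "linear_map K (?T x x' y y') (?T w w' z z') (\<lambda>s. ?l ?h s r)"
          by (rule linear_map_comp[OF bilinear_mapD(2)[OF bl] bilinear_mapD(1)[OF bl]]) (simp_all add: prems r h)
        show "linear_map K (?T x x' y y') (?T w w' z z') (\<lambda>s. ?r ?h s r)"
          by (rule linear_map_comp[OF bilinear_mapD(1)[OF bl] bilinear_mapD(2)[OF bl]]) (simp_all add: prems r h)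
        fix g g' assume g: "g \<in> carrier (LHom C x y)" "g' \<in> carrier (LHom D x' y')"
        let ?g = "pure_tensor K (LHom C x y) (LHom D x' y') g g'"
        show "?l ?h ?g r = ?r ?h ?g r"
        proof (rule linear_map_tensor_eqI[OF _ _ _ _ _ _ r])
          show "linear_map K (?T w w' x x') (?T w w' z z') (\<lambda>r. ?l ?h ?g r)"
            by (rule linear_map_comp[OF bilinear_mapD(1)[OF bl] bilinear_mapD(1)[OF bl]]) (simp_all add: prems g h)
          show "linear_map K (?T w w' x x') (?T w w' z z') (\<lambda>r. ?r ?h ?g r)"
            by (rule bilinear_mapD(1)[OF bl]) (simp_all add: prems g h)
        qed (simp_all add: prems g h box_comp_pure_tensor)
      qed (simp_all add: prems)
    qed (simp_all add: prems)
    then show ?case by simp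
  qed
  moreover have "linear_map K (LHom (box K C D) d e) (LHom (box K C D) d f) (LComp (box K C D) d e f t)"
    if "d \<in> LOb (box K C D)" "e \<in> LOb (box K C D)" "f \<in> LOb (box K C D)" "t \<in> carrier (LHom (box K C D) e f)" for d e f t
    using that bilinear_mapD(1)[OF box_comp_bilinear] by (cases d; cases e; cases f) (simp add: box_simps(1))
  moreover have "linear_map K (LHom (box K C D) e f) (LHom (box K C D) d f) (\<lambda>t. LComp (box K C D) d e f t s)"
    if "d \<in> LOb (box K C D)" "e \<in> LOb (box K C D)" "f \<in> LOb (box K C D)" "s \<in> carrier (LHom (box K C D) d e)" for d e f s
    using that bilinear_mapD(2)[OF box_comp_bilinear] by (cases d; cases e; cases f) (simp add: box_simps(1))
  ultimately show ?thesis
    unfolding linear_category_def by (auto simp: box_simps box_module)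
qed

end

lemma linear_category_enveloping:
  "linear_category K C \<Longrightarrow> linear_category K (enveloping_category K C)"
  unfolding enveloping_category_def by (intro linear_category_box linear_category_opposite)

lemma enveloping_category_simps:
  "LOb (enveloping_category K C) = LOb C \<times> LOb C"
  "LHom (enveloping_category K C) (x, y) (x', y') = tensor_product K (LHom C x x') (LHom C y' y)"
  "LIde (enveloping_category K C) (x, y) = pure_tensor K (LHom C x x) (LHom C y y) (LIde C x) (LIde C y)"
  by (simp_all add: enveloping_category_def box_simps opposite_def)

lemma regular_bimodule_Val: "Val (regular_bimodule K C) (x, y) = LHom C y x"
  by (simp add: regular_bimodule_def)

lemma enveloping_category_comp_pure_tensor:
  assumes C: "linear_category K C"
    and o: "x \<in> LOb C" "y \<in> LOb C" "z \<in> LOb C" "x' \<in> LOb C" "y' \<in> LOb C" "z' \<in> LOb C"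
    and "f \<in> carrier (LHom C x y)" "f' \<in> carrier (LHom C y' x')"
      "g \<in> carrier (LHom C y z)" "g' \<in> carrier (LHom C z' y')"
  shows "LComp (enveloping_category K C) (x, x') (y, y') (z, z')
      (pure_tensor K (LHom C y z) (LHom C z' y') g g') (pure_tensor K (LHom C x y) (LHom C y' x') f f')
    = pure_tensor K (LHom C x z) (LHom C z' x') (LComp C x y z g f) (LComp C z' y' x' f' g')"
  using box_comp_pure_tensor[OF C linear_category_opposite[OF C], of x y z x' y' z' f f' g g'] assms(2-)
  by (simp add: opposite_def enveloping_category_def)

section \<open>The regular bimodule as a linear functor\<close>

context
  fixes K :: "('k, 'z) ring_scheme" and C :: "('o, 'm, 'k) linear_category"
  assumes C: "linear_category K C"
begin

context
  fixes x x' y y' :: 'o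
  assumes o: "x \<in> LOb C" "x' \<in> LOb C" "y \<in> LOb C" "y' \<in> LOb C"
begin

lemma regular_bimodule_bilinear:
  assumes h: "h \<in> carrier (LHom C y x)"
  shows "bilinear_map K (LHom C x x') (LHom C y' y) (LHom C y' x')
    (\<lambda>f g. LComp C y' x x' f (LComp C y' y x h g))"
proof -
  note lr = linear_category_linear_right[OF C] and ll = linear_category_linear_left[OF C]
  show ?thesis unfolding bilinear_map_def
    by (intro conjI ballI, rule linear_map_comp[OF lr lr], simp_all add: o h ll linear_category_comp[OF C])
qed

lemma regular_bimodule_act_linear:
  assumes h: "h \<in> carrier (LHom C y x)"
  shows "linear_map K (tensor_product K (LHom C x x') (LHom C y' y)) (LHom C y' x')
    (\<lambda>t. Act (regular_bimodule K C) (x, y) (x', y') t h)"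
  unfolding regular_bimodule_def module_functor.simps prod.case
  by (intro linear_map_tensor_lift linear_categoryD[OF C] o regular_bimodule_bilinear[OF h])

lemma regular_bimodule_act_pure_tensor:
  assumes h: "h \<in> carrier (LHom C y x)" and "f \<in> carrier (LHom C x x')" "g \<in> carrier (LHom C y' y)"
  shows "Act (regular_bimodule K C) (x, y) (x', y') (pure_tensor K (LHom C x x') (LHom C y' y) f g) h
    = LComp C y' x x' f (LComp C y' y x h g)"
  unfolding regular_bimodule_def module_functor.simps prod.case
  by (intro tensor_lift_pure_tensor linear_categoryD[OF C] o assms regular_bimodule_bilinear[OF h])

lemma regular_bimodule_linear:
  assumes t: "t \<in> carrier (tensor_product K (LHom C x x') (LHom C y' y))"
  shows "linear_map K (LHom C y x) (LHom C y' x') (Act (regular_bimodule K C) (x, y) (x', y') t)"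
proof -
  have "linear_map K (LHom C y x) (LHom C y' x') (\<lambda>h. LComp C y' x x' f (LComp C y' y x h g))"
    if "f \<in> carrier (LHom C x x')" "g \<in> carrier (LHom C y' y)" for f g
    by (rule linear_map_comp[OF linear_category_linear_left[OF C] linear_category_linear_right[OF C]])
      (simp_all add: o that)
  then show ?thesis unfolding regular_bimodule_def module_functor.simps prod.case
    by (intro linear_map_tensor_lift_parameter[OF _ _ _ _ _ t] linear_categoryD[OF C] o)
qed

end

text \<open>On pure tensors, compatibility with composition reads
  \<open>(g f) h (f' g') = g (f h f') g'\<close>, which is associativity in \<open>C\<close>;
  linearity in both tensors gives the general case.\<close>

lemma linear_functor_regular_bimodule:
  "linear_functor K (enveloping_category K C) (regular_bimodule K C)"
proof -
  note cd = linear_categoryD[OF C] and E = linear_category_enveloping[OF C]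
  let ?a = "Act (regular_bimodule K C)"
  let ?T = "\<lambda>x y x' y'. tensor_product K (LHom C x x') (LHom C y' y)"
  have comp: "?a (x, x') (z, z') (LComp (enveloping_category K C) (x, x') (y, y') (z, z') t s) v
      = ?a (y, y') (z, z') t (?a (x, x') (y, y') s v)"
    if o: "x \<in> LOb C" "y \<in> LOb C" "z \<in> LOb C" "x' \<in> LOb C" "y' \<in> LOb C" "z' \<in> LOb C"
      and s: "s \<in> carrier (?T x x' y y')" and t: "t \<in> carrier (?T y y' z z')" and v: "v \<in> carrier (LHom C x' x)"
    for x x' y y' z z' s t v
  proof -
    note lr = linear_category_linear_right[OF E, of "(x, x')" "(y, y')" "(z, z')", unfolded enveloping_category_simps]
    note ll = linear_category_linear_left[OF E, of "(x, x')" "(y, y')" "(z, z')", unfolded enveloping_category_simps]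
    note prems = o cd pure_tensor_closed s t v module_tensor_product linear_map_closed[OF regular_bimodule_act_linear]
    show ?thesis
    proof (rule linear_map_tensor_eqI[OF _ _ _ _ _ _ t])
      show "linear_map K (?T y y' z z') (LHom C z' z)
          (\<lambda>t. ?a (x, x') (z, z') (LComp (enveloping_category K C) (x, x') (y, y') (z, z') t s) v)"
        by (rule linear_map_comp[OF ll regular_bimodule_act_linear]) (simp_all add: prems)
      show "linear_map K (?T y y' z z') (LHom C z' z) (\<lambda>t. ?a (y, y') (z, z') t (?a (x, x') (y, y') s v))"
        by (rule regular_bimodule_act_linear) (simp_all add: prems)
      fix g g' assume g: "g \<in> carrier (LHom C y z)" "g' \<in> carrier (LHom C z' y')"
      let ?g = "pure_tensor K (LHom C y z) (LHom C z' y') g g'"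
      show "?a (x, x') (z, z') (LComp (enveloping_category K C) (x, x') (y, y') (z, z') ?g s) v
        = ?a (y, y') (z, z') ?g (?a (x, x') (y, y') s v)"
      proof (rule linear_map_tensor_eqI[OF _ _ _ _ _ _ s])
        show "linear_map K (?T x x' y y') (LHom C z' z)
            (\<lambda>s. ?a (x, x') (z, z') (LComp (enveloping_category K C) (x, x') (y, y') (z, z') ?g s) v)"
          by (rule linear_map_comp[OF lr regular_bimodule_act_linear]) (simp_all add: prems g)
        show "linear_map K (?T x x' y y') (LHom C z' z) (\<lambda>s. ?a (y, y') (z, z') ?g (?a (x, x') (y, y') s v))"
          by (rule linear_map_comp[OF regular_bimodule_act_linear regular_bimodule_linear]) (simp_all add: prems g)
      qed (simp_all add: prems g enveloping_category_comp_pure_tensor[OF C] regular_bimodule_act_pure_tensor)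
    qed (simp_all add: prems)
  qed
  show ?thesis unfolding linear_functor_def enveloping_category_simps
    by (auto simp: regular_bimodule_Val enveloping_category_simps cd regular_bimodule_linear
        regular_bimodule_act_linear regular_bimodule_act_pure_tensor comp)
qed

end

section \<open>Small sets\<close>

lemma small_subset: "\<lbrakk>small U T; S \<subseteq> T\<rbrakk> \<Longrightarrow> small U S"
  unfolding small_def by (meson lepoll_trans subset_imp_lepoll)

lemma small_image: "small U S \<Longrightarrow> small U (f ` S)"
  unfolding small_def by (meson lepoll_trans image_lepoll)

context
  assumes inf: "infinite (UNIV :: 'u set)"
begin

text \<open>An infinite set is equipollent to its square; this is the first place where
  \<open>'u\<close> has to be infinite.\<close>

lemma small_Times:
  assumes "small TYPE('u) S" "small TYPE('u) T" shows "small TYPE('u) (S \<times> T)"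
proof -
  have "(UNIV :: 'u set) \<times> (UNIV :: 'u set) \<approx> (UNIV :: 'u set)"
    using card_of_Times_same_infinite[OF inf] by (simp add: eqpoll_iff_card_of_ordIso)
  moreover have "S \<times> T \<lesssim> (UNIV :: 'u set) \<times> (UNIV :: 'u set)"
    using assms unfolding small_def by (rule times_lepoll_mono)
  ultimately show ?thesis unfolding small_def by (meson lepoll_trans2)
qed

lemma small_Sigma:
  assumes S: "small TYPE('u) S" and T: "\<And>s. s \<in> S \<Longrightarrow> small TYPE('u) (T s)"
  shows "small TYPE('u) (Sigma S T)"
proof -
  have "Sigma S T \<lesssim> S \<times> (UNIV :: 'u set)"
    by (rule Sigma_lepoll_mono) (use T in \<open>auto simp: small_def\<close>)
  moreover have "small TYPE('u) (S \<times> (UNIV :: 'u set))"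
    by (intro small_Times S) (simp add: small_def)
  ultimately show ?thesis unfolding small_def by (meson lepoll_trans)
qed

lemma small_Fpow:
  assumes "small TYPE('u) S" shows "small TYPE('u) (Fpow S)"
proof -
  obtain f :: "'a \<Rightarrow> 'u" where f: "inj_on f S" using assms unfolding small_def lepoll_def by blast
  have "Fpow S \<lesssim> Fpow (UNIV :: 'u set)"
    unfolding lepoll_def using inj_on_image_Fpow[OF f] image_Fpow_mono[of f S UNIV] by blast
  then show ?thesis unfolding small_def using eqpoll_Fpow[OF inf] by (meson lepoll_trans2)
qed

text \<open>A function that deviates from \<open>k\<close> at finitely many points of
  \<open>A\<close> is determined by its graph over these points, a finite set of pairs. The default
  \<open>k\<close> is arbitrary because elements of a free functor rest at a zero that depends on
  the index, and are undefined outside the index set.\<close>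

lemma small_finitely_supported:
  assumes "small TYPE('u) A" "small TYPE('u) B"
  shows "small TYPE('u) {f. f ` A \<subseteq> B \<and> {x. f x \<noteq> k x} \<subseteq> A \<and> finite {x. f x \<noteq> k x}}"
  using small_Fpow[OF small_Times[OF assms]] lepoll_restricted_funspace[of A B k]
  unfolding small_def by (meson lepoll_trans)

lemma small_free_module:
  assumes "small TYPE('u) (carrier K)" "small TYPE('u) S"
  shows "small TYPE('u) (carrier (free_module K S))"
  by (rule small_subset[OF small_finitely_supported[OF assms(2,1), of "\<lambda>_. \<zero>\<^bsub>K\<^esub>"]])
    (auto simp: free_module_simps support_def)

lemma small_tensor_product:
  assumes "Module.module K V" "Module.module K W" "small TYPE('u) (carrier K)"
    "small TYPE('u) (carrier V)" "small TYPE('u) (carrier W)"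
  shows "small TYPE('u) (carrier (tensor_product K V W))"
  unfolding carrier_tensor_product[OF assms(1,2)]
  by (intro small_image small_free_module small_Times assms(3-))

lemma small_enveloping_category:
  assumes C: "linear_category K C" and "small TYPE('u) (carrier K)"
    and "\<And>x y. \<lbrakk>x \<in> LOb C; y \<in> LOb C\<rbrakk> \<Longrightarrow> small TYPE('u) (carrier (LHom C x y))"
    and "d \<in> LOb (enveloping_category K C)" "e \<in> LOb (enveloping_category K C)"
  shows "small TYPE('u) (carrier (LHom (enveloping_category K C) d e))"
  using assms(2-) linear_category_module[OF C]
  by (cases d; cases e) (auto simp: enveloping_category_simps intro!: small_tensor_product)

end

section \<open>Natural families of linear maps\<close>

text \<open>This is \<open>natural_transformations\<close> without extensionality, so that
  composites and differences are plain lambda terms. \<open>natural_family_restrict\<close> leads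
  back.\<close>

definition natural_family ::
    "('k, 'z) ring_scheme \<Rightarrow> ('d, 'm, 'k) linear_category \<Rightarrow> ('d, 'm, 'k, 'u) module_functor
      \<Rightarrow> ('d, 'm, 'k, 'v) module_functor \<Rightarrow> ('d \<Rightarrow> 'u \<Rightarrow> 'v) \<Rightarrow> bool" where
  "natural_family K D M N \<eta> \<longleftrightarrow>
     (\<forall>d \<in> LOb D. linear_map K (Val M d) (Val N d) (\<eta> d)) \<and>
     (\<forall>d \<in> LOb D. \<forall>e \<in> LOb D. \<forall>f \<in> carrier (LHom D d e). \<forall>v \<in> carrier (Val M d).
        \<eta> e (Act M d e f v) = Act N d e f (\<eta> d v))"

lemma linear_functorD:
  assumes "linear_functor K D M"
  shows linear_functor_module: "d \<in> LOb D \<Longrightarrow> Module.module K (Val M d)"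
    and linear_functor_linear: "\<lbrakk>d \<in> LOb D; e \<in> LOb D; f \<in> carrier (LHom D d e)\<rbrakk>
      \<Longrightarrow> linear_map K (Val M d) (Val M e) (Act M d e f)"
    and linear_functor_ide: "\<lbrakk>d \<in> LOb D; v \<in> carrier (Val M d)\<rbrakk> \<Longrightarrow> Act M d d (LIde D d) v = v"
    and linear_functor_comp: "\<lbrakk>c \<in> LOb D; d \<in> LOb D; e \<in> LOb D; f \<in> carrier (LHom D c d);
        g \<in> carrier (LHom D d e); v \<in> carrier (Val M c)\<rbrakk>
      \<Longrightarrow> Act M c e (LComp D c d e g f) v = Act M d e g (Act M c d f v)"
    and linear_functor_linear_left: "\<lbrakk>d \<in> LOb D; e \<in> LOb D; v \<in> carrier (Val M d)\<rbrakk>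
      \<Longrightarrow> linear_map K (LHom D d e) (Val M e) (\<lambda>f. Act M d e f v)"
    and linear_functor_closed: "\<lbrakk>d \<in> LOb D; e \<in> LOb D; f \<in> carrier (LHom D d e);
        v \<in> carrier (Val M d)\<rbrakk> \<Longrightarrow> Act M d e f v \<in> carrier (Val M e)"
proof -
  show lin: "linear_map K (Val M d) (Val M e) (Act M d e f)"
    if "d \<in> LOb D" "e \<in> LOb D" "f \<in> carrier (LHom D d e)" for d e f
    using assms that unfolding linear_functor_def by simp
  show "Act M d e f v \<in> carrier (Val M e)"
    if "d \<in> LOb D" "e \<in> LOb D" "f \<in> carrier (LHom D d e)" "v \<in> carrier (Val M d)" for d e f v
    using linear_map_closed[OF lin] that by blast
qed (use assms in \<open>simp_all add: linear_functor_def\<close>)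

lemma natural_familyD:
  assumes "natural_family K D M N \<eta>"
  shows natural_family_linear: "d \<in> LOb D \<Longrightarrow> linear_map K (Val M d) (Val N d) (\<eta> d)"
    and natural_family_natural: "\<lbrakk>d \<in> LOb D; e \<in> LOb D; f \<in> carrier (LHom D d e); v \<in> carrier (Val M d)\<rbrakk>
      \<Longrightarrow> \<eta> e (Act M d e f v) = Act N d e f (\<eta> d v)"
    and natural_family_closed: "\<lbrakk>d \<in> LOb D; v \<in> carrier (Val M d)\<rbrakk> \<Longrightarrow> \<eta> d v \<in> carrier (Val N d)"
proof -
  show lin: "linear_map K (Val M d) (Val N d) (\<eta> d)" if "d \<in> LOb D" for d
    using assms that unfolding natural_family_def by simp
  show "\<eta> d v \<in> carrier (Val N d)" if "d \<in> LOb D" "v \<in> carrier (Val M d)" for d v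
    using linear_map_closed[OF lin] that by blast
qed (use assms in \<open>simp add: natural_family_def\<close>)

lemma natural_family_comp:
  assumes "natural_family K D L M \<eta>" "natural_family K D M N \<theta>"
  shows "natural_family K D L N (\<lambda>d v. \<theta> d (\<eta> d v))"
  unfolding natural_family_def
  by (auto intro: linear_map_comp natural_family_linear[OF assms(1)] natural_family_linear[OF assms(2)]
      simp: natural_family_natural[OF assms(1)] natural_family_natural[OF assms(2)] natural_family_closed[OF assms(1)])

lemma natural_family_id: "natural_family K D M M (\<lambda>d v. v)"
  by (simp add: natural_family_def linear_map_id)

text \<open>Differences are the operation that the splitting arguments need: projections appear
  there as the identity minus a map.\<close>

lemma natural_family_difference:
  assumes M: "linear_functor K D M" and N: "linear_functor K D N"
    and \<eta>: "natural_family K D M N \<eta>" and \<theta>: "natural_family K D M N \<theta>"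
  shows "natural_family K D M N (\<lambda>d v. \<eta> d v \<ominus>\<^bsub>Val N d\<^esub> \<theta> d v)"
  unfolding natural_family_def
  by (auto intro!: linear_map_difference linear_functor_module[OF M] linear_functor_module[OF N]
      natural_family_linear[OF \<eta>] natural_family_linear[OF \<theta>]
      simp: natural_family_natural[OF \<eta>] natural_family_natural[OF \<theta>]
      linear_map_minus[OF linear_functor_module[OF N] linear_functor_module[OF N] linear_functor_linear[OF N]]
      natural_family_closed[OF \<eta>] natural_family_closed[OF \<theta>])

lemma natural_transformationsD: "\<eta> \<in> natural_transformations K D M N \<Longrightarrow> natural_family K D M N \<eta>"
  unfolding natural_transformations_def natural_family_def by blast

lemma natural_family_restrict:
  assumes M: "linear_functor K D M" and \<eta>: "natural_family K D M N \<eta>"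
  shows "(\<lambda>d \<in> LOb D. \<lambda>v \<in> carrier (Val M d). \<eta> d v) \<in> natural_transformations K D M N"
proof -
  have "linear_map K (Val M d) (Val N d) (\<lambda>v \<in> carrier (Val M d). \<eta> d v)" if "d \<in> LOb D" for d
    using natural_family_linear[OF \<eta> that]
      linear_map_cong[OF linear_functor_module[OF M that], where g = "\<eta> d" and h = "\<lambda>v \<in> carrier (Val M d). \<eta> d v"]
    by simp
  then show ?thesis
    by (simp add: natural_transformations_def natural_family_natural[OF \<eta>] linear_functor_closed[OF M])
qed

text \<open>The restrictions in \<open>natural_comp\<close> and the extensionality of
  \<open>\<phi>\<close> settle the equation outside the objects and carriers.\<close>

lemma natural_comp_eq_iff:
  assumes "\<phi> \<in> natural_transformations K D L N"
  shows "natural_comp D L \<theta> \<eta> = \<phi> \<longleftrightarrow> (\<forall>d \<in> LOb D. \<forall>v \<in> carrier (Val L d). \<theta> d (\<eta> d v) = \<phi> d v)"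
  using assms by (fastforce simp: natural_comp_def natural_transformations_def extensional_def fun_eq_iff restrict_def)

section \<open>Kernels, factorization through epimorphisms and copies with values in
  \<open>'u\<close>\<close>

definition kernel_functor ::
    "('d, 'm, 'k, 'u) module_functor \<Rightarrow> ('d, 'm, 'k, 'v) module_functor \<Rightarrow> ('d \<Rightarrow> 'u \<Rightarrow> 'v)
      \<Rightarrow> ('d, 'm, 'k, 'u) module_functor" where
  "kernel_functor M N \<eta> =
     \<lparr>Val = (\<lambda>d. (Val M d)\<lparr>carrier := {v \<in> carrier (Val M d). \<eta> d v = \<zero>\<^bsub>Val N d\<^esub>}\<rparr>), Act = Act M\<rparr>"

lemma kernel_functor_simps [simp]:
  "carrier (Val (kernel_functor M N \<eta>) d) = {v \<in> carrier (Val M d). \<eta> d v = \<zero>\<^bsub>Val N d\<^esub>}"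
  "Act (kernel_functor M N \<eta>) = Act M"
  "\<zero>\<^bsub>Val (kernel_functor M N \<eta>) d\<^esub> = \<zero>\<^bsub>Val M d\<^esub>"
  by (simp_all add: kernel_functor_def)

lemma linear_map_into_kernel_functor:
  "linear_map K V (Val (kernel_functor M N \<eta>) d) h \<longleftrightarrow>
     linear_map K V (Val M d) h \<and> (\<forall>v \<in> carrier V. \<eta> d (h v) = \<zero>\<^bsub>Val N d\<^esub>)"
  by (auto simp: linear_map_def kernel_functor_def)

lemma linear_map_from_kernel_functor:
  "linear_map K (Val M d) V h \<Longrightarrow> linear_map K (Val (kernel_functor M N \<eta>) d) V h"
  by (auto simp: linear_map_def kernel_functor_def)

lemma linear_functor_kernel_functor:
  assumes M: "linear_functor K D M" and N: "linear_functor K D N" and \<eta>: "natural_family K D M N \<eta>"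
  shows "linear_functor K D (kernel_functor M N \<eta>)"
proof -
  have "Module.module K (Val (kernel_functor M N \<eta>) d)" if d: "d \<in> LOb D" for d
    unfolding kernel_functor_def module_functor.simps
    by (intro submodule.submodule_is_module submodule_kernel linear_functor_module[OF M d]
        linear_functor_module[OF N d] natural_family_linear[OF \<eta> d])
  moreover have "\<eta> e (Act M d e f v) = \<zero>\<^bsub>Val N e\<^esub>"
    if "d \<in> LOb D" "e \<in> LOb D" "f \<in> carrier (LHom D d e)" "v \<in> carrier (Val M d)" "\<eta> d v = \<zero>\<^bsub>Val N d\<^esub>" for d e f v
    using that linear_map_zero[OF _ _ linear_functor_linear[OF N]]
    by (simp add: natural_family_natural[OF \<eta>] linear_functor_module[OF N])
  ultimately show ?thesis
    using M unfolding linear_functor_def linear_map_into_kernel_functor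
    by (auto intro!: linear_map_from_kernel_functor)
qed

lemma natural_family_into_kernel_functor:
  "natural_family K D L (kernel_functor M N \<eta>) \<theta> \<longleftrightarrow>
     natural_family K D L M \<theta> \<and> (\<forall>d \<in> LOb D. \<forall>v \<in> carrier (Val L d). \<eta> d (\<theta> d v) = \<zero>\<^bsub>Val N d\<^esub>)"
  unfolding natural_family_def linear_map_into_kernel_functor by auto

text \<open>An epimorphism is the cokernel of its kernel. Define \<open>\<sigma>\<close> through
  chosen preimages: two preimages differ by an element of the kernel, which \<open>\<theta>\<close>
  kills, so any preimage may be used to compute the value. Linearity and naturality follow by
  picking preimages compatible with the operation at hand.\<close>

lemma natural_family_factor:
  assumes P: "linear_functor K D P" and X: "linear_functor K D X" and Y: "linear_functor K D Y"
    and \<epsilon>: "natural_family K D P X \<epsilon>" and epi: "epimorphism D P X \<epsilon>" and \<theta>: "natural_family K D P Y \<theta>"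
    and ker: "\<And>d p. \<lbrakk>d \<in> LOb D; p \<in> carrier (Val P d); \<epsilon> d p = \<zero>\<^bsub>Val X d\<^esub>\<rbrakk> \<Longrightarrow> \<theta> d p = \<zero>\<^bsub>Val Y d\<^esub>"
  obtains \<sigma> where "natural_family K D X Y \<sigma>"
    and "\<And>d p. \<lbrakk>d \<in> LOb D; p \<in> carrier (Val P d)\<rbrakk> \<Longrightarrow> \<sigma> d (\<epsilon> d p) = \<theta> d p"
proof
  let ?r = "\<lambda>d x. SOME p. p \<in> carrier (Val P d) \<and> \<epsilon> d p = x"
  let ?\<sigma> = "\<lambda>d x. \<theta> d (?r d x)"
  have onto: "\<exists>p. p \<in> carrier (Val P d) \<and> \<epsilon> d p = x" if "d \<in> LOb D" "x \<in> carrier (Val X d)" for d x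
    using epi that unfolding epimorphism_def by (metis imageE)
  note PX = linear_functor_module[OF P] linear_functor_module[OF X] and PY = linear_functor_module[OF P] linear_functor_module[OF Y]
  show eq: "?\<sigma> d (\<epsilon> d p) = \<theta> d p" if d: "d \<in> LOb D" and p: "p \<in> carrier (Val P d)" for d p
  proof -
    interpret P: Module.module K "Val P d" by (rule PX[OF d])
    interpret X: Module.module K "Val X d" by (rule PX[OF d])
    interpret Y: Module.module K "Val Y d" by (rule PY[OF d])
    have r: "?r d (\<epsilon> d p) \<in> carrier (Val P d)" "\<epsilon> d (?r d (\<epsilon> d p)) = \<epsilon> d p"
      using someI[of "\<lambda>q. q \<in> carrier (Val P d) \<and> \<epsilon> d q = \<epsilon> d p" p] p by auto
    have "\<epsilon> d (?r d (\<epsilon> d p) \<ominus>\<^bsub>Val P d\<^esub> p) = \<zero>\<^bsub>Val X d\<^esub>"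
      using r p natural_family_closed[OF \<epsilon> d]
      by (simp add: linear_map_minus[OF PX(1)[OF d] PX(2)[OF d] natural_family_linear[OF \<epsilon> d]] X.minus_eq_zero_iff)
    then have "\<theta> d (?r d (\<epsilon> d p) \<ominus>\<^bsub>Val P d\<^esub> p) = \<zero>\<^bsub>Val Y d\<^esub>" using ker d r p by blast
    then show ?thesis
      using r p natural_family_closed[OF \<theta> d]
      by (simp add: linear_map_minus[OF PY(1)[OF d] PY(2)[OF d] natural_family_linear[OF \<theta> d]] Y.minus_eq_zero_iff)
  qed
  show "natural_family K D X Y ?\<sigma>" unfolding natural_family_def
  proof (intro conjI ballI)
    fix d assume d: "d \<in> LOb D"
    interpret P: Module.module K "Val P d" by (rule PX[OF d])
    note l = natural_family_linear[OF \<epsilon> d] natural_family_linear[OF \<theta> d]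
    show "linear_map K (Val X d) (Val Y d) (?\<sigma> d)"
    proof (rule linear_mapI)
      fix x assume "x \<in> carrier (Val X d)"
      then obtain p where p: "p \<in> carrier (Val P d)" "\<epsilon> d p = x" using onto[OF d] by blast
      show "?\<sigma> d x \<in> carrier (Val Y d)"
        using eq[OF d p(1)] p linear_map_closed[OF l(2)] by simp
      fix y assume "y \<in> carrier (Val X d)"
      then obtain q where q: "q \<in> carrier (Val P d)" "\<epsilon> d q = y" using onto[OF d] by blast
      show "?\<sigma> d (x \<oplus>\<^bsub>Val X d\<^esub> y) = ?\<sigma> d x \<oplus>\<^bsub>Val Y d\<^esub> ?\<sigma> d y"
        using eq[OF d, of p] eq[OF d, of q] eq[OF d, of "p \<oplus>\<^bsub>Val P d\<^esub> q"] p q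
        by (simp add: linear_map_add[OF l(1)] linear_map_add[OF l(2)])
    next
      fix r x assume r: "r \<in> carrier K" and "x \<in> carrier (Val X d)"
      then obtain p where p: "p \<in> carrier (Val P d)" "\<epsilon> d p = x" using onto[OF d] by blast
      show "?\<sigma> d (r \<odot>\<^bsub>Val X d\<^esub> x) = r \<odot>\<^bsub>Val Y d\<^esub> ?\<sigma> d x"
        using eq[OF d, of p] eq[OF d, of "r \<odot>\<^bsub>Val P d\<^esub> p"] p r
        by (simp add: linear_map_smult[OF l(1)] linear_map_smult[OF l(2)])
    qed
    fix e f x assume e: "e \<in> LOb D" and f: "f \<in> carrier (LHom D d e)" and "x \<in> carrier (Val X d)"
    then obtain p where p: "p \<in> carrier (Val P d)" "\<epsilon> d p = x" using onto[OF d] by blast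
    then show "?\<sigma> e (Act X d e f x) = Act Y d e f (?\<sigma> d x)"
      using eq[OF d, of p] eq[OF e, of "Act P d e f p"] d e f
      by (simp add: natural_family_natural[OF \<epsilon>] natural_family_natural[OF \<theta>] linear_functor_closed[OF P])
  qed
qed

text \<open>Transport of structure along injections \<open>f d\<close> of the carriers, with
  \<open>g d\<close> as decoding. It brings functors with values in function or set types within
  reach of notions that quantify over \<open>'u\<close>-valued functors only.\<close>

lemma small_functor_copy:
  fixes M :: "('d, 'm, 'k, 'v) module_functor"
  assumes M: "linear_functor K D M" and small: "\<And>d. d \<in> LOb D \<Longrightarrow> small TYPE('u) (carrier (Val M d))"
  obtains M' :: "('d, 'm, 'k, 'u) module_functor" and \<alpha> \<beta> where "linear_functor K D M'"
    and "natural_family K D M M' \<alpha>" and "natural_family K D M' M \<beta>"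
    and "\<And>d v. \<lbrakk>d \<in> LOb D; v \<in> carrier (Val M d)\<rbrakk> \<Longrightarrow> \<beta> d (\<alpha> d v) = v"
    and "\<And>d v. \<lbrakk>d \<in> LOb D; v \<in> carrier (Val M' d)\<rbrakk> \<Longrightarrow> \<alpha> d (\<beta> d v) = v"
proof -
  have "\<exists>f :: 'v \<Rightarrow> 'u. inj_on f (carrier (Val M d))" if "d \<in> LOb D" for d
    using small[OF that] unfolding small_def lepoll_def by blast
  then obtain f :: "'d \<Rightarrow> 'v \<Rightarrow> 'u" where f: "inj_on (f d) (carrier (Val M d))" if "d \<in> LOb D" for d
    by metis
  define g where "g d = inv_into (carrier (Val M d)) (f d)" for d
  have gf: "g d (f d v) = v" if "d \<in> LOb D" "v \<in> carrier (Val M d)" for d v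
    using f that by (simp add: g_def)
  define M' :: "('d, 'm, 'k, 'u) module_functor" where "M' =
    \<lparr>Val = (\<lambda>d. \<lparr>carrier = f d ` carrier (Val M d), mult = undefined, one = undefined, ring.zero = f d \<zero>\<^bsub>Val M d\<^esub>,
        add = (\<lambda>a b. f d (g d a \<oplus>\<^bsub>Val M d\<^esub> g d b)), smult = (\<lambda>r a. f d (r \<odot>\<^bsub>Val M d\<^esub> g d a))\<rparr>),
      Act = (\<lambda>d e t a. f e (Act M d e t (g d a)))\<rparr>"
  have simps: "carrier (Val M' d) = f d ` carrier (Val M d)" "\<zero>\<^bsub>Val M' d\<^esub> = f d \<zero>\<^bsub>Val M d\<^esub>"
    "a \<oplus>\<^bsub>Val M' d\<^esub> b = f d (g d a \<oplus>\<^bsub>Val M d\<^esub> g d b)" "r \<odot>\<^bsub>Val M' d\<^esub> a = f d (r \<odot>\<^bsub>Val M d\<^esub> g d a)"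
    "Act M' d e t a = f e (Act M d e t (g d a))" for d e t r a b
    by (simp_all add: M'_def)
  have mod: "Module.module K (Val M' d)" if "d \<in> LOb D" for d
    by (rule module_image[OF linear_functor_module[OF M that], where p = "f d"]) (simp_all add: simps gf that)
  have fl: "linear_map K (Val M d) (Val M' d) (f d)" and gl: "linear_map K (Val M' d) (Val M d) (g d)"
    if d: "d \<in> LOb D" for d
  proof -
    interpret Module.module K "Val M d" by (rule linear_functor_module[OF M d])
    show "linear_map K (Val M d) (Val M' d) (f d)" "linear_map K (Val M' d) (Val M d) (g d)"
      by (auto intro!: linear_mapI simp: simps gf d)
  qed
  show ?thesis
  proof
    have "linear_map K (LHom D d e) (Val M' e) (\<lambda>t. Act M' d e t v)"
      if "d \<in> LOb D" "e \<in> LOb D" "v \<in> carrier (Val M' d)" for d e v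
      unfolding simps(5)
      using linear_map_comp[OF linear_functor_linear_left[OF M that(1,2) linear_map_closed[OF gl[OF that(1)] that(3)]] fl[OF that(2)]] .
    moreover have "linear_map K (Val M' d) (Val M' e) (Act M' d e t)"
      if "d \<in> LOb D" "e \<in> LOb D" "t \<in> carrier (LHom D d e)" for d e t
      unfolding simps(5)
      using linear_map_comp[OF linear_map_comp[OF gl[OF that(1)] linear_functor_linear[OF M that]] fl[OF that(2)]] .
    moreover have "Act M' d d (LIde D d) v = v" if "d \<in> LOb D" "v \<in> carrier (Val M' d)" for d v
      using that by (auto simp: simps gf linear_functor_ide[OF M])
    moreover have "Act M' c e (LComp D c d e t s) v = Act M' d e t (Act M' c d s v)"
      if "c \<in> LOb D" "d \<in> LOb D" "e \<in> LOb D" "s \<in> carrier (LHom D c d)" "t \<in> carrier (LHom D d e)"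
        "v \<in> carrier (Val M' c)" for c d e s t v
      using that by (auto simp: simps gf linear_functorD[OF M])
    ultimately show "linear_functor K D M'" unfolding linear_functor_def by (simp add: mod)
    show "natural_family K D M M' f" "natural_family K D M' M g" unfolding natural_family_def
      by (auto simp: fl gl simps gf linear_functorD[OF M])
  qed (auto simp: gf simps)
qed

text \<open>By definition \<open>projective\<close> lifts only through epimorphisms between
  \<open>'u\<close>-valued functors. Copying \<open>M\<close> and \<open>N\<close> into
  \<open>'u\<close>, lifting there and decoding extends this to small functors with values in any
  types.\<close>

lemma projectiveD:
  fixes P :: "('d, 'm, 'k, 'u) module_functor"
    and M :: "('d, 'm, 'k, 'v) module_functor" and N :: "('d, 'm, 'k, 'w) module_functor"
  assumes P: "projective K D P" and M: "linear_functor K D M" and N: "linear_functor K D N"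
    and sM: "\<And>d. d \<in> LOb D \<Longrightarrow> small TYPE('u) (carrier (Val M d))"
    and sN: "\<And>d. d \<in> LOb D \<Longrightarrow> small TYPE('u) (carrier (Val N d))"
    and \<epsilon>: "natural_family K D M N \<epsilon>" and epi: "epimorphism D M N \<epsilon>" and \<phi>: "natural_family K D P N \<phi>"
  obtains \<psi> where "natural_family K D P M \<psi>"
    and "\<And>d p. \<lbrakk>d \<in> LOb D; p \<in> carrier (Val P d)\<rbrakk> \<Longrightarrow> \<epsilon> d (\<psi> d p) = \<phi> d p"
proof -
  obtain M' :: "('d, 'm, 'k, 'u) module_functor" and \<alpha> \<beta> where M': "linear_functor K D M'"
    and \<alpha>: "natural_family K D M M' \<alpha>" and \<beta>: "natural_family K D M' M \<beta>"
    and inv: "\<And>d v. \<lbrakk>d \<in> LOb D; v \<in> carrier (Val M d)\<rbrakk> \<Longrightarrow> \<beta> d (\<alpha> d v) = v"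
    by (rule small_functor_copy[OF M sM]) blast+
  obtain N' :: "('d, 'm, 'k, 'u) module_functor" and \<gamma> \<delta> where N': "linear_functor K D N'"
    and \<gamma>: "natural_family K D N N' \<gamma>" and \<delta>: "natural_family K D N' N \<delta>"
    and inv': "\<And>d v. \<lbrakk>d \<in> LOb D; v \<in> carrier (Val N d)\<rbrakk> \<Longrightarrow> \<delta> d (\<gamma> d v) = v"
    and inv'': "\<And>d v. \<lbrakk>d \<in> LOb D; v \<in> carrier (Val N' d)\<rbrakk> \<Longrightarrow> \<gamma> d (\<delta> d v) = v"
    by (rule small_functor_copy[OF N sN]) blast+
  have lP: "linear_functor K D P" using P unfolding projective_def by blast
  let ?\<epsilon> = "\<lambda>d \<in> LOb D. \<lambda>v \<in> carrier (Val M' d). \<gamma> d (\<epsilon> d (\<beta> d v))"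
  let ?\<phi> = "\<lambda>d \<in> LOb D. \<lambda>v \<in> carrier (Val P d). \<gamma> d (\<phi> d v)"
  have \<epsilon>': "?\<epsilon> \<in> natural_transformations K D M' N'"
    by (intro natural_family_restrict[OF M'] natural_family_comp[OF natural_family_comp[OF \<beta> \<epsilon>] \<gamma>])
  have \<phi>': "?\<phi> \<in> natural_transformations K D P N'"
    by (intro natural_family_restrict[OF lP] natural_family_comp[OF \<phi> \<gamma>])
  have "epimorphism D M' N' ?\<epsilon>" unfolding epimorphism_def
  proof (intro ballI equalityI subsetI)
    fix d x assume d: "d \<in> LOb D" and x: "x \<in> carrier (Val N' d)"
    then obtain v where v: "v \<in> carrier (Val M d)" "\<delta> d x = \<epsilon> d v"
      using natural_family_closed[OF \<delta> d x] epi unfolding epimorphism_def by blast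
    then have "?\<epsilon> d (\<alpha> d v) = x" "\<alpha> d v \<in> carrier (Val M' d)"
      using inv''[OF d x] d natural_family_closed[OF \<alpha> d] by (simp_all add: inv)
    then show "x \<in> ?\<epsilon> d ` carrier (Val M' d)" by blast
  qed (use natural_family_closed[OF natural_transformationsD[OF \<epsilon>']] in auto)
  then obtain \<psi> where \<psi>: "\<psi> \<in> natural_transformations K D P M'" "natural_comp D P ?\<epsilon> \<psi> = ?\<phi>"
    using P M' N' \<epsilon>' \<phi>' unfolding projective_def by blast
  note \<psi>' = natural_transformationsD[OF \<psi>(1)]
  show ?thesis
  proof
    show "natural_family K D P M (\<lambda>d p. \<beta> d (\<psi> d p))" by (rule natural_family_comp[OF \<psi>' \<beta>])
    fix d p assume d: "d \<in> LOb D" and p: "p \<in> carrier (Val P d)"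
    have "\<gamma> d (\<epsilon> d (\<beta> d (\<psi> d p))) = \<gamma> d (\<phi> d p)"
      using \<psi>(2)[unfolded natural_comp_eq_iff[OF \<phi>'], rule_format, OF d p]
        d p natural_family_closed[OF \<psi>' d p] by simp
    then have "\<delta> d (\<gamma> d (\<epsilon> d (\<beta> d (\<psi> d p)))) = \<delta> d (\<gamma> d (\<phi> d p))" by simp
    then show "\<epsilon> d (\<beta> d (\<psi> d p)) = \<phi> d p"
      using inv' d p natural_family_closed[OF \<psi>'] natural_family_closed[OF \<beta>]
        natural_family_closed[OF \<epsilon>] natural_family_closed[OF \<phi>] by simp
  qed
qed

section \<open>Free functors and projective resolutions\<close>

text \<open>The direct sum of the representable functors at the objects \<open>c i\<close> for \<open>i \<in> I\<close>.\<close>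

definition free_functor ::
    "('d, 'm, 'k) linear_category \<Rightarrow> 'i set \<Rightarrow> ('i \<Rightarrow> 'd) \<Rightarrow> ('d, 'm, 'k, 'i \<Rightarrow> 'm) module_functor" where
  "free_functor D I c =
     \<lparr>Val = (\<lambda>e. \<lparr>carrier = {h \<in> \<Pi>\<^sub>E i \<in> I. carrier (LHom D (c i) e). finite {i \<in> I. h i \<noteq> \<zero>\<^bsub>LHom D (c i) e\<^esub>}},
        mult = undefined, one = undefined, ring.zero = (\<lambda>i \<in> I. \<zero>\<^bsub>LHom D (c i) e\<^esub>),
        add = (\<lambda>h h'. \<lambda>i \<in> I. h i \<oplus>\<^bsub>LHom D (c i) e\<^esub> h' i),
        smult = (\<lambda>r h. \<lambda>i \<in> I. r \<odot>\<^bsub>LHom D (c i) e\<^esub> h i)\<rparr>),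
      Act = (\<lambda>d e t h. \<lambda>i \<in> I. LComp D (c i) d e t (h i))\<rparr>"

definition free_inclusion ::
    "('d, 'm, 'k) linear_category \<Rightarrow> 'i set \<Rightarrow> ('i \<Rightarrow> 'd) \<Rightarrow> 'd \<Rightarrow> 'i \<Rightarrow> 'm \<Rightarrow> 'i \<Rightarrow> 'm" where
  "free_inclusion D I c e i t = (\<lambda>j \<in> I. if j = i then t else \<zero>\<^bsub>LHom D (c j) e\<^esub>)"

text \<open>The map out of a sum of representable functors that Yoneda assigns to the elements
  \<open>m i\<close>. The sum runs over the support because \<open>finsum\<close> is meaningful over
  finite sets only.\<close>

definition free_lift ::
    "('d, 'm, 'k) linear_category \<Rightarrow> 'i set \<Rightarrow> ('i \<Rightarrow> 'd) \<Rightarrow> ('d, 'm, 'k, 'u) module_functor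
      \<Rightarrow> ('i \<Rightarrow> 'u) \<Rightarrow> 'd \<Rightarrow> ('i \<Rightarrow> 'm) \<Rightarrow> 'u" where
  "free_lift D I c M m e h =
     (\<Oplus>\<^bsub>Val M e\<^esub> i \<in> {i \<in> I. h i \<noteq> \<zero>\<^bsub>LHom D (c i) e\<^esub>}. Act M (c i) e (h i) (m i))"

lemma free_functor_carrierI:
  assumes "\<And>i. i \<in> I \<Longrightarrow> h i \<in> carrier (LHom D (c i) e)" "h \<in> extensional I"
    and "finite T" "\<And>i. \<lbrakk>i \<in> I; i \<notin> T\<rbrakk> \<Longrightarrow> h i = \<zero>\<^bsub>LHom D (c i) e\<^esub>"
  shows "h \<in> carrier (Val (free_functor D I c) e)"
proof -
  have "{i \<in> I. h i \<noteq> \<zero>\<^bsub>LHom D (c i) e\<^esub>} \<subseteq> T" using assms(4) by blast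
  then show ?thesis using assms by (auto simp: free_functor_def PiE_iff intro: finite_subset)
qed

lemma free_functor_carrierD:
  assumes "h \<in> carrier (Val (free_functor D I c) e)"
  shows free_functor_component: "i \<in> I \<Longrightarrow> h i \<in> carrier (LHom D (c i) e)"
    and free_functor_finite: "finite {i \<in> I. h i \<noteq> \<zero>\<^bsub>LHom D (c i) e\<^esub>}"
    and free_functor_extensional: "h \<in> extensional I"
  using assms by (auto simp: free_functor_def PiE_iff)

lemma free_functor_simps:
  "\<zero>\<^bsub>Val (free_functor D I c) e\<^esub> = (\<lambda>i \<in> I. \<zero>\<^bsub>LHom D (c i) e\<^esub>)"
  "h \<oplus>\<^bsub>Val (free_functor D I c) e\<^esub> h' = (\<lambda>i \<in> I. h i \<oplus>\<^bsub>LHom D (c i) e\<^esub> h' i)"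
  "r \<odot>\<^bsub>Val (free_functor D I c) e\<^esub> h = (\<lambda>i \<in> I. r \<odot>\<^bsub>LHom D (c i) e\<^esub> h i)"
  "Act (free_functor D I c) d e t h = (\<lambda>i \<in> I. LComp D (c i) d e t (h i))"
  by (simp_all add: free_functor_def)

section \<open>Free functors as linear functors\<close>

context
  fixes K :: "('k, 'z) ring_scheme" and D :: "('d, 'm, 'k) linear_category"
    and I :: "'i set" and c :: "'i \<Rightarrow> 'd"
  assumes K: "cring K" and D: "linear_category K D" and c: "\<And>i. i \<in> I \<Longrightarrow> c i \<in> LOb D"
begin

private abbreviation (input) "free_fun \<equiv> free_functor D I c"
private abbreviation (input) "hom_from i e \<equiv> LHom D (c i) e"

lemma hom_module: "\<lbrakk>i \<in> I; e \<in> LOb D\<rbrakk> \<Longrightarrow> Module.module K (hom_from i e)"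
  by (intro linear_category_module[OF D] c)

lemma free_functor_add_closed:
  assumes "e \<in> LOb D" "h \<in> carrier (Val free_fun e)" "h' \<in> carrier (Val free_fun e)"
  shows "(\<lambda>i \<in> I. h i \<oplus>\<^bsub>hom_from i e\<^esub> h' i) \<in> carrier (Val free_fun e)"
proof (rule free_functor_carrierI)
  show "finite ({i \<in> I. h i \<noteq> \<zero>\<^bsub>hom_from i e\<^esub>} \<union> {i \<in> I. h' i \<noteq> \<zero>\<^bsub>hom_from i e\<^esub>})"
    using free_functor_finite[OF assms(2)] free_functor_finite[OF assms(3)] by simp
  fix i assume i: "i \<in> I"
  interpret Module.module K "hom_from i e" by (rule hom_module[OF i assms(1)])
  show "(\<lambda>i \<in> I. h i \<oplus>\<^bsub>hom_from i e\<^esub> h' i) i \<in> carrier (hom_from i e)"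
    using i free_functor_component[OF assms(2) i] free_functor_component[OF assms(3) i] by simp
  assume "i \<notin> {i \<in> I. h i \<noteq> \<zero>\<^bsub>hom_from i e\<^esub>} \<union> {i \<in> I. h' i \<noteq> \<zero>\<^bsub>hom_from i e\<^esub>}"
  then show "(\<lambda>i \<in> I. h i \<oplus>\<^bsub>hom_from i e\<^esub> h' i) i = \<zero>\<^bsub>hom_from i e\<^esub>" using i by simp
qed simp

lemma free_functor_map_closed:
  assumes "e \<in> LOb D" "e' \<in> LOb D" "h \<in> carrier (Val free_fun e)"
    and p: "\<And>i. i \<in> I \<Longrightarrow> linear_map K (hom_from i e) (hom_from i e') (p i)"
  shows "(\<lambda>i \<in> I. p i (h i)) \<in> carrier (Val free_fun e')"
proof (rule free_functor_carrierI)
  show "finite {i \<in> I. h i \<noteq> \<zero>\<^bsub>hom_from i e\<^esub>}" by (rule free_functor_finite[OF assms(3)])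
  fix i assume i: "i \<in> I"
  show "(\<lambda>i \<in> I. p i (h i)) i \<in> carrier (hom_from i e')"
    using i linear_map_closed[OF p[OF i]] free_functor_component[OF assms(3)] by simp
  assume "i \<notin> {i \<in> I. h i \<noteq> \<zero>\<^bsub>hom_from i e\<^esub>}"
  then show "(\<lambda>i \<in> I. p i (h i)) i = \<zero>\<^bsub>hom_from i e'\<^esub>"
    using i linear_map_zero[OF hom_module hom_module p] assms by simp
qed simp

lemma module_free_functor:
  assumes e: "e \<in> LOb D" shows "Module.module K (Val free_fun e)"
proof -
  interpret K: cring K by (rule K)
  note comp = free_functor_component
  \<comment> \<open>The component modules vary with the index and can be interpreted only at a fixed
    one. Their laws are therefore recorded for all indices first, ready for rewriting under
    \<open>restrict\<close>.\<close>
  have ac: "h i \<oplus>\<^bsub>hom_from i e\<^esub> h' i \<oplus>\<^bsub>hom_from i e\<^esub> h'' i = h i \<oplus>\<^bsub>hom_from i e\<^esub> (h' i \<oplus>\<^bsub>hom_from i e\<^esub> h'' i)"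
     "h i \<oplus>\<^bsub>hom_from i e\<^esub> h' i = h' i \<oplus>\<^bsub>hom_from i e\<^esub> h i"
    if "i \<in> I" "h \<in> carrier (Val free_fun e)" "h' \<in> carrier (Val free_fun e)" "h'' \<in> carrier (Val free_fun e)" for i h h' h''
  proof -
    interpret Module.module K "hom_from i e" by (rule hom_module[OF that(1) e])
    show "h i \<oplus>\<^bsub>hom_from i e\<^esub> h' i \<oplus>\<^bsub>hom_from i e\<^esub> h'' i = h i \<oplus>\<^bsub>hom_from i e\<^esub> (h' i \<oplus>\<^bsub>hom_from i e\<^esub> h'' i)"
      using comp[OF that(2,1)] comp[OF that(3,1)] comp[OF that(4,1)] by (rule M.a_assoc)
    show "h i \<oplus>\<^bsub>hom_from i e\<^esub> h' i = h' i \<oplus>\<^bsub>hom_from i e\<^esub> h i"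
      using comp[OF that(2,1)] comp[OF that(3,1)] by (rule M.a_comm)
  qed
  have sm: "(r \<oplus>\<^bsub>K\<^esub> s) \<odot>\<^bsub>hom_from i e\<^esub> h i = r \<odot>\<^bsub>hom_from i e\<^esub> h i \<oplus>\<^bsub>hom_from i e\<^esub> s \<odot>\<^bsub>hom_from i e\<^esub> h i"
     "r \<odot>\<^bsub>hom_from i e\<^esub> (h i \<oplus>\<^bsub>hom_from i e\<^esub> h' i) = r \<odot>\<^bsub>hom_from i e\<^esub> h i \<oplus>\<^bsub>hom_from i e\<^esub> r \<odot>\<^bsub>hom_from i e\<^esub> h' i"
     "(r \<otimes>\<^bsub>K\<^esub> s) \<odot>\<^bsub>hom_from i e\<^esub> h i = r \<odot>\<^bsub>hom_from i e\<^esub> (s \<odot>\<^bsub>hom_from i e\<^esub> h i)"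
     "\<one>\<^bsub>K\<^esub> \<odot>\<^bsub>hom_from i e\<^esub> h i = h i" "\<zero>\<^bsub>hom_from i e\<^esub> \<oplus>\<^bsub>hom_from i e\<^esub> h i = h i"
     "(\<ominus>\<^bsub>K\<^esub> \<one>\<^bsub>K\<^esub>) \<odot>\<^bsub>hom_from i e\<^esub> h i \<oplus>\<^bsub>hom_from i e\<^esub> h i = \<zero>\<^bsub>hom_from i e\<^esub>"
    if "i \<in> I" "h \<in> carrier (Val free_fun e)" "h' \<in> carrier (Val free_fun e)" "r \<in> carrier K" "s \<in> carrier K" for i h h' r s
  proof -
    interpret Module.module K "hom_from i e" by (rule hom_module[OF that(1) e])
    show "(r \<oplus>\<^bsub>K\<^esub> s) \<odot>\<^bsub>hom_from i e\<^esub> h i = r \<odot>\<^bsub>hom_from i e\<^esub> h i \<oplus>\<^bsub>hom_from i e\<^esub> s \<odot>\<^bsub>hom_from i e\<^esub> h i"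
     "r \<odot>\<^bsub>hom_from i e\<^esub> (h i \<oplus>\<^bsub>hom_from i e\<^esub> h' i) = r \<odot>\<^bsub>hom_from i e\<^esub> h i \<oplus>\<^bsub>hom_from i e\<^esub> r \<odot>\<^bsub>hom_from i e\<^esub> h' i"
     "(r \<otimes>\<^bsub>K\<^esub> s) \<odot>\<^bsub>hom_from i e\<^esub> h i = r \<odot>\<^bsub>hom_from i e\<^esub> (s \<odot>\<^bsub>hom_from i e\<^esub> h i)"
     "\<one>\<^bsub>K\<^esub> \<odot>\<^bsub>hom_from i e\<^esub> h i = h i" "\<zero>\<^bsub>hom_from i e\<^esub> \<oplus>\<^bsub>hom_from i e\<^esub> h i = h i"
     "(\<ominus>\<^bsub>K\<^esub> \<one>\<^bsub>K\<^esub>) \<odot>\<^bsub>hom_from i e\<^esub> h i \<oplus>\<^bsub>hom_from i e\<^esub> h i = \<zero>\<^bsub>hom_from i e\<^esub>"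
      using that(4,5) comp[OF that(2,1)] comp[OF that(3,1)]
      by (simp_all add: smult_l_distr smult_r_distr smult_assoc1 smult_l_minus M.l_neg)
  qed
  have smc: "(\<lambda>i \<in> I. r \<odot>\<^bsub>hom_from i e\<^esub> h i) \<in> carrier (Val free_fun e)"
    if "r \<in> carrier K" "h \<in> carrier (Val free_fun e)" for r h
    using free_functor_map_closed[OF e e that(2), of "\<lambda>i t. r \<odot>\<^bsub>hom_from i e\<^esub> t"]
      linear_map_smult_const[OF hom_module[OF _ e] that(1)] by simp
  have neg: "\<exists>y\<in>carrier (Val free_fun e). y \<oplus>\<^bsub>Val free_fun e\<^esub> h = \<zero>\<^bsub>Val free_fun e\<^esub>"
    if h: "h \<in> carrier (Val free_fun e)" for h
    by (rule bexI[OF _ smc[of "\<ominus>\<^bsub>K\<^esub> \<one>\<^bsub>K\<^esub>", OF _ h]])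
      (auto simp: free_functor_simps sm[OF _ h h K.zero_closed K.zero_closed] intro!: restrict_ext)
  have zero: "(\<lambda>i \<in> I. \<zero>\<^bsub>hom_from i e\<^esub>) \<in> carrier (Val free_fun e)"
  proof (rule free_functor_carrierI[where T = "{}"])
    fix i assume i: "i \<in> I"
    interpret Module.module K "hom_from i e" by (rule hom_module[OF i e])
    show "(\<lambda>i \<in> I. \<zero>\<^bsub>hom_from i e\<^esub>) i \<in> carrier (hom_from i e)" using i by simp
  qed simp_all
  have ext: "(\<lambda>i \<in> I. h i) = h" if "h \<in> carrier (Val free_fun e)" for h
    using free_functor_extensional[OF that] by (simp add: extensional_restrict)
  show ?thesis
  proof (rule moduleI[OF K])
    show "abelian_group (Val free_fun e)"
    proof (rule abelian_groupI)
      fix h h' h'' assume h: "h \<in> carrier (Val free_fun e)" "h' \<in> carrier (Val free_fun e)" "h'' \<in> carrier (Val free_fun e)"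
      show "h \<oplus>\<^bsub>Val free_fun e\<^esub> h' \<oplus>\<^bsub>Val free_fun e\<^esub> h'' = h \<oplus>\<^bsub>Val free_fun e\<^esub> (h' \<oplus>\<^bsub>Val free_fun e\<^esub> h'')"
        using h by (auto simp: free_functor_simps ac(1) cong: restrict_cong)
    next
      fix h h' assume h: "h \<in> carrier (Val free_fun e)" "h' \<in> carrier (Val free_fun e)"
      show "h \<oplus>\<^bsub>Val free_fun e\<^esub> h' \<in> carrier (Val free_fun e)"
        using h by (simp add: free_functor_simps free_functor_add_closed[OF e])
      show "h \<oplus>\<^bsub>Val free_fun e\<^esub> h' = h' \<oplus>\<^bsub>Val free_fun e\<^esub> h"
        unfolding free_functor_simps by (rule restrict_ext) (rule ac(2)[OF _ h h(1)])
    next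
      fix h assume h: "h \<in> carrier (Val free_fun e)"
      show "\<zero>\<^bsub>Val free_fun e\<^esub> \<oplus>\<^bsub>Val free_fun e\<^esub> h = h"
        using h by (simp add: free_functor_simps ext sm(5)[OF _ h h K.zero_closed K.zero_closed] cong: restrict_cong)
    qed (simp_all add: free_functor_simps(1) zero neg[unfolded free_functor_simps(1)])
  next
    fix r s h assume "r \<in> carrier K" "s \<in> carrier K" "h \<in> carrier (Val free_fun e)"
    note a = this(3,3,1,2)
    show "(r \<oplus>\<^bsub>K\<^esub> s) \<odot>\<^bsub>Val free_fun e\<^esub> h = r \<odot>\<^bsub>Val free_fun e\<^esub> h \<oplus>\<^bsub>Val free_fun e\<^esub> s \<odot>\<^bsub>Val free_fun e\<^esub> h"
      "(r \<otimes>\<^bsub>K\<^esub> s) \<odot>\<^bsub>Val free_fun e\<^esub> h = r \<odot>\<^bsub>Val free_fun e\<^esub> (s \<odot>\<^bsub>Val free_fun e\<^esub> h)"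
      by (simp_all add: free_functor_simps sm[OF _ a] cong: restrict_cong)
  next
    fix r h h' assume "r \<in> carrier K" "h \<in> carrier (Val free_fun e)" "h' \<in> carrier (Val free_fun e)"
    note a = this(2,3,1,1)
    show "r \<odot>\<^bsub>Val free_fun e\<^esub> (h \<oplus>\<^bsub>Val free_fun e\<^esub> h') = r \<odot>\<^bsub>Val free_fun e\<^esub> h \<oplus>\<^bsub>Val free_fun e\<^esub> r \<odot>\<^bsub>Val free_fun e\<^esub> h'"
      by (simp add: free_functor_simps sm[OF _ a] cong: restrict_cong)
  next
    fix h assume h: "h \<in> carrier (Val free_fun e)"
    show "\<one>\<^bsub>K\<^esub> \<odot>\<^bsub>Val free_fun e\<^esub> h = h"
      by (simp add: free_functor_simps sm[OF _ h h K.zero_closed K.zero_closed] ext[OF h] cong: restrict_cong)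
  qed (simp add: free_functor_simps smc)
qed

lemma linear_functor_free_functor: "linear_functor K D free_fun"
  unfolding linear_functor_def
proof (intro conjI ballI)
  fix d e t assume a: "d \<in> LOb D" "e \<in> LOb D" "t \<in> carrier (LHom D d e)"
  note lin = linear_category_linear_right[OF D c a]
  show "linear_map K (Val free_fun d) (Val free_fun e) (Act free_fun d e t)"
  proof (rule linear_mapI)
    fix h assume h: "h \<in> carrier (Val free_fun d)"
    show "Act free_fun d e t h \<in> carrier (Val free_fun e)"
      unfolding free_functor_simps by (rule free_functor_map_closed[OF a(1,2) h lin])
  next
    fix h h' assume h: "h \<in> carrier (Val free_fun d)" "h' \<in> carrier (Val free_fun d)"
    show "Act free_fun d e t (h \<oplus>\<^bsub>Val free_fun d\<^esub> h') = Act free_fun d e t h \<oplus>\<^bsub>Val free_fun e\<^esub> Act free_fun d e t h'"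
      using h by (simp add: free_functor_simps linear_map_add[OF lin] free_functor_component cong: restrict_cong)
  next
    fix r h assume h: "r \<in> carrier K" "h \<in> carrier (Val free_fun d)"
    show "Act free_fun d e t (r \<odot>\<^bsub>Val free_fun d\<^esub> h) = r \<odot>\<^bsub>Val free_fun e\<^esub> Act free_fun d e t h"
      using h by (simp add: free_functor_simps linear_map_smult[OF lin] free_functor_component cong: restrict_cong)
  qed
next
  fix d h assume a: "d \<in> LOb D" and h: "h \<in> carrier (Val free_fun d)"
  show "Act free_fun d d (LIde D d) h = h"
    using free_functor_extensional[OF h] a
    by (simp add: free_functor_simps linear_category_ide_left[OF D c] free_functor_component[OF h]
        extensional_restrict cong: restrict_cong)
next
  fix d e e' s t h assume a: "d \<in> LOb D" "e \<in> LOb D" "e' \<in> LOb D" "s \<in> carrier (LHom D d e)"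
    "t \<in> carrier (LHom D e e')" "h \<in> carrier (Val free_fun d)"
  show "Act free_fun d e' (LComp D d e e' t s) h = Act free_fun e e' t (Act free_fun d e s h)"
    using a by (simp add: free_functor_simps linear_category_assoc[OF D c] free_functor_component cong: restrict_cong)
next
  fix d e h assume a: "d \<in> LOb D" "e \<in> LOb D" and h: "h \<in> carrier (Val free_fun d)"
  note lin = linear_category_linear_left[OF D c a free_functor_component[OF h]]
  show "linear_map K (LHom D d e) (Val free_fun e) (\<lambda>t. Act free_fun d e t h)"
  proof (rule linear_mapI)
    fix t assume t: "t \<in> carrier (LHom D d e)"
    show "Act free_fun d e t h \<in> carrier (Val free_fun e)"
      unfolding free_functor_simps
      by (rule free_functor_map_closed[OF a h linear_category_linear_right[OF D c a t]])
  qed (simp_all add: free_functor_simps linear_map_add[OF lin] linear_map_smult[OF lin] cong: restrict_cong)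
qed (rule module_free_functor)

lemma free_inclusion_closed:
  assumes "i \<in> I" "e \<in> LOb D" "t \<in> carrier (hom_from i e)"
  shows "free_inclusion D I c e i t \<in> carrier (Val free_fun e)"
proof (rule free_functor_carrierI[where T = "{i}"])
  fix j assume j: "j \<in> I"
  interpret Module.module K "hom_from j e" by (rule hom_module[OF j assms(2)])
  show "free_inclusion D I c e i t j \<in> carrier (hom_from j e)" using j assms by (simp add: free_inclusion_def)
qed (simp_all add: free_inclusion_def)

private abbreviation (input) "generator i \<equiv> free_inclusion D I c (c i) i (LIde D (c i))"

lemma generator_closed: "i \<in> I \<Longrightarrow> generator i \<in> carrier (Val free_fun (c i))"
  by (intro free_inclusion_closed c linear_category_ide[OF D])

text \<open>The action composes each component with \<open>t\<close>: the identity at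
  \<open>i\<close> becomes \<open>t\<close>, and the zeros elsewhere stay zero.\<close>

lemma act_generator:
  assumes "i \<in> I" "e \<in> LOb D" "t \<in> carrier (hom_from i e)"
  shows "Act free_fun (c i) e t (generator i) = free_inclusion D I c e i t"
  using linear_map_zero[OF hom_module hom_module linear_category_linear_right[OF D c c[OF assms(1)] assms(2,3)]] assms c
  by (auto simp: free_functor_simps free_inclusion_def linear_category_ide_right[OF D c] intro!: restrict_ext)

lemma free_functor_finsum:
  assumes e: "e \<in> LOb D" and "finite T" "T \<subseteq> I" and h: "\<And>i. i \<in> T \<Longrightarrow> h i \<in> carrier (hom_from i e)"
  shows "(\<Oplus>\<^bsub>Val free_fun e\<^esub> i \<in> T. free_inclusion D I c e i (h i))
    = (\<lambda>i \<in> I. if i \<in> T then h i else \<zero>\<^bsub>hom_from i e\<^esub>)"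
  using assms(2-)
proof (induction T)
  interpret F: Module.module K "Val free_fun e" by (rule module_free_functor[OF e])
  case empty then show ?case by (simp add: free_functor_simps)
next
  interpret F: Module.module K "Val free_fun e" by (rule module_free_functor[OF e])
  case (insert i T)
  have "(\<Oplus>\<^bsub>Val free_fun e\<^esub> j \<in> insert i T. free_inclusion D I c e j (h j)) =
    free_inclusion D I c e i (h i) \<oplus>\<^bsub>Val free_fun e\<^esub> (\<Oplus>\<^bsub>Val free_fun e\<^esub> j \<in> T. free_inclusion D I c e j (h j))"
    using insert by (intro F.M.finsum_insert) (auto intro!: free_inclusion_closed e)
  also have "(\<Oplus>\<^bsub>Val free_fun e\<^esub> j \<in> T. free_inclusion D I c e j (h j))
    = (\<lambda>j \<in> I. if j \<in> T then h j else \<zero>\<^bsub>hom_from j e\<^esub>)"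
    using insert by (intro insert.IH) auto
  also have "free_inclusion D I c e i (h i) \<oplus>\<^bsub>Val free_fun e\<^esub> (\<lambda>j \<in> I. if j \<in> T then h j else \<zero>\<^bsub>hom_from j e\<^esub>)
    = (\<lambda>j \<in> I. if j \<in> insert i T then h j else \<zero>\<^bsub>hom_from j e\<^esub>)"
  proof (unfold free_functor_simps, rule restrict_ext)
    fix j assume j: "j \<in> I"
    interpret Module.module K "hom_from j e" by (rule hom_module[OF j e])
    interpret V: Module.module K "hom_from i e" using insert.prems by (intro hom_module e) auto
    show "free_inclusion D I c e i (h i) j \<oplus>\<^bsub>hom_from j e\<^esub> (\<lambda>j \<in> I. if j \<in> T then h j else \<zero>\<^bsub>hom_from j e\<^esub>) j
      = (if j \<in> insert i T then h j else \<zero>\<^bsub>hom_from j e\<^esub>)"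
      using insert.hyps insert.prems j by (auto simp: free_inclusion_def)
  qed
  finally show ?case .
qed

lemma free_functor_expansion:
  assumes "e \<in> LOb D" and h: "h \<in> carrier (Val free_fun e)"
  shows "h = (\<Oplus>\<^bsub>Val free_fun e\<^esub> i \<in> {i \<in> I. h i \<noteq> \<zero>\<^bsub>hom_from i e\<^esub>}. free_inclusion D I c e i (h i))"
  using free_functor_extensional[OF h]
  by (subst free_functor_finsum[OF assms(1) free_functor_finite[OF h]])
    (auto simp: free_functor_component[OF h] extensional_def fun_eq_iff)

section \<open>Universal property of free functors\<close>

context
  fixes M :: "('d, 'm, 'k, 'u) module_functor" and m :: "'i \<Rightarrow> 'u"
  assumes M: "linear_functor K D M" and m: "\<And>i. i \<in> I \<Longrightarrow> m i \<in> carrier (Val M (c i))"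
begin

lemma free_lift_summand:
  assumes "e \<in> LOb D" "h \<in> carrier (Val free_fun e)" "i \<in> I"
  shows "Act M (c i) e (h i) (m i) \<in> carrier (Val M e)"
  using assms by (intro linear_functor_closed[OF M] c m free_functor_component)

text \<open>Indices with vanishing component contribute zero, so the index set may be enlarged. This
  puts two elements over the union of their supports, where their sums can be added.\<close>

lemma free_lift_superset:
  assumes e: "e \<in> LOb D" and h: "h \<in> carrier (Val free_fun e)" and T: "finite T" "T \<subseteq> I"
    and sub: "{i \<in> I. h i \<noteq> \<zero>\<^bsub>hom_from i e\<^esub>} \<subseteq> T"
  shows "free_lift D I c M m e h = (\<Oplus>\<^bsub>Val M e\<^esub> i \<in> T. Act M (c i) e (h i) (m i))"
proof -
  interpret Module.module K "Val M e" by (rule linear_functor_module[OF M e])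
  have "Act M (c i) e (h i) (m i) = \<zero>\<^bsub>Val M e\<^esub>" if "i \<in> T - {i \<in> I. h i \<noteq> \<zero>\<^bsub>hom_from i e\<^esub>}" for i
    using that T linear_map_zero[OF hom_module[OF _ e] linear_functor_module[OF M e] linear_functor_linear_left[OF M c e m]]
    by auto
  then show ?thesis unfolding free_lift_def
    using T sub free_lift_summand[OF e h] by (intro M.add.finprod_mono_neutral_cong_left) auto
qed

lemma natural_family_free_lift: "natural_family K D free_fun M (free_lift D I c M m)"
  unfolding natural_family_def
proof (intro conjI ballI)
  fix e assume e: "e \<in> LOb D"
  interpret Module.module K "Val M e" by (rule linear_functor_module[OF M e])
  interpret F: Module.module K "Val free_fun e" by (rule module_free_functor[OF e])
  note lin = linear_functor_linear_left[OF M c e m]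
  let ?s = "\<lambda>h. {i \<in> I. h i \<noteq> \<zero>\<^bsub>hom_from i e\<^esub>}" and ?L = "free_lift D I c M m e"
  show "linear_map K (Val free_fun e) (Val M e) ?L"
  proof (rule linear_mapI)
    fix h assume h: "h \<in> carrier (Val free_fun e)"
    show "?L h \<in> carrier (Val M e)"
      unfolding free_lift_def using free_lift_summand[OF e h] by (intro M.finsum_closed) auto
    fix h' assume h': "h' \<in> carrier (Val free_fun e)"
    let ?T = "?s h \<union> ?s h'"
    have T: "finite ?T" "?T \<subseteq> I" using free_functor_finite[OF h] free_functor_finite[OF h'] by auto
    have hh: "h \<oplus>\<^bsub>Val free_fun e\<^esub> h' \<in> carrier (Val free_fun e)" using h h' by simp
    \<comment> \<open>The component module can be interpreted only once an index is at hand, hence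
      the detour through a counterexample.\<close>
    have "?s (h \<oplus>\<^bsub>Val free_fun e\<^esub> h') \<subseteq> ?T"
    proof (rule ccontr)
      assume "\<not> ?s (h \<oplus>\<^bsub>Val free_fun e\<^esub> h') \<subseteq> ?T"
      then obtain i where i: "i \<in> I" "h i = \<zero>\<^bsub>hom_from i e\<^esub>" "h' i = \<zero>\<^bsub>hom_from i e\<^esub>" "h i \<oplus>\<^bsub>hom_from i e\<^esub> h' i \<noteq> \<zero>\<^bsub>hom_from i e\<^esub>"
        by (auto simp: free_functor_simps)
      interpret V: Module.module K "hom_from i e" by (rule hom_module[OF i(1) e])
      show False using i by simp
    qed
    then have "?L (h \<oplus>\<^bsub>Val free_fun e\<^esub> h') = (\<Oplus>\<^bsub>Val M e\<^esub> i \<in> ?T. Act M (c i) e ((h \<oplus>\<^bsub>Val free_fun e\<^esub> h') i) (m i))"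
      by (rule free_lift_superset[OF e hh T])
    also have "\<dots> = (\<Oplus>\<^bsub>Val M e\<^esub> i \<in> ?T. Act M (c i) e (h i) (m i) \<oplus>\<^bsub>Val M e\<^esub> Act M (c i) e (h' i) (m i))"
      using T free_lift_summand[OF e h] free_lift_summand[OF e h']
      by (intro M.finsum_cong')
        (auto simp: free_functor_simps linear_map_add[OF lin] free_functor_component[OF h] free_functor_component[OF h'])
    also have "\<dots> = (\<Oplus>\<^bsub>Val M e\<^esub> i \<in> ?T. Act M (c i) e (h i) (m i)) \<oplus>\<^bsub>Val M e\<^esub> (\<Oplus>\<^bsub>Val M e\<^esub> i \<in> ?T. Act M (c i) e (h' i) (m i))"
      using T free_lift_summand[OF e h] free_lift_summand[OF e h'] by (intro M.finsum_addf) auto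
    also have "\<dots> = ?L h \<oplus>\<^bsub>Val M e\<^esub> ?L h'"
      using free_lift_superset[OF e h T] free_lift_superset[OF e h' T] by simp
    finally show "?L (h \<oplus>\<^bsub>Val free_fun e\<^esub> h') = ?L h \<oplus>\<^bsub>Val M e\<^esub> ?L h'" .
  next
    fix r h assume r: "r \<in> carrier K" and h: "h \<in> carrier (Val free_fun e)"
    note fin = free_functor_finite[OF h]
    have rh: "r \<odot>\<^bsub>Val free_fun e\<^esub> h \<in> carrier (Val free_fun e)" using r h by simp
    have "?s (r \<odot>\<^bsub>Val free_fun e\<^esub> h) \<subseteq> ?s h"
      using linear_map_zero[OF hom_module[OF _ e] hom_module[OF _ e] linear_map_smult_const[OF hom_module[OF _ e] r]]
      by (auto simp: free_functor_simps)
    then have "?L (r \<odot>\<^bsub>Val free_fun e\<^esub> h) = (\<Oplus>\<^bsub>Val M e\<^esub> i \<in> ?s h. Act M (c i) e ((r \<odot>\<^bsub>Val free_fun e\<^esub> h) i) (m i))"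
      by (intro free_lift_superset[OF e rh fin]) auto
    also have "\<dots> = (\<Oplus>\<^bsub>Val M e\<^esub> i \<in> ?s h. r \<odot>\<^bsub>Val M e\<^esub> Act M (c i) e (h i) (m i))"
      using free_lift_summand[OF e h] r
      by (intro M.finsum_cong') (auto simp: free_functor_simps linear_map_smult[OF lin] free_functor_component[OF h])
    also have "\<dots> = r \<odot>\<^bsub>Val M e\<^esub> ?L h"
      unfolding free_lift_def using free_lift_summand[OF e h] r fin by (intro finsum_smult_ldistr[symmetric]) auto
    finally show "?L (r \<odot>\<^bsub>Val free_fun e\<^esub> h) = r \<odot>\<^bsub>Val M e\<^esub> ?L h" .
  qed
next
  fix d e t h assume de: "d \<in> LOb D" "e \<in> LOb D" and t: "t \<in> carrier (LHom D d e)" and h: "h \<in> carrier (Val free_fun d)"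
  interpret Module.module K "Val M e" by (rule linear_functor_module[OF M de(2)])
  let ?T = "{i \<in> I. h i \<noteq> \<zero>\<^bsub>hom_from i d\<^esub>}"
  have th: "Act free_fun d e t h \<in> carrier (Val free_fun e)"
    by (rule linear_functor_closed[OF linear_functor_free_functor de t h])
  have "free_lift D I c M m e (Act free_fun d e t h) = (\<Oplus>\<^bsub>Val M e\<^esub> i \<in> ?T. Act M (c i) e (Act free_fun d e t h i) (m i))"
    using linear_map_zero[OF hom_module[OF _ de(1)] hom_module[OF _ de(2)] linear_category_linear_right[OF D c de t]]
    by (intro free_lift_superset[OF de(2) th free_functor_finite[OF h]]) (auto simp: free_functor_simps)
  also have "\<dots> = (\<Oplus>\<^bsub>Val M e\<^esub> i \<in> ?T. Act M d e t (Act M (c i) d (h i) (m i)))"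
    using linear_functor_closed[OF M de t free_lift_summand[OF de(1) h]]
    by (intro M.finsum_cong')
      (auto simp: free_functor_simps linear_functor_comp[OF M c de free_functor_component[OF h] t m])
  also have "\<dots> = Act M d e t (free_lift D I c M m d h)"
    unfolding free_lift_def using free_lift_summand[OF de(1) h]
    by (intro linear_map_finsum[OF linear_functor_module[OF M de(1)] linear_functor_module[OF M de(2)]
          linear_functor_linear[OF M de t] free_functor_finite[OF h], symmetric]) auto
  finally show "free_lift D I c M m e (Act free_fun d e t h) = Act M d e t (free_lift D I c M m d h)" .
qed

lemma free_lift_generator:
  assumes i: "i \<in> I" shows "free_lift D I c M m (c i) (generator i) = m i"
proof -
  interpret Module.module K "Val M (c i)" by (rule linear_functor_module[OF M c[OF i]])
  have "free_lift D I c M m (c i) (generator i)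
    = (\<Oplus>\<^bsub>Val M (c i)\<^esub> j \<in> {i}. Act M (c j) (c i) (generator i j) (m j))"
    by (rule free_lift_superset[OF c[OF i] generator_closed[OF i]]) (use i in \<open>auto simp: free_inclusion_def\<close>)
  also have "\<dots> = m i" using i m[OF i] by (simp add: free_inclusion_def linear_functor_ide[OF M c[OF i]])
  finally show ?thesis .
qed

text \<open>Every element is a finite sum of inclusions, and each inclusion arises from a generator
  by acting on it. Linearity and naturality therefore fix all values once those on generators are
  known.\<close>

lemma free_lift_unique:
  assumes \<eta>: "natural_family K D free_fun M \<eta>" and gen: "\<And>i. i \<in> I \<Longrightarrow> \<eta> (c i) (generator i) = m i"
    and e: "e \<in> LOb D" and h: "h \<in> carrier (Val free_fun e)"
  shows "\<eta> e h = free_lift D I c M m e h"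
proof -
  interpret Module.module K "Val M e" by (rule linear_functor_module[OF M e])
  let ?T = "{i \<in> I. h i \<noteq> \<zero>\<^bsub>hom_from i e\<^esub>}"
  have inc: "\<eta> e (free_inclusion D I c e i (h i)) = Act M (c i) e (h i) (m i)" if i: "i \<in> I" for i
    using natural_family_natural[OF \<eta> c[OF i] e free_functor_component[OF h i] generator_closed[OF i]]
      act_generator[OF i e free_functor_component[OF h i]] gen[OF i] by simp
  have "\<eta> e h = \<eta> e (\<Oplus>\<^bsub>Val free_fun e\<^esub> i \<in> ?T. free_inclusion D I c e i (h i))"
    using free_functor_expansion[OF e h] by simp
  also have "\<dots> = (\<Oplus>\<^bsub>Val M e\<^esub> i \<in> ?T. \<eta> e (free_inclusion D I c e i (h i)))"
    by (rule linear_map_finsum[OF module_free_functor[OF e] linear_functor_module[OF M e]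
          natural_family_linear[OF \<eta> e] free_functor_finite[OF h]])
      (auto intro!: free_inclusion_closed e free_functor_component[OF h])
  also have "\<dots> = free_lift D I c M m e h"
    unfolding free_lift_def using free_lift_summand[OF e h] by (intro M.finsum_cong') (auto simp: inc)
  finally show ?thesis .
qed

end

text \<open>Choose preimages of the images of the generators and extend; the two maps to
  \<open>N\<close> agree on generators, hence everywhere. The value types of \<open>M\<close> and
  \<open>N\<close> are arbitrary here.\<close>

lemma free_functor_projective:
  assumes M: "linear_functor K D M" and N: "linear_functor K D N"
    and \<epsilon>: "natural_family K D M N \<epsilon>" and epi: "epimorphism D M N \<epsilon>" and \<phi>: "natural_family K D free_fun N \<phi>"
  obtains \<psi> where "natural_family K D free_fun M \<psi>"
    and "\<And>d h. \<lbrakk>d \<in> LOb D; h \<in> carrier (Val free_fun d)\<rbrakk> \<Longrightarrow> \<epsilon> d (\<psi> d h) = \<phi> d h"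
proof -
  have "\<exists>v. v \<in> carrier (Val M (c i)) \<and> \<epsilon> (c i) v = \<phi> (c i) (generator i)" if "i \<in> I" for i
    using natural_family_closed[OF \<phi> c[OF that] generator_closed[OF that]] epi c[OF that]
    unfolding epimorphism_def by (metis imageE)
  then obtain m where m: "m i \<in> carrier (Val M (c i))" "\<epsilon> (c i) (m i) = \<phi> (c i) (generator i)" if "i \<in> I" for i
    by metis
  note \<psi> = natural_family_free_lift[OF M m(1)]
  let ?n = "\<lambda>i. \<phi> (c i) (generator i)"
  have n: "?n i \<in> carrier (Val N (c i))" if "i \<in> I" for i
    using natural_family_closed[OF \<phi> c[OF that] generator_closed[OF that]] .
  show ?thesis
  proof
    fix d h assume dh: "d \<in> LOb D" "h \<in> carrier (Val free_fun d)"
    have "\<epsilon> d (free_lift D I c M m d h) = free_lift D I c N ?n d h"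
      by (rule free_lift_unique[OF N n natural_family_comp[OF \<psi> \<epsilon>] _ dh])
        (simp_all add: free_lift_generator[OF M m(1)] m(2))
    also have "\<dots> = \<phi> d h" by (rule free_lift_unique[OF N n \<phi> _ dh, symmetric]) simp_all
    finally show "\<epsilon> d (free_lift D I c M m d h) = \<phi> d h" .
  qed (rule \<psi>)
qed

lemma small_free_functor:
  assumes "infinite (UNIV :: 'u set)" and "small TYPE('u) I" and "e \<in> LOb D"
    and "\<And>i. i \<in> I \<Longrightarrow> small TYPE('u) (carrier (hom_from i e))"
  shows "small TYPE('u) (carrier (Val free_fun e))"
proof -
  \<comment> \<open>One set that contains the components of all elements; it is small as the image
    of a small disjoint sum.\<close>
  let ?B = "snd ` (SIGMA i:I. carrier (hom_from i e))"
  have "small TYPE('u) ?B" by (intro small_image small_Sigma assms)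
  \<comment> \<open>Elements are finite deviations from this default: zero at each index,
    \<open>undefined\<close> elsewhere.\<close>
  note fs = small_finitely_supported[OF assms(1,2) this, of "\<lambda>i \<in> I. \<zero>\<^bsub>hom_from i e\<^esub>"]
  show ?thesis
  proof (rule small_subset[OF fs], rule subsetI)
    fix h assume h: "h \<in> carrier (Val free_fun e)"
    have "{i. h i \<noteq> (\<lambda>i \<in> I. \<zero>\<^bsub>hom_from i e\<^esub>) i} = {i \<in> I. h i \<noteq> \<zero>\<^bsub>hom_from i e\<^esub>}"
      using free_functor_extensional[OF h] by (auto simp: extensional_def)
    then show "h \<in> {f. f ` I \<subseteq> ?B \<and> {x. f x \<noteq> (\<lambda>i \<in> I. \<zero>\<^bsub>hom_from i e\<^esub>) x} \<subseteq> I \<and>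
        finite {x. f x \<noteq> (\<lambda>i \<in> I. \<zero>\<^bsub>hom_from i e\<^esub>) x}}"
      using free_functor_finite[OF h] free_functor_component[OF h] by (force simp: image_iff)
  qed
qed

end

section \<open>Enough projectives and existence of resolutions\<close>

context
  fixes K :: "('k, 'z) ring_scheme" and D :: "('d, 'm, 'k) linear_category"
  assumes inf: "infinite (UNIV :: 'u set)" and K: "cring K" and D: "linear_category K D"
    and small_objects: "small TYPE('u) (LOb D)"
    and small_homs: "\<And>d e. \<lbrakk>d \<in> LOb D; e \<in> LOb D\<rbrakk> \<Longrightarrow> small TYPE('u) (carrier (LHom D d e))"
begin

text \<open>The generators are indexed by all elements of all values of \<open>X\<close>, and the
  one at \<open>(d, x)\<close> is sent to \<open>x\<close>, whence surjectivity. The free functor is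
  then copied into \<open>'u\<close>, where \<open>projective\<close> tests lifting.\<close>

lemma enough_projectives:
  fixes X :: "('d, 'm, 'k, 'v) module_functor"
  assumes X: "linear_functor K D X" and small: "\<And>d. d \<in> LOb D \<Longrightarrow> small TYPE('u) (carrier (Val X d))"
  obtains P :: "('d, 'm, 'k, 'u) module_functor" and \<epsilon>
  where "projective K D P" "\<epsilon> \<in> natural_transformations K D P X" "epimorphism D P X \<epsilon>"
proof -
  let ?I = "SIGMA d:LOb D. carrier (Val X d)"
  let ?F = "free_functor D ?I fst"
  let ?e = "free_lift D ?I fst X snd"
  have c: "\<And>i. i \<in> ?I \<Longrightarrow> fst i \<in> LOb D" and m: "\<And>i. i \<in> ?I \<Longrightarrow> snd i \<in> carrier (Val X (fst i))" by auto
  have smallF: "small TYPE('u) (carrier (Val ?F d))" if "d \<in> LOb D" for d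
    by (rule small_free_functor[OF K D c inf _ that])
      (use that in \<open>auto intro!: small_Sigma[OF inf] small_objects small small_homs\<close>)
  note F = linear_functor_free_functor[OF K D c] and e = natural_family_free_lift[OF K D c X m]
  obtain P :: "('d, 'm, 'k, 'u) module_functor" and \<alpha> \<beta> where P: "linear_functor K D P"
    and \<alpha>: "natural_family K D ?F P \<alpha>" and \<beta>: "natural_family K D P ?F \<beta>"
    and inv: "\<And>d v. \<lbrakk>d \<in> LOb D; v \<in> carrier (Val ?F d)\<rbrakk> \<Longrightarrow> \<beta> d (\<alpha> d v) = v"
    and inv': "\<And>d v. \<lbrakk>d \<in> LOb D; v \<in> carrier (Val P d)\<rbrakk> \<Longrightarrow> \<alpha> d (\<beta> d v) = v"
    by (rule small_functor_copy[OF F smallF]) blast+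
  have "projective K D P" unfolding projective_def
  proof (intro conjI allI impI ballI P)
    fix M N :: "('d, 'm, 'k, 'u) module_functor" and \<epsilon> \<phi>
    assume M: "linear_functor K D M" and N: "linear_functor K D N"
      and \<epsilon>: "\<epsilon> \<in> natural_transformations K D M N" and epi: "epimorphism D M N \<epsilon>"
      and \<phi>: "\<phi> \<in> natural_transformations K D P N"
    obtain \<psi> where \<psi>: "natural_family K D ?F M \<psi>"
      and eq: "\<And>d h. \<lbrakk>d \<in> LOb D; h \<in> carrier (Val ?F d)\<rbrakk> \<Longrightarrow> \<epsilon> d (\<psi> d h) = \<phi> d (\<alpha> d h)"
      by (rule free_functor_projective[OF K D c M N natural_transformationsD[OF \<epsilon>] epi
            natural_family_comp[OF \<alpha> natural_transformationsD[OF \<phi>]]]) blast+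
    let ?\<psi> = "\<lambda>d \<in> LOb D. \<lambda>v \<in> carrier (Val P d). \<psi> d (\<beta> d v)"
    have "?\<psi> \<in> natural_transformations K D P M"
      by (rule natural_family_restrict[OF P natural_family_comp[OF \<beta> \<psi>]])
    moreover have "natural_comp D P \<epsilon> ?\<psi> = \<phi>"
      by (simp add: natural_comp_eq_iff[OF \<phi>] eq natural_family_closed[OF \<beta>] inv')
    ultimately show "\<exists>\<psi>\<in>natural_transformations K D P M. natural_comp D P \<epsilon> \<psi> = \<phi>" by blast
  qed
  moreover let ?\<epsilon> = "\<lambda>d \<in> LOb D. \<lambda>v \<in> carrier (Val P d). ?e d (\<beta> d v)"
  have \<epsilon>: "?\<epsilon> \<in> natural_transformations K D P X"
    by (rule natural_family_restrict[OF P natural_family_comp[OF \<beta> e]])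
  moreover have "epimorphism D P X ?\<epsilon>" unfolding epimorphism_def
  proof (intro ballI equalityI subsetI)
    fix d x assume d: "d \<in> LOb D" and x: "x \<in> carrier (Val X d)"
    then have i: "(d, x) \<in> ?I" by simp
    let ?g = "free_inclusion D ?I fst d (d, x) (LIde D d)"
    have g: "?g \<in> carrier (Val ?F d)" "?e d ?g = x"
      using generator_closed[where I = ?I and c = fst, OF K D c i]
        free_lift_generator[where I = ?I and c = fst and m = snd, OF K D c X m i] by simp_all
    then have a: "?\<epsilon> d (\<alpha> d ?g) = x" "\<alpha> d ?g \<in> carrier (Val P d)"
      using d by (simp_all add: inv natural_family_closed[OF \<alpha>])
    show "x \<in> ?\<epsilon> d ` carrier (Val P d)" by (rule image_eqI[where x = "\<alpha> d ?g"]) (rule a(1)[symmetric], rule a(2))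
  qed (use natural_family_closed[OF natural_transformationsD[OF \<epsilon>]] in auto)
  ultimately show ?thesis using that by blast
qed

text \<open>Only \<open>X\<close> may have values outside \<open>'u\<close>: it is covered once, and
  from the kernel of that cover on every functor is \<open>'u\<close>-valued, so that the
  construction can be iterated within one type.\<close>

lemma projective_resolution_exists:
  fixes X :: "('d, 'm, 'k, 'v) module_functor"
  assumes X: "linear_functor K D X" and small: "\<And>d. d \<in> LOb D \<Longrightarrow> small TYPE('u) (carrier (Val X d))"
  obtains P :: "nat \<Rightarrow> ('d, 'm, 'k, 'u) module_functor" and \<delta> \<epsilon> where "projective_resolution K D X P \<delta> \<epsilon>"
proof -
  obtain P0 :: "('d, 'm, 'k, 'u) module_functor" and \<epsilon> where P0: "projective K D P0"
    and \<epsilon>: "\<epsilon> \<in> natural_transformations K D P0 X" "epimorphism D P0 X \<epsilon>"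
    using enough_projectives[OF X small] .
  \<comment> \<open>Values in \<open>'u\<close> are small for the trivial reason that they are
    subsets of \<open>'u\<close>; so covers can be chosen uniformly for all such functors.\<close>
  have "\<exists>Q :: ('d, 'm, 'k, 'u) module_functor. \<exists>q. projective K D Q \<and> q \<in> natural_transformations K D Q Z \<and> epimorphism D Q Z q"
    if "linear_functor K D Z" for Z :: "('d, 'm, 'k, 'u) module_functor"
    using enough_projectives[OF that] by (metis (no_types, lifting) small_def subset_UNIV subset_imp_lepoll)
  then have "\<forall>Z :: ('d, 'm, 'k, 'u) module_functor. \<exists>F. linear_functor K D Z \<longrightarrow> projective K D (fst F :: ('d, 'm, 'k, 'u) module_functor) \<and>
      snd F \<in> natural_transformations K D (fst F) Z \<and> epimorphism D (fst F) Z (snd F)"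
    by simp
  from choice[OF this] obtain F :: "('d, 'm, 'k, 'u) module_functor \<Rightarrow> ('d, 'm, 'k, 'u) module_functor \<times> ('d \<Rightarrow> 'u \<Rightarrow> 'u)"
    where F: "\<forall>Z. linear_functor K D Z \<longrightarrow> projective K D (fst (F Z)) \<and>
      snd (F Z) \<in> natural_transformations K D (fst (F Z)) Z \<and> epimorphism D (fst (F Z)) Z (snd (F Z))" ..
  define Q q where "Q Z = fst (F Z)" and "q Z = snd (F Z)" for Z
  have Q: "projective K D (Q Z)" and q: "q Z \<in> natural_transformations K D (Q Z) Z" "epimorphism D (Q Z) Z (q Z)"
    if "linear_functor K D Z" for Z
    using F[rule_format, OF that] by (simp_all add: Q_def q_def)
  have lQ: "linear_functor K D R" if "projective K D R" for R :: "('d, 'm, 'k, 'u) module_functor"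
    using that unfolding projective_def by blast
  \<comment> \<open>\<open>Z\<close> lists the syzygies: the kernel of the augmentation, then in
    each step the kernel of the cover of the previous one.\<close>
  define Z where "Z = rec_nat (kernel_functor P0 X \<epsilon>) (\<lambda>_ Y. kernel_functor (Q Y) Y (q Y))"
  have Z0: "Z 0 = kernel_functor P0 X \<epsilon>" and ZS: "Z (Suc n) = kernel_functor (Q (Z n)) (Z n) (q (Z n))" for n
    by (simp_all add: Z_def)
  have lZ: "linear_functor K D (Z n)" for n
  proof (induction n)
    case 0 show ?case unfolding Z0
      by (rule linear_functor_kernel_functor[OF lQ[OF P0] X natural_transformationsD[OF \<epsilon>(1)]])
  next
    case (Suc n) show ?case unfolding ZS
      by (rule linear_functor_kernel_functor[OF lQ[OF Q[OF Suc]] Suc natural_transformationsD[OF q(1)[OF Suc]]])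
  qed
  define P where "P n = (case n of 0 \<Rightarrow> P0 | Suc k \<Rightarrow> Q (Z k))" for n
  have P: "P 0 = P0" "P (Suc n) = Q (Z n)" for n by (simp_all add: P_def)
  \<comment> \<open>A cover of a kernel is also a map into the functor that contains the kernel;
    this makes differentials out of the covers of syzygies.\<close>
  have sub: "\<eta> \<in> natural_transformations K D L M"
    if "\<eta> \<in> natural_transformations K D L (kernel_functor M N \<theta>)"
    for \<eta> \<theta> and L :: "('d, 'm, 'k, 'u) module_functor" and M :: "('d, 'm, 'k, 'u) module_functor" and N :: "('d, 'm, 'k, 'w) module_functor"
    using that by (simp add: natural_transformations_def linear_map_into_kernel_functor)
  have "projective_resolution K D X P (\<lambda>n. q (Z n)) \<epsilon>" unfolding projective_resolution_def
  proof (intro conjI allI)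
    fix n
    show "projective K D (P n)" using P0 Q[OF lZ] by (cases n) (simp_all add: P)
    show "q (Z n) \<in> natural_transformations K D (P (Suc n)) (P n)"
      using q(1)[OF lZ[of n]] by (cases n) (auto simp: P Z0 ZS intro: sub)
    \<comment> \<open>A kernel functor keeps the zeros of the functor around it, so the kernel of
      the differential into \<open>P n\<close> is that of the cover of \<open>Z n\<close>, which is
      \<open>Z (Suc n)\<close>.\<close>
    show "exact_at D (P (Suc (Suc n))) (P (Suc n)) (P n) (q (Z (Suc n))) (q (Z n))"
    proof -
      have "\<zero>\<^bsub>Val (Z n) d\<^esub> = \<zero>\<^bsub>Val (P n) d\<^esub>" for d by (cases n) (simp_all add: P Z0 ZS)
      then show ?thesis using q(2)[OF lZ[of "Suc n"]]
        by (simp add: exact_at_def epimorphism_def P ZS)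
    qed
    show "exact_at D (P (Suc 0)) (P 0) X (q (Z 0)) \<epsilon>"
      using q(2)[OF lZ[of 0]] by (simp add: exact_at_def epimorphism_def P Z0)
  qed (use \<epsilon> in \<open>simp_all add: P\<close>)
  then show ?thesis by (rule that)
qed

end

section \<open>Separability as a splitting property\<close>

lemma linear_map_const_zero:
  assumes "Module.module K V" "Module.module K W" shows "linear_map K V W (\<lambda>v. \<zero>\<^bsub>W\<^esub>)"
proof -
  interpret W: Module.module K W by fact
  show ?thesis by (rule linear_mapI) simp_all
qed

lemma natural_family_zero:
  assumes M: "linear_functor K D M" and N: "linear_functor K D N"
  shows "natural_family K D M N (\<lambda>d v. \<zero>\<^bsub>Val N d\<^esub>)"
  unfolding natural_family_def
  by (simp add: linear_map_const_zero linear_functor_module[OF M] linear_functor_module[OF N]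
      linear_map_zero[OF _ _ linear_functor_linear[OF N]])

text \<open>With the cosets unfolded to translates of the coboundaries, one direction evaluates a
  translate at zero; the other shows that coboundaries are closed under sums and
  differences.\<close>

lemma hom_cohomology_trivial_iff:
  assumes P: "\<And>n. linear_functor K D (P n)" and M: "linear_functor K D M"
    and \<delta>: "\<And>n. natural_family K D (P (Suc n)) (P n) (\<delta> n)"
  shows "carrier (hom_cohomology K D P \<delta> (Suc n) M) = {\<zero>\<^bsub>hom_cohomology K D P \<delta> (Suc n) M\<^esub>} \<longleftrightarrow>
    hom_cocycles K D P \<delta> (Suc n) M \<subseteq> hom_coboundaries K D P \<delta> (Suc n) M"
proof -
  let ?V = "natural_module K D (P (Suc n)) M"
  let ?N = "hom_coboundaries K D P \<delta> (Suc n) M" and ?Z = "hom_cocycles K D P \<delta> (Suc n) M"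
  let ?c = "\<lambda>\<phi>. natural_comp D (P (Suc n)) \<phi> (\<delta> n)"
  have coset: "carrier (hom_cohomology K D P \<delta> (Suc n) M) = (\<lambda>v. (\<lambda>n. n \<oplus>\<^bsub>?V\<^esub> v) ` ?N) ` ?Z"
    unfolding hom_cohomology_def quotient_module_def by (auto simp: A_RCOSETS_def' a_r_coset_def')
  have zero: "\<zero>\<^bsub>hom_cohomology K D P \<delta> (Suc n) M\<^esub> = ?N"
    by (simp add: hom_cohomology_def quotient_module_def)
  \<comment> \<open>Composition with \<open>\<delta> n\<close> sees a family on carriers only, so
    restricting the family to an extensional one leaves the composite unchanged.\<close>
  have mem: "?c \<phi> \<in> ?N" if "natural_family K D (P n) M \<phi>" for \<phi>
  proof -
    have "?c \<phi> = ?c (\<lambda>d \<in> LOb D. \<lambda>v \<in> carrier (Val (P n) d). \<phi> d v)"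
      using natural_family_closed[OF \<delta>] by (auto simp: natural_comp_def intro!: restrict_ext)
    then show ?thesis using natural_family_restrict[OF P that] by simp
  qed
  \<comment> \<open>At least one cocycle is needed for the set of cosets to be a singleton and not
    empty.\<close>
  have Z0: "(\<lambda>d \<in> LOb D. \<lambda>v \<in> carrier (Val (P (Suc n)) d). \<zero>\<^bsub>Val M d\<^esub>) \<in> ?Z"
    using natural_family_restrict[OF P natural_family_zero[OF P M]] natural_family_closed[OF \<delta>]
    by (auto simp: hom_cocycles_def natural_comp_def natural_module_def intro!: restrict_ext)
  have add: "?c \<phi> \<oplus>\<^bsub>?V\<^esub> ?c \<psi> = (\<lambda>d \<in> LOb D. \<lambda>v \<in> carrier (Val (P (Suc n)) d). \<phi> d (\<delta> n d v) \<oplus>\<^bsub>Val M d\<^esub> \<psi> d (\<delta> n d v))" for \<phi> \<psi>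
    by (auto simp: natural_module_def natural_comp_def intro!: restrict_ext)
  show ?thesis
  proof
    assume triv: "carrier (hom_cohomology K D P \<delta> (Suc n) M) = {\<zero>\<^bsub>hom_cohomology K D P \<delta> (Suc n) M\<^esub>}"
    show "?Z \<subseteq> ?N"
    proof
      fix v assume v: "v \<in> ?Z"
      then have nt: "v \<in> natural_transformations K D (P (Suc n)) M" by (simp add: hom_cocycles_def)
      have "(\<lambda>n. n \<oplus>\<^bsub>?V\<^esub> v) ` ?N = ?N"
        using imageI[OF v, of "\<lambda>v. (\<lambda>n. n \<oplus>\<^bsub>?V\<^esub> v) ` ?N"] triv[unfolded coset zero] by (simp only: singleton_iff)
      moreover have "?c (\<lambda>d p. \<zero>\<^bsub>Val M d\<^esub>) \<oplus>\<^bsub>?V\<^esub> v \<in> (\<lambda>n. n \<oplus>\<^bsub>?V\<^esub> v) ` ?N"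
        by (rule imageI) (rule mem[OF natural_family_zero[OF P M]])
      moreover have "?c (\<lambda>d p. \<zero>\<^bsub>Val M d\<^esub>) \<oplus>\<^bsub>?V\<^esub> v = v"
      proof
        fix d
        show "(?c (\<lambda>d p. \<zero>\<^bsub>Val M d\<^esub>) \<oplus>\<^bsub>?V\<^esub> v) d = v d"
        proof (cases "d \<in> LOb D")
          case d: True
          interpret Module.module K "Val M d" by (rule linear_functor_module[OF M d])
          show ?thesis
            using nt d natural_family_closed[OF natural_transformationsD[OF nt] d]
            by (auto simp: natural_module_def natural_comp_def natural_transformations_def extensional_def fun_eq_iff restrict_def)
        next
          case False
          then show ?thesis using nt by (simp add: natural_module_def natural_transformations_def extensional_def)
        qed
      qed
      ultimately show "v \<in> ?N" by (simp only:)
    qed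
  next
    assume sub: "?Z \<subseteq> ?N"
    have "(\<lambda>n. n \<oplus>\<^bsub>?V\<^esub> v) ` ?N = ?N" if "v \<in> ?Z" for v
    proof -
      have "v \<in> ?N" using sub that by (rule subsetD)
      then obtain \<psi> where \<psi>: "natural_family K D (P n) M \<psi>" "v = ?c \<psi>"
        unfolding hom_coboundaries.simps using natural_transformationsD by blast
      show ?thesis
      proof (intro equalityI subsetI)
        fix w assume "w \<in> (\<lambda>n. n \<oplus>\<^bsub>?V\<^esub> v) ` ?N"
        then obtain \<phi> where \<phi>: "natural_family K D (P n) M \<phi>" "w = ?c \<phi> \<oplus>\<^bsub>?V\<^esub> v"
          unfolding hom_coboundaries.simps using natural_transformationsD by blast
        \<comment> \<open>sums are expressed by differences, \<open>a + b = a - ((b - b) - b)\<close>\<close>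
        let ?\<theta> = "\<lambda>d v. \<phi> d v \<ominus>\<^bsub>Val M d\<^esub> (\<psi> d v \<ominus>\<^bsub>Val M d\<^esub> \<psi> d v \<ominus>\<^bsub>Val M d\<^esub> \<psi> d v)"
        have "w = ?c ?\<theta>" unfolding \<phi>(2) \<psi>(2) add unfolding natural_comp_def
        proof (intro restrict_ext)
          fix d v assume d: "d \<in> LOb D" and v: "v \<in> carrier (Val (P (Suc n)) d)"
          interpret Module.module K "Val M d" by (rule linear_functor_module[OF M d])
          show "\<phi> d (\<delta> n d v) \<oplus>\<^bsub>Val M d\<^esub> \<psi> d (\<delta> n d v) = ?\<theta> d (\<delta> n d v)"
            using natural_family_closed[OF \<phi>(1) d natural_family_closed[OF \<delta> d v]]
              natural_family_closed[OF \<psi>(1) d natural_family_closed[OF \<delta> d v]]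
            by (simp add: a_minus_def M.r_neg)
        qed
        moreover have "natural_family K D (P n) M ?\<theta>"
          by (intro natural_family_difference P M \<phi>(1) \<psi>(1))
        ultimately show "w \<in> ?N" using mem by blast
      next
        fix w assume "w \<in> ?N"
        then obtain \<phi> where \<phi>: "natural_family K D (P n) M \<phi>" "w = ?c \<phi>"
          unfolding hom_coboundaries.simps using natural_transformationsD by blast
        let ?\<theta> = "\<lambda>d v. \<phi> d v \<ominus>\<^bsub>Val M d\<^esub> \<psi> d v"
        have "w = ?c ?\<theta> \<oplus>\<^bsub>?V\<^esub> v" unfolding \<phi>(2) \<psi>(2) add unfolding natural_comp_def
        proof (intro restrict_ext)
          fix d v assume d: "d \<in> LOb D" and v: "v \<in> carrier (Val (P (Suc n)) d)"
          interpret Module.module K "Val M d" by (rule linear_functor_module[OF M d])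
          show "\<phi> d (\<delta> n d v) = ?\<theta> d (\<delta> n d v) \<oplus>\<^bsub>Val M d\<^esub> \<psi> d (\<delta> n d v)"
            using natural_family_closed[OF \<phi>(1) d natural_family_closed[OF \<delta> d v]]
              natural_family_closed[OF \<psi>(1) d natural_family_closed[OF \<delta> d v]]
            by (simp add: a_minus_def M.a_assoc M.l_neg)
        qed
        moreover have "?c ?\<theta> \<in> ?N" by (rule mem[OF natural_family_difference[OF P M \<phi>(1) \<psi>(1)]])
        ultimately show "w \<in> (\<lambda>n. n \<oplus>\<^bsub>?V\<^esub> v) ` ?N" by blast
      qed
    qed
    then show "carrier (hom_cohomology K D P \<delta> (Suc n) M) = {\<zero>\<^bsub>hom_cohomology K D P \<delta> (Suc n) M\<^esub>}"
      unfolding coset zero using Z0 by blast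
  qed
qed

text \<open>The class of \<open>\<delta> 0\<close> with values in the kernel of the augmentation is the universal obstruction.\<close>

lemma first_cohomology_trivial_iff_splitting:
  fixes P :: "nat \<Rightarrow> ('d, 'm, 'k, 'u) module_functor"
  assumes X: "linear_functor K D X" and res: "projective_resolution K D X P \<delta> \<epsilon>"
  shows "(\<forall>M :: ('d, 'm, 'k, 'u) module_functor. linear_functor K D M \<longrightarrow>
      carrier (hom_cohomology K D P \<delta> 1 M) = {\<zero>\<^bsub>hom_cohomology K D P \<delta> 1 M\<^esub>}) \<longleftrightarrow>
    (\<exists>\<sigma>. natural_family K D X (P 0) \<sigma> \<and> (\<forall>d \<in> LOb D. \<forall>x \<in> carrier (Val X d). \<epsilon> d (\<sigma> d x) = x))"
proof -
  have P: "linear_functor K D (P n)" for n using res by (simp add: projective_resolution_def projective_def)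
  have \<delta>nt: "\<delta> n \<in> natural_transformations K D (P (Suc n)) (P n)" for n
    using res by (simp add: projective_resolution_def)
  note \<delta> = natural_transformationsD[OF \<delta>nt]
  have \<epsilon>: "natural_family K D (P 0) X \<epsilon>" and epi: "epimorphism D (P 0) X \<epsilon>"
    using res natural_transformationsD by (auto simp: projective_resolution_def)
  have im: "\<delta> 0 d ` carrier (Val (P (Suc 0)) d) = {p \<in> carrier (Val (P 0) d). \<epsilon> d p = \<zero>\<^bsub>Val X d\<^esub>}"
    and im': "\<delta> (Suc 0) d ` carrier (Val (P (Suc (Suc 0))) d) =
      {p \<in> carrier (Val (P (Suc 0)) d). \<delta> 0 d p = \<zero>\<^bsub>Val (P 0) d\<^esub>}" if "d \<in> LOb D" for d
    using res that by (simp_all add: projective_resolution_def exact_at_def)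
  let ?L = "kernel_functor (P 0) X \<epsilon>"
  note L = linear_functor_kernel_functor[OF P X \<epsilon>]
  have \<epsilon>\<delta>: "\<epsilon> d (\<delta> 0 d v) = \<zero>\<^bsub>Val X d\<^esub>" if "d \<in> LOb D" "v \<in> carrier (Val (P (Suc 0)) d)" for d v
    using im[OF that(1)] that(2) by blast
  have \<delta>\<delta>: "\<delta> 0 d (\<delta> (Suc 0) d v) = \<zero>\<^bsub>Val (P 0) d\<^esub>" if "d \<in> LOb D" "v \<in> carrier (Val (P (Suc (Suc 0))) d)" for d v
    using im'[OF that(1)] that(2) by blast
  have \<delta>L: "natural_family K D (P (Suc 0)) ?L (\<delta> 0)"
    using \<delta> \<epsilon>\<delta> by (simp add: natural_family_into_kernel_functor)
  have triv: "carrier (hom_cohomology K D P \<delta> 1 M) = {\<zero>\<^bsub>hom_cohomology K D P \<delta> 1 M\<^esub>} \<longleftrightarrow>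
    hom_cocycles K D P \<delta> (Suc 0) M \<subseteq> hom_coboundaries K D P \<delta> (Suc 0) M"
    if "linear_functor K D M" for M :: "('d, 'm, 'k, 'u) module_functor"
    unfolding One_nat_def by (rule hom_cohomology_trivial_iff[where P = P and \<delta> = \<delta>, OF P that \<delta>])
  show ?thesis
  proof
    assume "\<forall>M :: ('d, 'm, 'k, 'u) module_functor. linear_functor K D M \<longrightarrow>
      carrier (hom_cohomology K D P \<delta> 1 M) = {\<zero>\<^bsub>hom_cohomology K D P \<delta> 1 M\<^esub>}"
    \<comment> \<open>The kernel \<open>?L\<close> of the augmentation is itself
      \<open>'u\<close>-valued, hence among the admissible coefficients.\<close>
    then have sub: "hom_cocycles K D P \<delta> (Suc 0) ?L \<subseteq> hom_coboundaries K D P \<delta> (Suc 0) ?L"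
      using triv[OF L] L by blast
    have "\<delta> 0 \<in> natural_transformations K D (P (Suc 0)) ?L"
      using \<delta>nt[of 0] \<epsilon>\<delta> by (simp add: natural_transformations_def linear_map_into_kernel_functor)
    then have "\<delta> 0 \<in> hom_cocycles K D P \<delta> (Suc 0) ?L"
      by (auto simp: hom_cocycles_def natural_comp_def natural_module_def \<delta>\<delta> intro!: restrict_ext)
    then obtain \<psi> where \<psi>: "\<psi> \<in> natural_transformations K D (P 0) ?L" "natural_comp D (P (Suc 0)) \<psi> (\<delta> 0) = \<delta> 0"
      using sub by auto
    then have retract: "\<psi> d (\<delta> 0 d v) = \<delta> 0 d v" if "d \<in> LOb D" "v \<in> carrier (Val (P (Suc 0)) d)" for d v
      using that natural_comp_eq_iff[OF \<delta>nt] by blast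
    have \<psi>': "natural_family K D (P 0) (P 0) \<psi>" "\<And>d p. \<lbrakk>d \<in> LOb D; p \<in> carrier (Val (P 0) d)\<rbrakk> \<Longrightarrow> \<epsilon> d (\<psi> d p) = \<zero>\<^bsub>Val X d\<^esub>"
      using natural_transformationsD[OF \<psi>(1)] by (simp_all add: natural_family_into_kernel_functor)
    \<comment> \<open>As \<open>\<psi>\<close> fixes the image of \<open>\<delta> 0\<close>, which
      is the kernel of \<open>\<epsilon>\<close>, the identity minus \<open>\<psi>\<close> vanishes
      on that kernel and descends along \<open>\<epsilon>\<close> to \<open>\<sigma>\<close>. Since
      \<open>\<epsilon>\<close> kills the values of \<open>\<psi>\<close>, this
      \<open>\<sigma>\<close> is a section.\<close>
    let ?\<theta> = "\<lambda>d p. p \<ominus>\<^bsub>Val (P 0) d\<^esub> \<psi> d p"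
    have "?\<theta> d p = \<zero>\<^bsub>Val (P 0) d\<^esub>" if d: "d \<in> LOb D" and p: "p \<in> carrier (Val (P 0) d)" "\<epsilon> d p = \<zero>\<^bsub>Val X d\<^esub>" for d p
    proof -
      interpret Module.module K "Val (P 0) d" by (rule linear_functor_module[OF P d])
      obtain v where "v \<in> carrier (Val (P (Suc 0)) d)" "p = \<delta> 0 d v" using im[OF d] p by blast
      then have "\<psi> d p = p" using retract[OF d] by simp
      then show ?thesis using p by (simp add: minus_eq_zero_iff)
    qed
    then obtain \<sigma> where \<sigma>: "natural_family K D X (P 0) \<sigma>"
      "\<And>d p. \<lbrakk>d \<in> LOb D; p \<in> carrier (Val (P 0) d)\<rbrakk> \<Longrightarrow> \<sigma> d (\<epsilon> d p) = ?\<theta> d p"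
      by (rule natural_family_factor[OF P X P \<epsilon> epi natural_family_difference[OF P P natural_family_id \<psi>'(1)]]) blast+
    have "\<epsilon> d (\<sigma> d x) = x" if d: "d \<in> LOb D" and x: "x \<in> carrier (Val X d)" for d x
    proof -
      interpret X: Module.module K "Val X d" by (rule linear_functor_module[OF X d])
      obtain p where p: "p \<in> carrier (Val (P 0) d)" "x = \<epsilon> d p" using epi d x unfolding epimorphism_def by blast
      then show ?thesis using d x natural_family_closed[OF \<psi>'(1) d]
        by (simp add: \<sigma>(2) \<psi>'(2) a_minus_def
            linear_map_minus[OF linear_functor_module[OF P d] linear_functor_module[OF X d] natural_family_linear[OF \<epsilon> d], unfolded a_minus_def])
    qed
    then show "\<exists>\<sigma>. natural_family K D X (P 0) \<sigma> \<and> (\<forall>d \<in> LOb D. \<forall>x \<in> carrier (Val X d). \<epsilon> d (\<sigma> d x) = x)"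
      using \<sigma>(1) by blast
  next
    assume "\<exists>\<sigma>. natural_family K D X (P 0) \<sigma> \<and> (\<forall>d \<in> LOb D. \<forall>x \<in> carrier (Val X d). \<epsilon> d (\<sigma> d x) = x)"
    then obtain \<sigma> where \<sigma>: "natural_family K D X (P 0) \<sigma>" "\<And>d x. \<lbrakk>d \<in> LOb D; x \<in> carrier (Val X d)\<rbrakk> \<Longrightarrow> \<epsilon> d (\<sigma> d x) = x"
      by blast
    \<comment> \<open>The projection of \<open>P 0\<close> onto the kernel of
      \<open>\<epsilon>\<close> that belongs to the section.\<close>
    let ?\<theta> = "\<lambda>d p. p \<ominus>\<^bsub>Val (P 0) d\<^esub> \<sigma> d (\<epsilon> d p)"
    have "natural_family K D (P 0) (P 0) ?\<theta>"
      by (rule natural_family_difference[OF P P natural_family_id natural_family_comp[OF \<epsilon> \<sigma>(1)]])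
    moreover have "\<epsilon> d (?\<theta> d p) = \<zero>\<^bsub>Val X d\<^esub>" if d: "d \<in> LOb D" and p: "p \<in> carrier (Val (P 0) d)" for d p
    proof -
      interpret X: Module.module K "Val X d" by (rule linear_functor_module[OF X d])
      show ?thesis using d p natural_family_closed[OF \<epsilon> d] natural_family_closed[OF \<sigma>(1) d]
        by (simp add: \<sigma>(2) X.minus_eq_zero_iff
            linear_map_minus[OF linear_functor_module[OF P d] linear_functor_module[OF X d] natural_family_linear[OF \<epsilon> d]])
    qed
    ultimately have \<theta>: "natural_family K D (P 0) ?L ?\<theta>" by (simp add: natural_family_into_kernel_functor)
    show "\<forall>M :: ('d, 'm, 'k, 'u) module_functor. linear_functor K D M \<longrightarrow>
      carrier (hom_cohomology K D P \<delta> 1 M) = {\<zero>\<^bsub>hom_cohomology K D P \<delta> 1 M\<^esub>}"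
    proof (intro allI impI)
      fix M :: "('d, 'm, 'k, 'u) module_functor" assume M: "linear_functor K D M"
      have "\<phi> \<in> hom_coboundaries K D P \<delta> (Suc 0) M" if "\<phi> \<in> hom_cocycles K D P \<delta> (Suc 0) M" for \<phi>
      proof -
        have \<phi>: "\<phi> \<in> natural_transformations K D (P (Suc 0)) M"
          and cocycle: "natural_comp D (P (Suc (Suc 0))) \<phi> (\<delta> (Suc 0)) = \<zero>\<^bsub>natural_module K D (P (Suc (Suc 0))) M\<^esub>"
          using that by (simp_all add: hom_cocycles_def)
        have "\<phi> d (\<delta> (Suc 0) d v) = \<zero>\<^bsub>Val M d\<^esub>" if "d \<in> LOb D" "v \<in> carrier (Val (P (Suc (Suc 0))) d)" for d v
          using fun_cong[OF fun_cong[OF cocycle], of d v] that by (simp add: natural_comp_def natural_module_def)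
        moreover have "p \<in> \<delta> (Suc 0) d ` carrier (Val (P (Suc (Suc 0))) d)"
          if "d \<in> LOb D" "p \<in> carrier (Val (P (Suc 0)) d)" "\<delta> 0 d p = \<zero>\<^bsub>Val ?L d\<^esub>" for d p
          unfolding im'[OF that(1)] using that by simp
        ultimately have "\<phi> d p = \<zero>\<^bsub>Val M d\<^esub>"
          if "d \<in> LOb D" "p \<in> carrier (Val (P (Suc 0)) d)" "\<delta> 0 d p = \<zero>\<^bsub>Val ?L d\<^esub>" for d p
          using that by blast
        moreover have "epimorphism D (P (Suc 0)) ?L (\<delta> 0)" using im by (simp add: epimorphism_def)
        \<comment> \<open>A cocycle vanishes on the image of \<open>\<delta> (Suc 0)\<close>, which
          is the kernel of \<open>\<delta> 0\<close>, so it factors through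
          \<open>\<delta> 0\<close> viewed as an epimorphism onto \<open>?L\<close>. Extending
          \<open>\<chi>\<close> to \<open>P 0\<close> by the projection \<open>?\<theta>\<close>
          exhibits the cocycle as a coboundary.\<close>
        ultimately obtain \<chi> where \<chi>: "natural_family K D ?L M \<chi>"
          "\<And>d p. \<lbrakk>d \<in> LOb D; p \<in> carrier (Val (P (Suc 0)) d)\<rbrakk> \<Longrightarrow> \<chi> d (\<delta> 0 d p) = \<phi> d p"
          using natural_family_factor[OF P L M \<delta>L _ natural_transformationsD[OF \<phi>]] by metis
        let ?\<psi> = "\<lambda>d \<in> LOb D. \<lambda>p \<in> carrier (Val (P 0) d). \<chi> d (?\<theta> d p)"
        have "?\<psi> \<in> natural_transformations K D (P 0) M"
          by (rule natural_family_restrict[OF P natural_family_comp[OF \<theta> \<chi>(1)]])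
        moreover have "natural_comp D (P (Suc 0)) ?\<psi> (\<delta> 0) = \<phi>"
        proof (unfold natural_comp_eq_iff[OF \<phi>], intro ballI)
          fix d v assume d: "d \<in> LOb D" and v: "v \<in> carrier (Val (P (Suc 0)) d)"
          interpret P0: Module.module K "Val (P 0) d" by (rule linear_functor_module[OF P d])
          \<comment> \<open>The projection fixes the image of \<open>\<delta> 0\<close>, because
            \<open>\<epsilon>\<close> vanishes there.\<close>
          have "?\<theta> d (\<delta> 0 d v) = \<delta> 0 d v"
            using natural_family_closed[OF \<delta> d v] linear_map_zero[OF linear_functor_module[OF X d] linear_functor_module[OF P d] natural_family_linear[OF \<sigma>(1) d]]
            by (simp add: \<epsilon>\<delta>[OF d v] a_minus_def)
          then show "?\<psi> d (\<delta> 0 d v) = \<phi> d v" using d v natural_family_closed[OF \<delta> d v] by (simp add: \<chi>(2))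
        qed
        ultimately show ?thesis by auto
      qed
      then show "carrier (hom_cohomology K D P \<delta> 1 M) = {\<zero>\<^bsub>hom_cohomology K D P \<delta> 1 M\<^esub>}"
        using triv[OF M] by blast
    qed
  qed
qed

section \<open>Linearizations of delta categories\<close>

lemma tensor_product_trivial:
  assumes V: "Module.module K V" and W: "Module.module K W"
    and triv: "carrier V \<subseteq> {\<zero>\<^bsub>V\<^esub>} \<or> carrier W \<subseteq> {\<zero>\<^bsub>W\<^esub>}"
    and t: "t \<in> carrier (tensor_product K V W)"
  shows "t = \<zero>\<^bsub>tensor_product K V W\<^esub>"
proof -
  note T = module_tensor_product[OF V W] and bil = bilinear_mapD[OF bilinear_pure_tensor[OF V W]]
  have "pure_tensor K V W v w = \<zero>\<^bsub>tensor_product K V W\<^esub>" if "v \<in> carrier V" "w \<in> carrier W" for v w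
    using triv that linear_map_zero[OF W T bil(1)[OF that(1)]] linear_map_zero[OF V T bil(2)[OF that(2)]] by blast
  then show ?thesis
    by (rule linear_map_tensor_eqI[OF V W T linear_map_id linear_map_const_zero[OF T T] _ t])
qed

lemma linearization_simps:
  "LOb (linearization K A) = Ob A" "LHom (linearization K A) x y = free_module K (Hom A x y)"
  "LIde (linearization K A) x = basis_vector K (Ide A x)"
  by (simp_all add: linearization_def)

lemma free_module_empty: "a \<in> carrier (free_module K {}) \<Longrightarrow> a = \<zero>\<^bsub>free_module K {}\<^esub>"
  by (auto simp: free_module_simps support_def)

lemma free_module_singleton:
  assumes "cring K" and a: "a \<in> carrier (free_module K {s})"
  shows "a = a s \<odot>\<^bsub>free_module K {s}\<^esub> basis_vector K s"
proof -
  interpret cring K by fact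
  have "a t \<in> carrier K" "t \<noteq> s \<Longrightarrow> a t = \<zero>\<^bsub>K\<^esub>" for t
    using a by (auto simp: free_module_simps support_def)
  then show ?thesis by (auto simp: free_module_simps basis_vector_def)
qed

text \<open>Both composites are endomorphisms, hence identities, so \<open>f\<close> is an
  isomorphism and skeletality identifies its ends.\<close>

lemma delta_category_antisym:
  assumes A: "delta_category A" and "x \<in> Ob A" "y \<in> Ob A" "f \<in> Hom A x y" "g \<in> Hom A y x"
  shows "x = y"
proof -
  interpret category A using A by (simp add: delta_category_def)
  have "Comp A x y x g f = Ide A x" "Comp A y x y f g = Ide A y"
    using A assms(2-) comp_closed[of x y x f g] comp_closed[of y x y g f] by (auto simp: delta_category_def)
  then have "isomorphism A x y f" using assms unfolding isomorphism_def by blast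
  then show ?thesis using A assms unfolding delta_category_def skeletal_def by blast
qed

lemma diagonal_object: "x \<in> LOb C \<Longrightarrow> (x, x) \<in> LOb (enveloping_category K C)"
  by (simp add: enveloping_category_simps)

section \<open>Sections of epimorphisms onto the regular bimodule\<close>

context
  fixes K :: "('k, 'z) ring_scheme" and C :: "('o, 'm, 'k) linear_category"
  assumes K: "cring K" and C: "linear_category K C"
begin

private abbreviation (input) "envelope \<equiv> enveloping_category K C"
private abbreviation (input) "regular \<equiv> regular_bimodule K C"
text \<open>The summand at \<open>z\<close> has the value \<open>C(z, x) \<otimes> C(y, z)\<close>
  at \<open>(x, y)\<close>. With the identities as images of the generators,
  \<open>diagonal_lift\<close> sends the tensor of \<open>f\<close> and \<open>g\<close> in this
  summand to the composite of \<open>g\<close> followed by \<open>f\<close>.\<close>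

private abbreviation (input) "diagonal_free \<equiv> free_functor envelope (LOb C) (\<lambda>x. (x, x))"
private abbreviation (input) "diagonal_lift \<equiv> free_lift envelope (LOb C) (\<lambda>x. (x, x)) regular (LIde C)"

context
  assumes inf: "infinite (UNIV :: 'u set)" and small_K: "small TYPE('u) (carrier K)"
    and small_objects: "small TYPE('u) (LOb C)"
    and small_homs: "\<And>x y. \<lbrakk>x \<in> LOb C; y \<in> LOb C\<rbrakk> \<Longrightarrow> small TYPE('u) (carrier (LHom C x y))"
begin

lemma small_regular_bimodule: "d \<in> LOb envelope \<Longrightarrow> small TYPE('u) (carrier (Val regular d))"
  by (cases d) (auto simp: regular_bimodule_Val enveloping_category_simps small_homs)

text \<open>The \<open>SOME\<close> in \<open>Ext\<close> does not mention the coefficients, so one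
  resolution serves all of them, and its term in degree 0 is the \<open>P\<close> obtained here.
  Existence of some resolution guarantees that the chosen pair is one.\<close>

lemma separable_splitting:
  obtains P :: "('o \<times> 'o, ('m \<times> 'm \<Rightarrow> 'k) set, 'k, 'u) module_functor" and \<epsilon>
  where "projective K envelope P" "natural_family K envelope P regular \<epsilon>" "epimorphism envelope P regular \<epsilon>"
    "separable TYPE('u) K C \<longleftrightarrow>
      (\<exists>\<sigma>. natural_family K envelope regular P \<sigma> \<and> (\<forall>d \<in> LOb envelope. \<forall>x \<in> carrier (Val regular d). \<epsilon> d (\<sigma> d x) = x))"
proof -
  note X = linear_functor_regular_bimodule[OF C]
  have E: "linear_category K envelope" by (rule linear_category_enveloping[OF C])
  have "small TYPE('u) (LOb envelope)"
    unfolding enveloping_category_simps by (intro small_Times inf small_objects)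
  then obtain P0 :: "nat \<Rightarrow> ('o \<times> 'o, ('m \<times> 'm \<Rightarrow> 'k) set, 'k, 'u) module_functor" and \<delta>0 \<epsilon>0
    where res0: "projective_resolution K envelope regular P0 \<delta>0 \<epsilon>0"
    by (rule projective_resolution_exists[OF inf K E _ small_enveloping_category[OF inf C small_K small_homs] X small_regular_bimodule])
  obtain P :: "nat \<Rightarrow> ('o \<times> 'o, ('m \<times> 'm \<Rightarrow> 'k) set, 'k, 'u) module_functor" and \<delta>
    where chosen: "(SOME (P :: nat \<Rightarrow> ('o \<times> 'o, ('m \<times> 'm \<Rightarrow> 'k) set, 'k, 'u) module_functor, \<delta>).
      \<exists>\<epsilon>. projective_resolution K envelope regular P \<delta> \<epsilon>) = (P, \<delta>)" by (metis surj_pair)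
  have "(case (SOME (P :: nat \<Rightarrow> ('o \<times> 'o, ('m \<times> 'm \<Rightarrow> 'k) set, 'k, 'u) module_functor, \<delta>).
      \<exists>\<epsilon>. projective_resolution K envelope regular P \<delta> \<epsilon>) of (P, \<delta>) \<Rightarrow> \<exists>\<epsilon>. projective_resolution K envelope regular P \<delta> \<epsilon>)"
    by (rule someI[of _ "(P0, \<delta>0)"]) (use res0 in auto)
  then obtain \<epsilon> where res: "projective_resolution K envelope regular P \<delta> \<epsilon>" unfolding chosen by auto
  have Ext: "hochschild_mitchell K C 1 M = hom_cohomology K envelope P \<delta> 1 M" for M
    unfolding hochschild_mitchell_def Ext_def chosen by simp
  show ?thesis
  proof
    show "projective K envelope (P 0)" "natural_family K envelope (P 0) regular \<epsilon>" "epimorphism envelope (P 0) regular \<epsilon>"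
      using res natural_transformationsD by (auto simp: projective_resolution_def)
    show "separable TYPE('u) K C \<longleftrightarrow>
      (\<exists>\<sigma>. natural_family K envelope regular (P 0) \<sigma> \<and> (\<forall>d \<in> LOb envelope. \<forall>x \<in> carrier (Val regular d). \<epsilon> d (\<sigma> d x) = x))"
      unfolding separable_def bimodule_def Ext by (rule first_cohomology_trivial_iff_splitting[OF X res])
  qed
qed

text \<open>The values of \<open>M\<close> may lie in a type other than \<open>'u\<close>, as
  \<open>projectiveD\<close> permits; this is the case for the diagonal free bimodule, to which the
  lemma is applied.\<close>

lemma separable_section:
  fixes M :: "('o \<times> 'o, ('m \<times> 'm \<Rightarrow> 'k) set, 'k, 'v) module_functor"
  assumes sep: "separable TYPE('u) K C" and M: "linear_functor K envelope M"
    and small: "\<And>d. d \<in> LOb envelope \<Longrightarrow> small TYPE('u) (carrier (Val M d))"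
    and \<pi>: "natural_family K envelope M regular \<pi>" "epimorphism envelope M regular \<pi>"
  obtains \<sigma> where "natural_family K envelope regular M \<sigma>"
    and "\<And>d x. \<lbrakk>d \<in> LOb envelope; x \<in> carrier (Val regular d)\<rbrakk> \<Longrightarrow> \<pi> d (\<sigma> d x) = x"
proof -
  obtain P :: "('o \<times> 'o, ('m \<times> 'm \<Rightarrow> 'k) set, 'k, 'u) module_functor" and \<epsilon> \<sigma>
    where P: "projective K envelope P" "natural_family K envelope P regular \<epsilon>"
    and \<sigma>: "natural_family K envelope regular P \<sigma>" "\<And>d x. \<lbrakk>d \<in> LOb envelope; x \<in> carrier (Val regular d)\<rbrakk> \<Longrightarrow> \<epsilon> d (\<sigma> d x) = x"
    using separable_splitting sep by metis
  obtain \<psi> where \<psi>: "natural_family K envelope P M \<psi>" "\<And>d p. \<lbrakk>d \<in> LOb envelope; p \<in> carrier (Val P d)\<rbrakk> \<Longrightarrow> \<pi> d (\<psi> d p) = \<epsilon> d p"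
    by (rule projectiveD[OF P(1) M linear_functor_regular_bimodule[OF C] small small_regular_bimodule \<pi> P(2)]) blast+
  show ?thesis
    by (rule that[OF natural_family_comp[OF \<sigma>(1) \<psi>(1)]]) (simp add: \<psi>(2) \<sigma>(2) natural_family_closed[OF \<sigma>(1)])
qed

lemma separableI:
  assumes "\<And>(P :: ('o \<times> 'o, ('m \<times> 'm \<Rightarrow> 'k) set, 'k, 'u) module_functor) \<epsilon>.
    \<lbrakk>linear_functor K envelope P; natural_family K envelope P regular \<epsilon>; epimorphism envelope P regular \<epsilon>\<rbrakk>
      \<Longrightarrow> \<exists>\<sigma>. natural_family K envelope regular P \<sigma> \<and> (\<forall>d \<in> LOb envelope. \<forall>x \<in> carrier (Val regular d). \<epsilon> d (\<sigma> d x) = x)"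
  shows "separable TYPE('u) K C"
proof -
  obtain P :: "('o \<times> 'o, ('m \<times> 'm \<Rightarrow> 'k) set, 'k, 'u) module_functor" and \<epsilon>
    where "projective K envelope P" "natural_family K envelope P regular \<epsilon>" "epimorphism envelope P regular \<epsilon>"
    "separable TYPE('u) K C \<longleftrightarrow>
      (\<exists>\<sigma>. natural_family K envelope regular P \<sigma> \<and> (\<forall>d \<in> LOb envelope. \<forall>x \<in> carrier (Val regular d). \<epsilon> d (\<sigma> d x) = x))"
    by (rule separable_splitting)
  then show ?thesis using assms[of P \<epsilon>] unfolding projective_def by blast
qed

end

lemma identity_regular_bimodule: "x \<in> LOb C \<Longrightarrow> LIde C x \<in> carrier (Val regular (x, x))"
  by (simp add: regular_bimodule_Val linear_category_ide[OF C])

text \<open>A morphism arises by acting on the identity of its source and also by acting on that of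
  its target. The first equation yields surjectivity of the diagonal lift; both together confine the
  image of the morphism under a section.\<close>

lemma regular_bimodule_act_ide:
  assumes o: "x \<in> LOb C" "y \<in> LOb C" and a: "a \<in> carrier (LHom C x y)"
  shows "Act regular (x, x) (y, x) (pure_tensor K (LHom C x y) (LHom C x x) a (LIde C x)) (LIde C x) = a"
    and "Act regular (y, y) (y, x) (pure_tensor K (LHom C y y) (LHom C x y) (LIde C y) a) (LIde C y) = a"
  using assms linear_categoryD[OF C] by (simp_all add: regular_bimodule_act_pure_tensor[OF C])

lemma natural_family_diagonal_lift: "natural_family K envelope diagonal_free regular diagonal_lift"
  by (rule natural_family_free_lift[OF K linear_category_enveloping[OF C] diagonal_object
        linear_functor_regular_bimodule[OF C] identity_regular_bimodule])

text \<open>A morphism \<open>a\<close> from \<open>x\<close> to \<open>y\<close> is hit by the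
  tensor of \<open>a\<close> and the identity in the summand at \<open>x\<close>.\<close>

lemma epimorphism_diagonal_lift: "epimorphism envelope diagonal_free regular diagonal_lift"
  unfolding epimorphism_def
proof (intro ballI equalityI subsetI)
  fix d a assume "d \<in> LOb envelope" and a: "a \<in> carrier (Val regular d)"
  then obtain x y where d: "d = (y, x)" and o: "x \<in> LOb C" "y \<in> LOb C"
    by (cases d) (auto simp: enveloping_category_simps)
  have a: "a \<in> carrier (LHom C x y)" using a by (simp add: d regular_bimodule_Val)
  let ?g = "free_inclusion envelope (LOb C) (\<lambda>x. (x, x)) (x, x) x (LIde envelope (x, x))"
  let ?t = "pure_tensor K (LHom C x y) (LHom C x x) a (LIde C x)"
  have g: "?g \<in> carrier (Val diagonal_free (x, x))"
    by (rule generator_closed[OF K linear_category_enveloping[OF C] diagonal_object o(1)])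
  have t: "?t \<in> carrier (LHom envelope (x, x) (y, x))"
    using o a linear_categoryD[OF C] by (simp add: enveloping_category_simps pure_tensor_closed)
  have yx: "(y, x) \<in> LOb envelope" using o by (simp add: enveloping_category_simps)
  have "diagonal_lift (y, x) (Act diagonal_free (x, x) (y, x) ?t ?g)
    = Act regular (x, x) (y, x) ?t (diagonal_lift (x, x) ?g)"
    by (rule natural_family_natural[OF natural_family_diagonal_lift diagonal_object[OF o(1)] yx t g])
  also have "diagonal_lift (x, x) ?g = LIde C x"
    by (rule free_lift_generator[OF K linear_category_enveloping[OF C] diagonal_object
        linear_functor_regular_bimodule[OF C] identity_regular_bimodule o(1)])
  finally have "a = diagonal_lift d (Act diagonal_free (x, x) (y, x) ?t ?g)"
    using regular_bimodule_act_ide(1)[OF o a] d by simp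
  moreover have "Act diagonal_free (x, x) (y, x) ?t ?g \<in> carrier (Val diagonal_free d)"
    unfolding d by (rule linear_functor_closed[OF linear_functor_free_functor[OF K linear_category_enveloping[OF C] diagonal_object]
          diagonal_object[OF o(1)] yx t g])
  ultimately show "a \<in> diagonal_lift d ` carrier (Val diagonal_free d)" by (rule image_eqI)
qed (use natural_family_closed[OF natural_family_diagonal_lift] in auto)

text \<open>
  A section sends the identity of \<open>x\<close> to an element supported at \<open>x\<close>, so \<open>a\<close> from \<open>x\<close> to
  \<open>y\<close>, being \<open>a\<close> acting on either identity, is sent to an element supported at both \<open>x\<close> and \<open>y\<close>.
\<close>

lemma diagonal_section_vanishes:
  assumes \<sigma>: "natural_family K envelope regular diagonal_free \<sigma>"
    and sec: "\<And>d v. \<lbrakk>d \<in> LOb envelope; v \<in> carrier (Val regular d)\<rbrakk> \<Longrightarrow> diagonal_lift d (\<sigma> d v) = v"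
    and disjoint: "\<And>x z. \<lbrakk>x \<in> LOb C; z \<in> LOb C; z \<noteq> x\<rbrakk> \<Longrightarrow>
      carrier (LHom C z x) \<subseteq> {\<zero>\<^bsub>LHom C z x\<^esub>} \<or> carrier (LHom C x z) \<subseteq> {\<zero>\<^bsub>LHom C x z\<^esub>}"
    and o: "x \<in> LOb C" "y \<in> LOb C" "x \<noteq> y" and a: "a \<in> carrier (LHom C x y)"
  shows "a = \<zero>\<^bsub>LHom C x y\<^esub>"
proof -
  note cd = linear_categoryD[OF C]
  note E = linear_category_enveloping[OF C]
  note F = linear_functor_free_functor[OF K E diagonal_object]
  have yx: "(y, x) \<in> LOb envelope" using o by (simp add: enveloping_category_simps)
  have ax: "a \<in> carrier (Val regular (y, x))" using a by (simp add: regular_bimodule_Val)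
  \<comment> \<open>The component at \<open>z\<close> lies in
    \<open>C(z, x) \<otimes> C(x, z)\<close>, and \<open>disjoint\<close> makes one of the factors
    zero.\<close>
  have supp: "\<sigma> (x, x) (LIde C x) z = \<zero>\<^bsub>LHom envelope (z, z) (x, x)\<^esub>"
    if "x \<in> LOb C" "z \<in> LOb C" "z \<noteq> x" for x z
    using tensor_product_trivial[OF cd(1) cd(1) disjoint[OF that]] that
      free_functor_component[OF natural_family_closed[OF \<sigma> diagonal_object identity_regular_bimodule], of x z]
    by (simp add: enveloping_category_simps)
  \<comment> \<open>The action works in each summand separately and linearly, so a component that is
    zero stays zero.\<close>
  have act: "Act diagonal_free (x, x) (y', x') t (\<sigma> (x, x) (LIde C x)) z = \<zero>\<^bsub>LHom envelope (z, z) (y', x')\<^esub>"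
    if "x \<in> LOb C" "z \<in> LOb C" "z \<noteq> x" "x' \<in> LOb C" "y' \<in> LOb C" "t \<in> carrier (LHom envelope (x, x) (y', x'))" for x z x' y' t
  proof -
    have e: "(y', x') \<in> LOb envelope" using that by (simp add: enveloping_category_simps)
    note d = diagonal_object[OF that(1)] diagonal_object[OF that(2)]
    show ?thesis using that(2) supp[OF that(1-3)]
        linear_map_zero[OF linear_category_module[OF E d(2,1)] linear_category_module[OF E d(2) e]
          linear_category_linear_right[OF E d(2,1) e that(6)]]
      by (simp add: free_functor_def)
  qed
  let ?t = "pure_tensor K (LHom C x y) (LHom C x x) a (LIde C x)"
  let ?t' = "pure_tensor K (LHom C y y) (LHom C x y) (LIde C y) a"
  have t: "?t \<in> carrier (LHom envelope (x, x) (y, x))" "?t' \<in> carrier (LHom envelope (y, y) (y, x))"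
    using o a cd by (simp_all add: enveloping_category_simps pure_tensor_closed)
  have \<sigma>a: "\<sigma> (y, x) a = Act diagonal_free (x, x) (y, x) ?t (\<sigma> (x, x) (LIde C x))"
    "\<sigma> (y, x) a = Act diagonal_free (y, y) (y, x) ?t' (\<sigma> (y, y) (LIde C y))"
    using natural_family_natural[OF \<sigma> diagonal_object yx t(1) identity_regular_bimodule]
      natural_family_natural[OF \<sigma> diagonal_object yx t(2) identity_regular_bimodule]
      regular_bimodule_act_ide[OF o(1,2) a] o by simp_all
  \<comment> \<open>At \<open>z = x\<close> the description through the identity of \<open>y\<close>
    gives zero, since \<open>x\<close> and \<open>y\<close> differ; at every other \<open>z\<close>
    the one through the identity of \<open>x\<close> does.\<close>
  have "\<sigma> (y, x) a z = \<zero>\<^bsub>LHom envelope (z, z) (y, x)\<^esub>" if z: "z \<in> LOb C" for z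
  proof (cases "z = x")
    case True
    then show ?thesis using act[OF o(2) z _ o(1,2) t(2)] o(3) \<sigma>a(2) by simp
  next
    case False
    then show ?thesis using act[OF o(1) z _ o(1,2) t(1)] \<sigma>a(1) by simp
  qed
  moreover have "\<sigma> (y, x) a \<in> extensional (LOb C)"
    by (rule free_functor_extensional[OF natural_family_closed[OF \<sigma> yx ax]])
  ultimately have "\<sigma> (y, x) a = \<zero>\<^bsub>Val diagonal_free (y, x)\<^esub>"
    by (auto simp: free_functor_def extensional_def fun_eq_iff)
  then have "a = diagonal_lift (y, x) \<zero>\<^bsub>Val diagonal_free (y, x)\<^esub>"
    using sec[OF yx ax] by simp
  also have "\<dots> = \<zero>\<^bsub>Val regular (y, x)\<^esub>"
    by (rule linear_map_zero[OF linear_functor_module[OF F yx]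
          linear_functor_module[OF linear_functor_regular_bimodule[OF C] yx]
          natural_family_linear[OF natural_family_diagonal_lift yx]])
  finally show ?thesis by (simp add: regular_bimodule_Val)
qed

end

text \<open>At \<open>(x, x)\<close> the regular bimodule is free on the identity of
  \<open>x\<close>, and off the diagonal it is zero. A family of linear maps out of it into
  \<open>P\<close> is thus a choice of one element of \<open>P\<close> at each
  \<open>(x, x)\<close>.\<close>

lemma discrete_regular_bimodule_section:
  assumes K: "cring K" and A: "discrete_category A"
    and P: "linear_functor K (enveloping_category K (linearization K A)) P"
    and \<epsilon>: "natural_family K (enveloping_category K (linearization K A)) P (regular_bimodule K (linearization K A)) \<epsilon>"
    and epi: "epimorphism (enveloping_category K (linearization K A)) P (regular_bimodule K (linearization K A)) \<epsilon>"
  obtains \<sigma> where "natural_family K (enveloping_category K (linearization K A)) (regular_bimodule K (linearization K A)) P \<sigma>"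
    and "\<And>d v. \<lbrakk>d \<in> LOb (enveloping_category K (linearization K A)); v \<in> carrier (Val (regular_bimodule K (linearization K A)) d)\<rbrakk>
      \<Longrightarrow> \<epsilon> d (\<sigma> d v) = v"
proof -
  interpret A: category A using A by (simp add: discrete_category_def)
  let ?C = "linearization K A"
  let ?E = "enveloping_category K ?C" and ?X = "regular_bimodule K ?C"
  let ?F = "\<lambda>x y. free_module K (Hom A x y)"
  have C: "linear_category K ?C" by (rule linear_category_linearization[OF K A.category_axioms])
  note X = linear_functor_regular_bimodule[OF C] and E = linear_category_enveloping[OF C]
  have F: "Module.module K (?F x y)" for x y by (rule module_free_module[OF K])
  have Hom: "Hom A x y = (if x = y then {Ide A x} else {})" if "x \<in> Ob A" "y \<in> Ob A" for x y
    using A that A.ide_closed unfolding discrete_category_def by auto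
  have Val: "Val ?X (x, y) = ?F y x" for x y by (simp add: regular_bimodule_Val linearization_simps)
  have ob: "(x, y) \<in> LOb ?E \<longleftrightarrow> x \<in> Ob A \<and> y \<in> Ob A" for x y
    by (simp add: enveloping_category_simps linearization_simps)
  have expand: "a = a (Ide A x) \<odot>\<^bsub>?F x x\<^esub> basis_vector K (Ide A x)" if "x \<in> Ob A" "a \<in> carrier (?F x x)" for x a
    using free_module_singleton[OF K] that by (simp add: Hom)
  have coeff: "a s \<in> carrier K" if "a \<in> carrier (?F x y)" for a s x y using that by (auto simp: free_module_simps)
  have trivial: "a = \<zero>\<^bsub>?F x y\<^esub>" if "x \<in> Ob A" "y \<in> Ob A" "x \<noteq> y" "a \<in> carrier (?F x y)" for x y a
    using free_module_empty[of a K] that by (simp add: Hom)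
  have "\<exists>p. p \<in> carrier (Val P (x, x)) \<and> \<epsilon> (x, x) p = basis_vector K (Ide A x)" if "x \<in> Ob A" for x
  proof -
    have "basis_vector K (Ide A x) \<in> \<epsilon> (x, x) ` carrier (Val P (x, x))"
      using epi that basis_vector_closed[OF K A.ide_closed[OF that]] by (simp add: epimorphism_def ob Val)
    then show ?thesis by (metis imageE)
  qed
  then obtain p where p: "p x \<in> carrier (Val P (x, x))" "\<epsilon> (x, x) (p x) = basis_vector K (Ide A x)" if "x \<in> Ob A" for x
    by metis
  \<comment> \<open>\<open>a (Ide A x)\<close> is the coordinate of \<open>a\<close> with respect to
    the identity of \<open>x\<close>.\<close>
  let ?\<sigma> = "\<lambda>(x, y) a. if x = y then a (Ide A x) \<odot>\<^bsub>Val P (x, y)\<^esub> p x else \<zero>\<^bsub>Val P (x, y)\<^esub>"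
  have lin: "linear_map K (Val ?X d) (Val P d) (?\<sigma> d)" if "d \<in> LOb ?E" for d
  proof -
    obtain x y where d: "d = (x, y)" by (cases d)
    show ?thesis
    proof (cases "x = y")
      case True
      interpret P: Module.module K "Val P (y, y)" using linear_functor_module[OF P that] d True by simp
      have "p y \<in> carrier (Val P (y, y))" using p that ob d by simp
      then show ?thesis unfolding d Val using True
        by (intro linear_mapI) (auto simp: free_module_simps(2-) coeff P.smult_l_distr P.smult_assoc1)
    next
      case False
      then show ?thesis using linear_map_const_zero[OF linear_functor_module[OF X that] linear_functor_module[OF P that]]
        by (simp add: d)
    qed
  qed
  have "?\<sigma> e (Act ?X d e t v) = Act P d e t (?\<sigma> d v)"
    if d: "d \<in> LOb ?E" and e: "e \<in> LOb ?E" and t: "t \<in> carrier (LHom ?E d e)" and v: "v \<in> carrier (Val ?X d)" for d e t v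
  proof -
    note l = linear_map_comp[OF linear_functor_linear_left[OF X d e v] lin[OF e]]
      and l' = linear_functor_linear_left[OF P d e linear_map_closed[OF lin[OF d] v]]
      and m = linear_category_module[OF E d e] linear_functor_module[OF P e]
    obtain x y x' y' where de: "d = (x, y)" "e = (x', y')" by (cases d; cases e)
    have o: "x \<in> Ob A" "y \<in> Ob A" "x' \<in> Ob A" "y' \<in> Ob A" using d e ob de by simp_all
    have T: "LHom ?E d e = tensor_product K (?F x x') (?F y' y)"
      by (simp add: de enveloping_category_simps linearization_simps)
    show ?thesis
    proof (cases "x = x' \<and> y = y'")
      case True
      then have eq: "e = d" and T': "LHom ?E d d = tensor_product K (?F x x) (?F y y)" using de T by simp_all
      interpret Tm: Module.module K "LHom ?E d d" using m(1) eq by simp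
      note bil = bilinear_mapD[OF bilinear_pure_tensor[OF F F]]
      \<comment> \<open>Both coordinates come out of the tensor and leave a multiple of the identity
        of \<open>d\<close>, where naturality reduces to the identity laws of the two
        functors.\<close>
      have span: "pure_tensor K (?F x x) (?F y y) f g = g (Ide A y) \<odot>\<^bsub>LHom ?E d d\<^esub> (f (Ide A x) \<odot>\<^bsub>LHom ?E d d\<^esub> LIde ?E d)"
        if f: "f \<in> carrier (?F x x)" and g: "g \<in> carrier (?F y y)" for f g
      proof -
        note bx = basis_vector_closed[OF K A.ide_closed[OF o(1)]] and b_y = basis_vector_closed[OF K A.ide_closed[OF o(2)]]
        have "pure_tensor K (?F x x) (?F y y) f g
          = pure_tensor K (?F x x) (?F y y) (f (Ide A x) \<odot>\<^bsub>?F x x\<^esub> basis_vector K (Ide A x)) (g (Ide A y) \<odot>\<^bsub>?F y y\<^esub> basis_vector K (Ide A y))"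
          using expand[OF o(1) f] expand[OF o(2) g] by simp
        also have "\<dots> = g (Ide A y) \<odot>\<^bsub>LHom ?E d d\<^esub> (f (Ide A x) \<odot>\<^bsub>LHom ?E d d\<^esub> LIde ?E d)"
          unfolding T' using linear_map_smult[OF bil(1)] linear_map_smult[OF bil(2)] bx b_y f g coeff
          by (simp add: de enveloping_category_simps linearization_simps Module.module.smult_closed[OF F])
        finally show ?thesis .
      qed
      have ide: "?\<sigma> d (Act ?X d d (LIde ?E d) v) = Act P d d (LIde ?E d) (?\<sigma> d v)"
        using linear_functor_ide[OF X d v] linear_functor_ide[OF P d linear_map_closed[OF lin[OF d] v]] by simp
      show ?thesis unfolding eq
      proof (rule linear_map_tensor_eqI[OF F F, of "Val P d" _ _ _ _ "\<lambda>t. ?\<sigma> d (Act ?X d d t v)" "\<lambda>t. Act P d d t (?\<sigma> d v)"])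
        show "linear_map K (tensor_product K (?F x x) (?F y y)) (Val P d) (\<lambda>t. ?\<sigma> d (Act ?X d d t v))"
          "linear_map K (tensor_product K (?F x x) (?F y y)) (Val P d) (\<lambda>t. Act P d d t (?\<sigma> d v))"
          using l l' unfolding eq T' .
        show "Module.module K (Val P d)" using m(2) eq by simp
        show "t \<in> carrier (tensor_product K (?F x x) (?F y y))" using t unfolding eq T' .
        fix f g assume fg: "f \<in> carrier (?F x x)" "g \<in> carrier (?F y y)"
        show "?\<sigma> d (Act ?X d d (pure_tensor K (?F x x) (?F y y) f g) v) = Act P d d (pure_tensor K (?F x x) (?F y y) f g) (?\<sigma> d v)"
          using linear_map_smult[OF l] linear_map_smult[OF l'] ide coeff fg linear_category_ide[OF E d]
          by (simp add: span eq)
      qed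
    next
      case False
      \<comment> \<open>Between different objects of the enveloping category the zero morphism is
        the only one, and both sides vanish on it.\<close>
      then have "carrier (?F x x') \<subseteq> {\<zero>\<^bsub>?F x x'\<^esub>} \<or> carrier (?F y' y) \<subseteq> {\<zero>\<^bsub>?F y' y\<^esub>}"
        using trivial o by blast
      then have "t = \<zero>\<^bsub>LHom ?E d e\<^esub>" using tensor_product_trivial[OF F F] t unfolding T by blast
      then show ?thesis using linear_map_zero[OF m l] linear_map_zero[OF m l'] by simp
    qed
  qed
  then have "natural_family K ?E ?X P ?\<sigma>" unfolding natural_family_def using lin by blast
  moreover have "\<epsilon> d (?\<sigma> d v) = v" if d: "d \<in> LOb ?E" and v: "v \<in> carrier (Val ?X d)" for d v
  proof -
    obtain x y where xy: "d = (x, y)" by (cases d)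
    have o: "x \<in> Ob A" "y \<in> Ob A" and v': "v \<in> carrier (?F y x)" using d v by (simp_all add: xy ob Val)
    note \<epsilon>l = natural_family_linear[OF \<epsilon> d]
    show ?thesis
    proof (cases "x = y")
      case True
      have "\<epsilon> (x, x) (v (Ide A x) \<odot>\<^bsub>Val P (x, x)\<^esub> p x) = v (Ide A x) \<odot>\<^bsub>Val ?X (x, x)\<^esub> \<epsilon> (x, x) (p x)"
        using \<epsilon>l coeff[OF v'] p o by (intro linear_map_smult) (auto simp: xy True)
      also have "\<dots> = v" using expand[OF o(1), of v] v' True p(2)[OF o(1)] by (simp add: Val)
      finally show ?thesis by (simp add: xy True)
    next
      case False
      then show ?thesis using trivial[OF o(2,1) _ v'] linear_map_zero[OF linear_functor_module[OF P d] linear_functor_module[OF X d] \<epsilon>l]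
        by (simp add: xy Val)
    qed
  qed
  ultimately show ?thesis by (rule that)
qed

theorem corollary2p7:
  fixes K :: "('k, 'z) ring_scheme" and A :: "('o, 'm) category"
  assumes "infinite (UNIV :: 'u set)"
    and "field K" and "small TYPE('u) (carrier K)"
    and "delta_category A" and "small_category TYPE('u) A"
  shows "separable TYPE('u) K (linearization K A) \<longleftrightarrow> discrete_category A"
proof -
  interpret field K by fact
  interpret A: category A using assms(4) by (simp add: delta_category_def)
  let ?C = "linearization K A"
  have C: "linear_category K ?C" by (rule linear_category_linearization[OF is_cring A.category_axioms])
  have small: "small TYPE('u) (LOb ?C)"
    "\<And>x y. \<lbrakk>x \<in> LOb ?C; y \<in> LOb ?C\<rbrakk> \<Longrightarrow> small TYPE('u) (carrier (LHom ?C x y))"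
    using assms(5) by (auto simp: small_category_def linearization_simps intro!: small_free_module[OF assms(1,3)])
  note small_C = is_cring C assms(1,3) small
  show ?thesis
  proof
    assume sep: "separable TYPE('u) K ?C"
    let ?E = "enveloping_category K ?C" and ?X = "regular_bimodule K ?C"
    let ?F = "free_functor ?E (LOb ?C) (\<lambda>x. (x, x))"
    note E = linear_category_enveloping[OF C]
    have smallF: "small TYPE('u) (carrier (Val ?F d))" if "d \<in> LOb ?E" for d
      by (rule small_free_functor[OF is_cring E diagonal_object assms(1) small(1) that])
        (auto intro!: small_enveloping_category[OF assms(1) C assms(3) small(2) diagonal_object] that)
    obtain \<sigma> where \<sigma>: "natural_family K ?E ?X ?F \<sigma>"
      "\<And>d v. \<lbrakk>d \<in> LOb ?E; v \<in> carrier (Val ?X d)\<rbrakk> \<Longrightarrow>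
        free_lift ?E (LOb ?C) (\<lambda>x. (x, x)) ?X (LIde ?C) d (\<sigma> d v) = v"
      by (rule separable_section[OF small_C sep linear_functor_free_functor[OF is_cring E diagonal_object]
            smallF natural_family_diagonal_lift[OF is_cring C] epimorphism_diagonal_lift[OF is_cring C]]) blast+
    have disjoint: "carrier (LHom ?C z x) \<subseteq> {\<zero>\<^bsub>LHom ?C z x\<^esub>} \<or> carrier (LHom ?C x z) \<subseteq> {\<zero>\<^bsub>LHom ?C x z\<^esub>}"
      if "x \<in> LOb ?C" "z \<in> LOb ?C" "z \<noteq> x" for x z
    proof -
      have "Hom A z x = {} \<or> Hom A x z = {}"
        using delta_category_antisym[OF assms(4)] that unfolding linearization_simps by blast
      moreover have "carrier (free_module K {}) \<subseteq> {\<zero>\<^bsub>free_module K ({} :: 'm set)\<^esub>}"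
        using free_module_empty by blast
      ultimately show ?thesis unfolding linearization_simps by (elim disjE) simp_all
    qed
    have "x = y" if xy: "x \<in> Ob A" "y \<in> Ob A" "f \<in> Hom A x y" for x y f
    proof (rule ccontr)
      assume "x \<noteq> y"
      then have "basis_vector K f = \<zero>\<^bsub>LHom ?C x y\<^esub>"
        using xy basis_vector_closed[OF is_cring xy(3)]
        by (intro diagonal_section_vanishes[OF is_cring C \<sigma> disjoint]) (auto simp: linearization_simps)
      \<comment> \<open>At \<open>f\<close> the basis vector takes the value one, which differs from
        zero in a field.\<close>
      from fun_cong[OF this, of f] show False by (simp add: linearization_simps free_module_simps basis_vector_def)
    qed
    \<comment> \<open>Once source and target agree, the equation with the identity is the condition
      on endomorphisms in a delta category.\<close>
    then show "discrete_category A"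
      using assms(4) unfolding discrete_category_def delta_category_def by blast
  next
    assume A: "discrete_category A"
    show "separable TYPE('u) K ?C"
    proof (rule separableI[OF small_C])
      fix P :: "('o \<times> 'o, (('m \<Rightarrow> 'k) \<times> ('m \<Rightarrow> 'k) \<Rightarrow> 'k) set, 'k, 'u) module_functor" and \<epsilon>
      let ?E = "enveloping_category K ?C" and ?X = "regular_bimodule K ?C"
      assume "linear_functor K ?E P" "natural_family K ?E P ?X \<epsilon>" "epimorphism ?E P ?X \<epsilon>"
      then show "\<exists>\<sigma>. natural_family K ?E ?X P \<sigma> \<and> (\<forall>d \<in> LOb ?E. \<forall>x \<in> carrier (Val ?X d). \<epsilon> d (\<sigma> d x) = x)"
        by (rule discrete_regular_bimodule_section[OF is_cring A]) blast
    qed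
  qed
qed

end
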